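(* Let $A$ be an augmented ring and $C\subseteq A$ a subring that is a division ring, such that $A\supseteq C$ is a depth two extension. Let $V=A^C$ be the centralizer and $S=\operatorname{End}{}_CA_C$ the associated left $V$-bialgebroid. Suppose $A_V$ is faithfully flat. Then the left D3 intermediate division rings $B$ of $A\supseteq C$ are in Galois correspondence with the Galois left coideal subrings of $S$; that is, the maps $B\mapsto\operatorname{End}{}_CA_B$ and $\mathcal J\mapsto A^{\mathcal J}$ are mutually inverse order-reversing bijections between these two sets.
   Context: Rings are unital and subrings share the identity. $A$ is an augmented ring if there is given a ring homomorphism $A\to D$ with $D$ a division ring. $A\supseteq C$ is depth two (D2) if $A\otimes_CA$ is isomorphic to a direct summand of some $A^N$ both as $A$-$C$-bimodules and as $C$-$A$-bimodules. A ring $B$ with $C\subseteq B\subseteq A$ is a left D3 intermediate ring if, as $C$-$A$-bimodules, $A\otimes_BA$ is isomorphic to a direct summand of $A^N$ for some positive integer $N$. $V=A^C=\{a\in A:ac=ca\ \forall c\in C\}$. $S=\operatorname{End}{}_CA_C$ is the ring of $C$-$C$-bimodule endomorphisms of $A$ under composition, with $V$-$V$-bimodule structure $(v\cdot\beta\cdot v')(a)=v\beta(a)v'$. Since $A\,|\,C$ is D2 there are finitely many $\tilde\gamma_k\in S$, $\tilde u_k=\tilde u^1_k\otimes_C\tilde u^2_k\in(A\otimes_CA)^C$ with $x\otimes_Cy=\sum_kx\tilde\gamma_k(y)\tilde u_k$ for all $x,y\in A$, and $S$ is a left $V$-bialgebroid with coproduct $\Delta:S\to S\otimes_VS$, $\Delta(\beta)=\sum_k\tilde\gamma_k\otimes_V\tilde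 u^1_k\beta(\tilde u^2_k\,-)$, equivalently the unique element $\beta_{(1)}\otimes_V\beta_{(2)}$ with $\beta(xy)=\beta_{(1)}(x)\beta_{(2)}(y)$ for all $x,y\in A$; the counit is $\beta\mapsto\beta(1)$. A left coideal subring of $S$ is a subring $\mathcal J\subseteq S$ that is a left $V$-submodule with $\Delta(\mathcal J)\subseteq S\otimes_V\mathcal J$. It is a Galois left coideal subring if (1) the module ${}_V\mathcal J$ is finitely generated projective and (2) $A$ has no proper (i.e. nonzero and different from $A$) left ideals stable under $\mathcal J$ acting by evaluation. $\operatorname{End}{}_CA_B$ is the ring of $C$-$B$-bimodule endomorphisms of $A$, and $A^{\mathcal J}=\{x\in A:\alpha(x)=\alpha(1)x\ \text{for all }\alpha\in\mathcal J\}$. *)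

theory Defs
  imports "HOL-Algebra.Free_Abelian_Groups" "HOL-Algebra.Coset"
begin

text \<open>
  The ambient ring \<open>A\<close> is the whole type \<open>'a :: ring_1\<close>; its subrings are subsets of that type.
  (The class demands \<open>0 \<noteq> 1\<close>, which an augmentation into a division ring forces anyway.)
  Modules have explicit carriers, and their additive group is a commutative group in the
  multiplicative notation of HOL-Algebra. All scalars come from \<open>A\<close>; the ring acting is a subset
  of \<open>A\<close> given as a separate argument, so that restriction of scalars leaves the record unchanged.
\<close>

record ('a, 'm) lmod = "'m monoid" +
  lact :: "'a \<Rightarrow> 'm \<Rightarrow> 'm"

record ('a, 'm) bimod = "('a, 'm) lmod" +
  ract :: "'m \<Rightarrow> 'a \<Rightarrow> 'm"


section \<open>Subrings and augmentations\<close>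

definition unital_subring :: "'a::ring_1 set \<Rightarrow> bool" where
  "unital_subring B \<longleftrightarrow>
     1 \<in> B \<and> (\<forall>x\<in>B. \<forall>y\<in>B. x - y \<in> B) \<and> (\<forall>x\<in>B. \<forall>y\<in>B. x * y \<in> B)"

definition division_subring :: "'a::ring_1 set \<Rightarrow> bool" where
  "division_subring B \<longleftrightarrow>
     unital_subring B \<and> (\<forall>x\<in>B. x \<noteq> 0 \<longrightarrow> (\<exists>y\<in>B. x * y = 1 \<and> y * x = 1))"

definition augmentation :: "('a::ring_1 \<Rightarrow> 'd::division_ring) \<Rightarrow> bool" where
  "augmentation \<epsilon> \<longleftrightarrow>
     \<epsilon> 1 = 1 \<and> (\<forall>x y. \<epsilon> (x + y) = \<epsilon> x + \<epsilon> y) \<and> (\<forall>x y. \<epsilon> (x * y) = \<epsilon> x * \<epsilon> y)"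

definition centralizer :: "'a::ring_1 set \<Rightarrow> 'a set" where
  "centralizer C = {a. \<forall>c\<in>C. a * c = c * a}"


section \<open>Modules and bimodules\<close>

definition lmodule :: "'a::ring_1 set \<Rightarrow> ('a, 'm, 'x) lmod_scheme \<Rightarrow> bool" where
  "lmodule R M \<longleftrightarrow> comm_group M \<and>
     (\<forall>r\<in>R. \<forall>m\<in>carrier M. lact M r m \<in> carrier M) \<and>
     (\<forall>r\<in>R. \<forall>m\<in>carrier M. \<forall>n\<in>carrier M.
        lact M r (m \<otimes>\<^bsub>M\<^esub> n) = lact M r m \<otimes>\<^bsub>M\<^esub> lact M r n) \<and>
     (\<forall>r\<in>R. \<forall>s\<in>R. \<forall>m\<in>carrier M. lact M (r + s) m = lact M r m \<otimes>\<^bsub>M\<^esub> lact M s m) \<and>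
     (\<forall>r\<in>R. \<forall>s\<in>R. \<forall>m\<in>carrier M. lact M (r * s) m = lact M r (lact M s m)) \<and>
     (\<forall>m\<in>carrier M. lact M 1 m = m)"

definition lmodule_hom ::
  "'a set \<Rightarrow> ('a, 'm, 'x) lmod_scheme \<Rightarrow> ('a, 'n, 'y) lmod_scheme \<Rightarrow> ('m \<Rightarrow> 'n) set" where
  "lmodule_hom R M N = {f \<in> hom M N. \<forall>r\<in>R. \<forall>m\<in>carrier M. f (lact M r m) = lact N r (f m)}"

definition bimodule_hom ::
  "'a set \<Rightarrow> 'a set \<Rightarrow> ('a, 'm, 'x) bimod_scheme \<Rightarrow> ('a, 'n, 'y) bimod_scheme \<Rightarrow> ('m \<Rightarrow> 'n) set"
where
  "bimodule_hom L R M N =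
     {f \<in> lmodule_hom L M N. \<forall>r\<in>R. \<forall>m\<in>carrier M. f (ract M m r) = ract N (f m) r}"

definition lsubmodule :: "'a set \<Rightarrow> ('a, 'm, 'x) lmod_scheme \<Rightarrow> 'm set \<Rightarrow> bool" where
  "lsubmodule R M X \<longleftrightarrow> subgroup X M \<and> (\<forall>r\<in>R. \<forall>x\<in>X. lact M r x \<in> X)"

definition subbimodule :: "'a set \<Rightarrow> 'a set \<Rightarrow> ('a, 'm, 'x) bimod_scheme \<Rightarrow> 'm set \<Rightarrow> bool" where
  "subbimodule L R M X \<longleftrightarrow> lsubmodule L M X \<and> (\<forall>r\<in>R. \<forall>x\<in>X. ract M x r \<in> X)"

definition internal_direct_sum :: "('m, 'x) monoid_scheme \<Rightarrow> 'm set \<Rightarrow> 'm set \<Rightarrow> bool" where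
  "internal_direct_sum M X Y \<longleftrightarrow> X \<inter> Y = {\<one>\<^bsub>M\<^esub>} \<and> X <#>\<^bsub>M\<^esub> Y = carrier M"

text \<open>\<open>M\<close> is isomorphic to a direct summand of \<open>P\<close>, as left modules and as bimodules.\<close>

definition lmodule_summand ::
  "'a set \<Rightarrow> ('a, 'm, 'x) lmod_scheme \<Rightarrow> ('a, 'p, 'y) lmod_scheme \<Rightarrow> bool" where
  "lmodule_summand R M P \<longleftrightarrow>
     (\<exists>X Y f. lsubmodule R P X \<and> lsubmodule R P Y \<and> internal_direct_sum P X Y \<and>
        f \<in> lmodule_hom R M (P\<lparr>carrier := X\<rparr>) \<and> bij_betw f (carrier M) X)"

definition bimodule_summand ::
  "'a set \<Rightarrow> 'a set \<Rightarrow> ('a, 'm, 'x) bimod_scheme \<Rightarrow> ('a, 'p, 'y) bimod_scheme \<Rightarrow> bool" where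
  "bimodule_summand L R M P \<longleftrightarrow>
     (\<exists>X Y f. subbimodule L R P X \<and> subbimodule L R P Y \<and> internal_direct_sum P X Y \<and>
        f \<in> bimodule_hom L R M (P\<lparr>carrier := X\<rparr>) \<and> bij_betw f (carrier M) X)"

definition regular :: "('a::ring_1, 'a) bimod" where
  "regular = \<lparr>carrier = UNIV, monoid.mult = (+), one = 0, lact = (*), ract = (*)\<rparr>"

definition power_bimod :: "('a, 'm, 'x) bimod_scheme \<Rightarrow> nat \<Rightarrow> ('a, nat \<Rightarrow> 'm) bimod" where
  "power_bimod M n =
     (let P = product_group {..<n} (\<lambda>_. M) in
      \<lparr>carrier = carrier P, monoid.mult = monoid.mult P, one = one P,
       lact = (\<lambda>a x. \<lambda>i\<in>{..<n}. lact M a (x i)), ract = (\<lambda>x a. \<lambda>i\<in>{..<n}. ract M (x i) a)\<rparr>)"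

definition free_lmod :: "'a::ring_1 set \<Rightarrow> 'i set \<Rightarrow> ('a, 'i \<Rightarrow> 'a) lmod" where
  "free_lmod R I =
     (let P = sum_group I (\<lambda>_. regular\<lparr>carrier := R\<rparr>) in
      \<lparr>carrier = carrier P, monoid.mult = monoid.mult P, one = one P,
       lact = (\<lambda>a x. \<lambda>i\<in>I. a * x i)\<rparr>)"

definition fin_generated :: "'a set \<Rightarrow> ('a, 'm, 'x) lmod_scheme \<Rightarrow> bool" where
  "fin_generated R M \<longleftrightarrow>
     (\<exists>F. finite F \<and> F \<subseteq> carrier M \<and> (\<forall>X. lsubmodule R M X \<and> F \<subseteq> X \<longrightarrow> X = carrier M))"

text \<open>
  Basis elements are drawn from the type of the module itself; this is no restriction, since a
  projective module is a direct summand of the free module on its own carrier.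
\<close>

definition projective :: "'a::ring_1 set \<Rightarrow> ('a, 'm, 'x) lmod_scheme \<Rightarrow> bool" where
  "projective R M \<longleftrightarrow> (\<exists>I :: 'm set. lmodule_summand R M (free_lmod R I))"


section \<open>Tensor products\<close>

text \<open>
  \<open>M \<otimes>\<^sub>R N\<close> is the free abelian group on \<open>M \<times> N\<close> modulo the subgroup generated by the usual
  relations, so its elements are cosets of formal sums of pairs.
\<close>

definition tensor_rels ::
  "'a set \<Rightarrow> ('a, 'm, 'x) bimod_scheme \<Rightarrow> ('a, 'n, 'y) lmod_scheme \<Rightarrow> ('m \<times> 'n \<Rightarrow>\<^sub>0 int) set" where
  "tensor_rels R M N = generate (free_Abelian_group (carrier M \<times> carrier N))
     ({frag_of (m \<otimes>\<^bsub>M\<^esub> m', n) - frag_of (m, n) - frag_of (m', n) | m m' n.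
         m \<in> carrier M \<and> m' \<in> carrier M \<and> n \<in> carrier N} \<union>
      {frag_of (m, n \<otimes>\<^bsub>N\<^esub> n') - frag_of (m, n) - frag_of (m, n') | m n n'.
         m \<in> carrier M \<and> n \<in> carrier N \<and> n' \<in> carrier N} \<union>
      {frag_of (ract M m r, n) - frag_of (m, lact N r n) | m r n.
         m \<in> carrier M \<and> r \<in> R \<and> n \<in> carrier N})"

definition tensor ::
  "'a set \<Rightarrow> ('a, 'm, 'x) bimod_scheme \<Rightarrow> ('a, 'n, 'y) lmod_scheme \<Rightarrow> ('m \<times> 'n \<Rightarrow>\<^sub>0 int) set monoid"
where
  "tensor R M N = free_Abelian_group (carrier M \<times> carrier N) Mod tensor_rels R M N"

text \<open>
  The map \<open>f \<otimes> g\<close> into \<open>M' \<otimes>\<^sub>R N'\<close>. For \<open>R\<close>-linear \<open>f\<close> and \<open>g\<close> all representatives of a coset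
  are sent into one and the same coset, and the union below is that coset.
\<close>

definition tensor_map ::
  "'a set \<Rightarrow> ('a, 'p, 'x) bimod_scheme \<Rightarrow> ('a, 'q, 'y) lmod_scheme \<Rightarrow> ('m \<Rightarrow> 'p) \<Rightarrow> ('n \<Rightarrow> 'q) \<Rightarrow>
   ('m \<times> 'n \<Rightarrow>\<^sub>0 int) set \<Rightarrow> ('p \<times> 'q \<Rightarrow>\<^sub>0 int) set" where
  "tensor_map R M' N' f g t =
     (\<Union>c\<in>t. tensor_rels R M' N' #>\<^bsub>free_Abelian_group (carrier M' \<times> carrier N')\<^esub>
        frag_extend (\<lambda>(m, n). frag_of (f m, g n)) c)"

definition tensor_bimod ::
  "'a set \<Rightarrow> ('a, 'm, 'x) bimod_scheme \<Rightarrow> ('a, 'n, 'y) bimod_scheme \<Rightarrow>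
   ('a, ('m \<times> 'n \<Rightarrow>\<^sub>0 int) set) bimod" where
  "tensor_bimod R M N =
     (let T = tensor R M N in
      \<lparr>carrier = carrier T, monoid.mult = monoid.mult T, one = one T,
       lact = (\<lambda>a. tensor_map R M N (lact M a) id),
       ract = (\<lambda>t a. tensor_map R M N id (\<lambda>n. ract N n a) t)\<rparr>)"


section \<open>Faithful flatness\<close>

definition exact_at ::
  "('m, 'x) monoid_scheme \<Rightarrow> ('n, 'y) monoid_scheme \<Rightarrow> ('p, 'z) monoid_scheme \<Rightarrow>
   ('m \<Rightarrow> 'n) \<Rightarrow> ('n \<Rightarrow> 'p) \<Rightarrow> bool" where
  "exact_at X Y Z f g \<longleftrightarrow> f ` carrier X = kernel Y Z g"

text \<open>
  The right \<open>R\<close>-module \<open>M\<close> is faithfully flat: a sequence of left \<open>R\<close>-modules is exact iff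
  tensoring with \<open>M\<close> makes it exact. HOL cannot quantify over types, so the modules in the test
  sequences have carriers in one type \<open>'m\<close>. As soon as \<open>R\<close> injects into \<open>'m\<close> this is the usual
  notion, because the inclusions of left ideals into \<open>R\<close> and the cyclic left \<open>R\<close>-modules
  already detect flatness and faithfulness.
\<close>

definition faithfully_flat ::
  "'m itself \<Rightarrow> 'a::ring_1 set \<Rightarrow> ('a, 'n, 'x) bimod_scheme \<Rightarrow> bool" where
  "faithfully_flat _ R M \<longleftrightarrow>
     (\<forall>(X :: ('a, 'm) lmod) (Y :: ('a, 'm) lmod) (Z :: ('a, 'm) lmod) f g.
        lmodule R X \<and> lmodule R Y \<and> lmodule R Z \<and>
        f \<in> lmodule_hom R X Y \<and> g \<in> lmodule_hom R Y Z \<longrightarrow>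
        (exact_at X Y Z f g \<longleftrightarrow>
         exact_at (tensor R M X) (tensor R M Y) (tensor R M Z)
           (tensor_map R M Y id f) (tensor_map R M Z id g)))"


section \<open>Depth two and left D3\<close>

definition depth_two :: "'a::ring_1 set \<Rightarrow> bool" where
  "depth_two C \<longleftrightarrow> (\<exists>N.
     bimodule_summand UNIV C (tensor_bimod C regular regular) (power_bimod regular N) \<and>
     bimodule_summand C UNIV (tensor_bimod C regular regular) (power_bimod regular N))"

definition left_D3 :: "'a::ring_1 set \<Rightarrow> 'a set \<Rightarrow> bool" where
  "left_D3 C B \<longleftrightarrow> unital_subring B \<and> C \<subseteq> B \<and>
     (\<exists>N>0. bimodule_summand C UNIV (tensor_bimod B regular regular) (power_bimod regular N))"


section \<open>The bialgebroid of endomorphisms\<close>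

definition End_bimod :: "'a::ring_1 set \<Rightarrow> 'a set \<Rightarrow> ('a \<Rightarrow> 'a) set" where
  "End_bimod L R = bimodule_hom L R regular regular"

text \<open>\<open>S = End\<^sub>C A\<^sub>C\<close> with its bimodule structure over the centralizer of \<open>C\<close>.\<close>

definition S_bimod :: "'a::ring_1 set \<Rightarrow> ('a, 'a \<Rightarrow> 'a) bimod" where
  "S_bimod C =
     \<lparr>carrier = End_bimod C C, monoid.mult = (\<lambda>\<alpha> \<beta> a. \<alpha> a + \<beta> a), one = (\<lambda>_. 0),
      lact = (\<lambda>v \<beta> a. v * \<beta> a), ract = (\<lambda>\<beta> v a. \<beta> a * v)\<rparr>"

text \<open>A formal sum \<open>\<Sum> n\<^sub>i (\<beta>\<^sub>i, \<gamma>\<^sub>i)\<close> is evaluated at \<open>(x, y)\<close> to \<open>\<Sum> n\<^sub>i \<beta>\<^sub>i(x) \<gamma>\<^sub>i(y)\<close>.\<close>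

definition tensor_eval :: "(('a::ring_1 \<Rightarrow> 'a) \<times> ('a \<Rightarrow> 'a) \<Rightarrow>\<^sub>0 int) \<Rightarrow> 'a \<Rightarrow> 'a \<Rightarrow> 'a" where
  "tensor_eval c x y =
     (\<Sum>(\<beta>, \<gamma>)\<in>Poly_Mapping.keys c. of_int (Poly_Mapping.lookup c (\<beta>, \<gamma>)) * (\<beta> x * \<gamma> y))"

text \<open>
  \<open>\<Delta>(\<beta>)\<close> is the unique element of \<open>S \<otimes>\<^sub>V S\<close> with \<open>\<beta>(xy) = \<beta>\<^sub>(\<^sub>1\<^sub>)(x) \<beta>\<^sub>(\<^sub>2\<^sub>)(y)\<close>; for a depth two
  extension it exists and is unique. Evaluation is constant on cosets, so it makes no difference
  that every representative is asked to satisfy the equation.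
\<close>

definition coproduct ::
  "'a::ring_1 set \<Rightarrow> ('a \<Rightarrow> 'a) \<Rightarrow> (('a \<Rightarrow> 'a) \<times> ('a \<Rightarrow> 'a) \<Rightarrow>\<^sub>0 int) set" where
  "coproduct C \<beta> =
     (THE t. t \<in> carrier (tensor (centralizer C) (S_bimod C) (S_bimod C)) \<and>
        (\<forall>c\<in>t. \<forall>x y. \<beta> (x * y) = tensor_eval c x y))"

text \<open>
  Multiplication in \<open>S\<close> is composition. The inclusion \<open>\<Delta>(J) \<subseteq> S \<otimes>\<^sub>V J\<close> refers to the image of
  the canonical map \<open>S \<otimes>\<^sub>V J \<rightarrow> S \<otimes>\<^sub>V S\<close>.
\<close>

definition left_coideal_subring :: "'a::ring_1 set \<Rightarrow> ('a \<Rightarrow> 'a) set \<Rightarrow> bool" where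
  "left_coideal_subring C J \<longleftrightarrow>
     (let S = S_bimod C; V = centralizer C in
      lsubmodule V S J \<and> id \<in> J \<and> (\<forall>\<alpha>\<in>J. \<forall>\<beta>\<in>J. \<alpha> \<circ> \<beta> \<in> J) \<and>
      coproduct C ` J \<subseteq> tensor_map V S S id id ` carrier (tensor V S (S\<lparr>carrier := J\<rparr>)))"

definition galois_left_coideal_subring :: "'a::ring_1 set \<Rightarrow> ('a \<Rightarrow> 'a) set \<Rightarrow> bool" where
  "galois_left_coideal_subring C J \<longleftrightarrow>
     left_coideal_subring C J \<and>
     fin_generated (centralizer C) ((S_bimod C)\<lparr>carrier := J\<rparr>) \<and>
     projective (centralizer C) ((S_bimod C)\<lparr>carrier := J\<rparr>) \<and>
     (\<forall>I. lsubmodule UNIV regular I \<and> (\<forall>\<alpha>\<in>J. \<alpha> ` I \<subseteq> I) \<longrightarrow> I = {0} \<or> I = UNIV)"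

definition fixed_points :: "('a::ring_1 \<Rightarrow> 'a) set \<Rightarrow> 'a set" where
  "fixed_points J = {x. \<forall>\<alpha>\<in>J. \<alpha> x = \<alpha> 1 * x}"

end

theory Submission
  imports Defs
begin

text \<open>
  Suppose first that \<open>B\<close> is a left D3 intermediate division ring and \<open>J = End\<^sub>C A\<^sub>B\<close>. The D3 condition
  amounts to a quasibasis: maps \<open>\<gamma>\<^sub>i \<in> J\<close> and elements \<open>u\<^sub>i\<close> of \<open>A \<otimes>\<^sub>B A\<close> commuting with \<open>C\<close> such that
  \<open>x \<otimes> y = \<Sum> u\<^sub>i \<gamma>\<^sub>i(x) y\<close> (\<open>ex_right_quasibasis\<close>). Applying \<open>a \<otimes> b \<mapsto> F(a) b\<close> to it gives
  \<open>F = \<Sum> F(u\<^sub>i\<^sup>1) u\<^sub>i\<^sup>2 \<gamma>\<^sub>i\<close> for every right \<open>B\<close>-linear \<open>F\<close>, with coefficients in \<open>V\<close> if \<open>F \<in> J\<close>. So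
  the \<open>\<gamma>\<^sub>i\<close> belong to a finite dual basis of \<open>J\<close> over \<open>V\<close>, and \<open>A J\<close> is the ring \<open>End A\<^sub>B\<close> of all
  endomorphisms of a vector space over \<open>B\<close>. That ring acts transitively enough to leave no stable
  left ideals other than \<open>0\<close> and \<open>A\<close>, and to fix only \<open>B\<close>. The depth two quasibases make the coproduct
  explicit and unique, and the explicit formula shows \<open>\<Delta>(J) \<subseteq> S \<otimes>\<^sub>V J\<close>.

  Conversely let \<open>J\<close> be a Galois left coideal subring and \<open>B = A\<^sup>J\<close>. The coideal condition, rewritten as
  a statement about \<open>\<beta>(x y)\<close> in \<open>left_coideal_subring_iff\<close>, says that \<open>A J\<close> is closed under composition
  and that \<open>J\<close> is right \<open>B\<close>-linear. So \<open>A\<close> is a simple module over the ring \<open>A J\<close>, and \<open>B\<close> acts on it from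
  the right by commuting endomorphisms; Schur's lemma makes \<open>B\<close> a division ring. The argument of the
  Jacobson--Bourbaki theorem now applies: by density, a system of elements \<open>x\<^sub>j\<close> with dual functionals in
  \<open>A J\<close> can be enlarged unless it is a basis of \<open>A\<close> over \<open>B\<close>, while the augmentation, by passing to
  matrices over a division ring, bounds its length by the number of generators of \<open>J\<close>
  (\<open>ex_basis_over_fixed\<close>). Therefore \<open>A\<close> is finite dimensional over \<open>B\<close> and \<open>A J = End A\<^sub>B\<close>.

  It remains to descend from \<open>A J\<close> to \<open>J\<close>. By depth two, \<open>A \<otimes>\<^sub>V S\<close> embeds into \<open>End A\<close>, and flatness of
  \<open>A\<^sub>V\<close> embeds \<open>A \<otimes>\<^sub>V J\<close> into \<open>A \<otimes>\<^sub>V S\<close>; so a dual basis \<open>(e\<^sub>i, \<phi>\<^sub>i)\<close> of \<open>J\<close> over \<open>V\<close> extends to left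
  \<open>A\<close>-linear coordinates \<open>\<Phi>\<^sub>i\<close> on \<open>A J\<close> (\<open>ex_A_span_coordinates\<close>). An element of \<open>End\<^sub>C A\<^sub>B\<close> lies in \<open>A J\<close>
  and has coordinates in \<open>V\<close>, hence it is in \<open>J\<close>; and the \<open>e\<^sub>i\<close> with \<open>u\<^sub>i = \<Sum> x\<^sub>j \<otimes> \<Phi>\<^sub>i(F\<^sub>j)\<close>, where \<open>F\<^sub>j\<close> is
  dual to \<open>x\<^sub>j\<close>, are a quasibasis that makes \<open>B\<close> left D3 (\<open>End_fixed_and_left_D3\<close>).
\<close>

section \<open>Formal sums of pairs and tensor products\<close>

text \<open>
  A map on pairs extends additively to formal sums. This single sum serves for all the ring-valued
  maps out of tensor products used below: \<open>a \<otimes> b \<mapsto> F(a) b\<close>, \<open>\<beta> \<otimes> \<gamma> \<mapsto> \<beta>(x) \<gamma>(y)\<close>, and so on.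
\<close>

definition frag_eval :: "('m \<Rightarrow> 'n \<Rightarrow> 'b::ring_1) \<Rightarrow> ('m \<times> 'n \<Rightarrow>\<^sub>0 int) \<Rightarrow> 'b" where
  "frag_eval h c = (\<Sum>(m, n)\<in>Poly_Mapping.keys c. of_int (Poly_Mapping.lookup c (m, n)) * h m n)"

lemma tensor_eval_frag_eval: "tensor_eval c x y = frag_eval (\<lambda>\<beta> \<gamma>. \<beta> x * \<gamma> y) c"
  unfolding tensor_eval_def frag_eval_def ..

lemma frag_eval_superset:
  assumes "finite K" "Poly_Mapping.keys c \<subseteq> K"
  shows "frag_eval h c = (\<Sum>p\<in>K. of_int (Poly_Mapping.lookup c p) * h (fst p) (snd p))"
  unfolding frag_eval_def using assms
  by (intro sum.mono_neutral_cong_left) (auto simp: in_keys_iff split: prod.splits)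

lemma frag_eval_0 [simp]: "frag_eval h 0 = 0"
  by (simp add: frag_eval_def)

lemma frag_eval_frag_of [simp]: "frag_eval h (frag_of (m, n)) = h m n"
  by (simp add: frag_eval_def)

lemma frag_eval_add [simp]: "frag_eval h (c + d) = frag_eval h c + frag_eval h d"
proof -
  let ?K = "Poly_Mapping.keys c \<union> Poly_Mapping.keys d"
  have "Poly_Mapping.keys (c + d) \<subseteq> ?K"
    by (rule keys_add)
  then show ?thesis
    by (simp add: frag_eval_superset[of ?K] lookup_add distrib_right sum.distrib)
qed

lemma frag_eval_minus [simp]: "frag_eval h (- c) = - frag_eval h c"
  using frag_eval_add[of h c "- c"] by (simp add: add_eq_0_iff)

lemma frag_eval_diff [simp]: "frag_eval h (c - d) = frag_eval h c - frag_eval h d"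
  using frag_eval_add[of h c "- d"] by simp

lemma frag_eval_sum [simp]: "frag_eval h (\<Sum>i\<in>I. c i) = (\<Sum>i\<in>I. frag_eval h (c i))"
  by (induction I rule: infinite_finite_induct) auto

lemma frag_eval_cong:
  assumes "\<And>m n. (m, n) \<in> Poly_Mapping.keys c \<Longrightarrow> h m n = h' m n"
  shows "frag_eval h c = frag_eval h' c"
  unfolding frag_eval_def using assms by (intro sum.cong) auto

lemma frag_eval_zero_fun [simp]: "frag_eval (\<lambda>m n. 0) c = 0"
  by (simp add: frag_eval_def)

lemma frag_eval_add_fun: "frag_eval (\<lambda>m n. h m n + h' m n) c = frag_eval h c + frag_eval h' c"
  by (simp add: frag_eval_def distrib_left sum.distrib case_prod_unfold)

lemma frag_eval_sum_fun: "frag_eval (\<lambda>m n. \<Sum>i\<in>I. h i m n) c = (\<Sum>i\<in>I. frag_eval (h i) c)"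
  by (induction I rule: infinite_finite_induct) (auto simp: frag_eval_add_fun)

lemma frag_eval_mult_right: "frag_eval (\<lambda>m n. h m n * a) c = frag_eval h c * a"
  by (simp add: frag_eval_def sum_distrib_right case_prod_unfold mult.assoc)

lemma frag_pair_induct [case_names zero pair diff]:
  fixes c :: "'m \<times> 'n \<Rightarrow>\<^sub>0 int"
  assumes "P 0" "\<And>m n. P (frag_of (m, n))" "\<And>c d. P c \<Longrightarrow> P d \<Longrightarrow> P (c - d)"
  shows "P c"
  using free_Abelian_group_induct[of c UNIV P] assms by auto

lemma frag_eval_mult_left: "frag_eval (\<lambda>m n. a * h m n) c = a * frag_eval h c"
  by (induction c rule: frag_pair_induct) (auto simp: right_diff_distrib)

text \<open>
  On representatives, this is \<open>f \<otimes> g\<close>.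
\<close>

definition frag_map :: "('m \<Rightarrow> 'p) \<Rightarrow> ('n \<Rightarrow> 'q) \<Rightarrow> ('m \<times> 'n \<Rightarrow>\<^sub>0 int) \<Rightarrow> ('p \<times> 'q \<Rightarrow>\<^sub>0 int)" where
  "frag_map f g = frag_extend (\<lambda>(m, n). frag_of (f m, g n))"

lemma frag_map_simps [simp]:
  "frag_map f g 0 = 0"
  "frag_map f g (frag_of (m, n)) = frag_of (f m, g n)"
  "frag_map f g (c + d) = frag_map f g c + frag_map f g d"
  "frag_map f g (c - d) = frag_map f g c - frag_map f g d"
  "frag_map f g (- c) = - frag_map f g c"
  by (simp_all add: frag_map_def frag_extend_add frag_extend_diff frag_extend_minus)

lemma frag_map_sum: "frag_map f g (\<Sum>i\<in>I. c i) = (\<Sum>i\<in>I. frag_map f g (c i))"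
  by (induction I rule: infinite_finite_induct) auto

lemma frag_eval_frag_map: "frag_eval h (frag_map f g c) = frag_eval (\<lambda>m n. h (f m) (g n)) c"
  by (induction c rule: frag_pair_induct) auto

lemma frag_map_id [simp]: "frag_map id id c = c"
  by (induction c rule: frag_pair_induct) auto

lemma keys_frag_map:
  assumes "Poly_Mapping.keys c \<subseteq> A \<times> B" "f ` A \<subseteq> A'" "g ` B \<subseteq> B'"
  shows "Poly_Mapping.keys (frag_map f g c) \<subseteq> A' \<times> B'"
proof -
  have "Poly_Mapping.keys (frag_map f g c)
      \<subseteq> (\<Union>x\<in>Poly_Mapping.keys c. Poly_Mapping.keys (case x of (m, n) \<Rightarrow> frag_of (f m, g n)))"
    unfolding frag_map_def by (rule keys_frag_extend)
  also have "\<dots> \<subseteq> A' \<times> B'"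
    using assms by (fastforce simp: image_subset_iff)
  finally show ?thesis .
qed

text \<open>
  The element of \<open>M \<otimes>\<^sub>R N\<close> represented by a formal sum.
\<close>

definition tensor_class ::
  "'a set \<Rightarrow> ('a, 'm, 'x) bimod_scheme \<Rightarrow> ('a, 'n, 'y) lmod_scheme \<Rightarrow>
   ('m \<times> 'n \<Rightarrow>\<^sub>0 int) \<Rightarrow> ('m \<times> 'n \<Rightarrow>\<^sub>0 int) set" where
  "tensor_class R M N c =
     tensor_rels R M N #>\<^bsub>free_Abelian_group (carrier M \<times> carrier N)\<^esub> c"

text \<open>
  The universal property of the tensor product is used only in this form: a balanced map vanishes on
  the tensor relations, so its additive extension may be evaluated on any representative.
\<close>

definition balanced ::
  "'a set \<Rightarrow> ('a, 'm, 'x) bimod_scheme \<Rightarrow> ('a, 'n, 'y) lmod_scheme \<Rightarrow> ('m \<Rightarrow> 'n \<Rightarrow> 'b::ring_1) \<Rightarrow> bool"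
where
  "balanced R M N h \<longleftrightarrow>
     (\<forall>m\<in>carrier M. \<forall>m'\<in>carrier M. \<forall>n\<in>carrier N. h (m \<otimes>\<^bsub>M\<^esub> m') n = h m n + h m' n) \<and>
     (\<forall>m\<in>carrier M. \<forall>n\<in>carrier N. \<forall>n'\<in>carrier N. h m (n \<otimes>\<^bsub>N\<^esub> n') = h m n + h m n') \<and>
     (\<forall>m\<in>carrier M. \<forall>r\<in>R. \<forall>n\<in>carrier N. h (ract M m r) n = h m (lact N r n))"

text \<open>
  Closure under the operations makes the tensor relations formal sums of pairs, which is what the
  manipulation of cosets rests on.
\<close>

locale tensor_factors =
  fixes R :: "'a set"
    and M :: "('a, 'm, 'x) bimod_scheme"
    and N :: "('a, 'n, 'y) lmod_scheme"
  assumes M_mult: "\<And>m m'. m \<in> carrier M \<Longrightarrow> m' \<in> carrier M \<Longrightarrow> m \<otimes>\<^bsub>M\<^esub> m' \<in> carrier M"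
    and N_mult: "\<And>n n'. n \<in> carrier N \<Longrightarrow> n' \<in> carrier N \<Longrightarrow> n \<otimes>\<^bsub>N\<^esub> n' \<in> carrier N"
    and M_act: "\<And>m r. m \<in> carrier M \<Longrightarrow> r \<in> R \<Longrightarrow> ract M m r \<in> carrier M"
    and N_act: "\<And>n r. n \<in> carrier N \<Longrightarrow> r \<in> R \<Longrightarrow> lact N r n \<in> carrier N"
begin

abbreviation "cls \<equiv> tensor_class R M N"
abbreviation "rels \<equiv> tensor_rels R M N"
abbreviation "pairs \<equiv> carrier M \<times> carrier N"

lemma rels_generators:
  "{frag_of (m \<otimes>\<^bsub>M\<^esub> m', n) - frag_of (m, n) - frag_of (m', n) | m m' n.
         m \<in> carrier M \<and> m' \<in> carrier M \<and> n \<in> carrier N} \<union>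
      {frag_of (m, n \<otimes>\<^bsub>N\<^esub> n') - frag_of (m, n) - frag_of (m, n') | m n n'.
         m \<in> carrier M \<and> n \<in> carrier N \<and> n' \<in> carrier N} \<union>
      {frag_of (ract M m r, n) - frag_of (m, lact N r n) | m r n.
         m \<in> carrier M \<and> r \<in> R \<and> n \<in> carrier N}
   \<subseteq> carrier (free_Abelian_group pairs)"
proof -
  have *: "Poly_Mapping.keys (a - b) \<subseteq> P"
    if "Poly_Mapping.keys a \<subseteq> P" "Poly_Mapping.keys b \<subseteq> P" for a b :: "('m \<times> 'n) \<Rightarrow>\<^sub>0 int" and P
    using keys_diff[of a b] that by blast
  show ?thesis
    unfolding carrier_free_Abelian_group_iff subset_iff[of _ "carrier _"]
    by (intro allI impI, elim UnE CollectE exE conjE; hypsubst; intro *)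
      (simp_all add: M_mult N_mult M_act N_act)
qed

lemma subgroup_rels: "subgroup rels (free_Abelian_group pairs)"
  unfolding tensor_rels_def
  by (rule group.generate_is_subgroup[OF group_free_Abelian_group rels_generators])

lemma normal_rels: "rels \<lhd> free_Abelian_group pairs"
  by (rule comm_group.subgroup_imp_normal[OF abelian_free_Abelian_group subgroup_rels])

lemma rels_closed:
  "0 \<in> rels" "c \<in> rels \<Longrightarrow> d \<in> rels \<Longrightarrow> c + d \<in> rels" "c \<in> rels \<Longrightarrow> - c \<in> rels"
  "c \<in> rels \<Longrightarrow> d \<in> rels \<Longrightarrow> c - d \<in> rels"
proof -
  show z: "0 \<in> rels"
    using subgroup.one_closed[OF subgroup_rels] by simp
  show a: "c + d \<in> rels" if "c \<in> rels" "d \<in> rels" for c d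
    using subgroup.m_closed[OF subgroup_rels that] by simp
  show m: "- c \<in> rels" if "c \<in> rels" for c
    using subgroup.m_inv_closed[OF subgroup_rels that] subgroup.mem_carrier[OF subgroup_rels that]
    by simp
  show "c - d \<in> rels" if "c \<in> rels" "d \<in> rels"
    using a[OF that(1) m[OF that(2)]] by simp
qed

lemma rels_keys: "c \<in> rels \<Longrightarrow> Poly_Mapping.keys c \<subseteq> pairs"
  using subgroup.mem_carrier[OF subgroup_rels] by simp

lemma rels_basic:
  "m \<in> carrier M \<Longrightarrow> m' \<in> carrier M \<Longrightarrow> n \<in> carrier N \<Longrightarrow>
     frag_of (m \<otimes>\<^bsub>M\<^esub> m', n) - frag_of (m, n) - frag_of (m', n) \<in> rels"
  "m \<in> carrier M \<Longrightarrow> n \<in> carrier N \<Longrightarrow> n' \<in> carrier N \<Longrightarrow>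
     frag_of (m, n \<otimes>\<^bsub>N\<^esub> n') - frag_of (m, n) - frag_of (m, n') \<in> rels"
  "m \<in> carrier M \<Longrightarrow> r \<in> R \<Longrightarrow> n \<in> carrier N \<Longrightarrow>
     frag_of (ract M m r, n) - frag_of (m, lact N r n) \<in> rels"
  unfolding tensor_rels_def by (rule generate.incl, blast)+

lemma rels_induct [consumes 1, case_names left right middle zero add minus]:
  assumes "c \<in> rels"
    and "\<And>m m' n. m \<in> carrier M \<Longrightarrow> m' \<in> carrier M \<Longrightarrow> n \<in> carrier N \<Longrightarrow>
       P (frag_of (m \<otimes>\<^bsub>M\<^esub> m', n) - frag_of (m, n) - frag_of (m', n))"
    and "\<And>m n n'. m \<in> carrier M \<Longrightarrow> n \<in> carrier N \<Longrightarrow> n' \<in> carrier N \<Longrightarrow>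
       P (frag_of (m, n \<otimes>\<^bsub>N\<^esub> n') - frag_of (m, n) - frag_of (m, n'))"
    and "\<And>m r n. m \<in> carrier M \<Longrightarrow> r \<in> R \<Longrightarrow> n \<in> carrier N \<Longrightarrow>
       P (frag_of (ract M m r, n) - frag_of (m, lact N r n))"
    and "P 0" and "\<And>c d. P c \<Longrightarrow> P d \<Longrightarrow> P (c + d)" and "\<And>c. P c \<Longrightarrow> P (- c)"
  shows "P c"
  using assms(1) unfolding tensor_rels_def
proof (induction rule: generate.induct)
  case one
  then show ?case using assms(5) by simp
next
  case (incl h)
  then show ?case using assms(2-4) by blast
next
  case (inv h)
  then have "P h" using assms(2-4) by blast
  moreover have "h \<in> carrier (free_Abelian_group pairs)"
    by (rule subsetD[OF rels_generators inv])
  ultimately show ?case using assms(7) by simp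
next
  case (eng h1 h2)
  then show ?case using assms(6) by simp
qed

lemma cls_eq_iff:
  assumes "Poly_Mapping.keys c \<subseteq> pairs" "Poly_Mapping.keys d \<subseteq> pairs"
  shows "cls c = cls d \<longleftrightarrow> c - d \<in> rels"
proof -
  have "cls c = cls d \<longleftrightarrow> c \<in> cls d"
    using assms group.repr_independence[OF group_free_Abelian_group _ _ subgroup_rels, of c d]
      group.rcos_self[OF group_free_Abelian_group _ subgroup_rels, of c]
    by (auto simp: tensor_class_def)
  also have "\<dots> \<longleftrightarrow> c - d \<in> rels"
    by (auto simp: tensor_class_def r_coset_def intro: bexI[of _ "c - d"])
  finally show ?thesis .
qed

lemma mem_cls_iff: "d \<in> cls c \<longleftrightarrow> d - c \<in> rels"
  by (auto simp: tensor_class_def r_coset_def intro: bexI[of _ "d - c"])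

lemma carrier_tensor: "carrier (tensor R M N) = cls ` {c. Poly_Mapping.keys c \<subseteq> pairs}"
  by (auto simp: tensor_def FactGroup_def RCOSETS_def tensor_class_def)

lemma mult_tensor:
  assumes "Poly_Mapping.keys c \<subseteq> pairs" "Poly_Mapping.keys d \<subseteq> pairs"
  shows "cls c \<otimes>\<^bsub>tensor R M N\<^esub> cls d = cls (c + d)"
  using normal.rcos_sum[OF normal_rels, of c d] assms
  by (simp add: tensor_def FactGroup_def tensor_class_def)

lemma one_tensor: "\<one>\<^bsub>tensor R M N\<^esub> = cls 0"
  using group.coset_join2[OF group_free_Abelian_group _ subgroup_rels, of 0] rels_closed(1)
  by (simp add: tensor_def FactGroup_def tensor_class_def)

lemma group_tensor: "group (tensor R M N)"
  unfolding tensor_def by (rule normal.factorgroup_is_group[OF normal_rels])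

lemma cls_eq_one_iff: "Poly_Mapping.keys c \<subseteq> pairs \<Longrightarrow> cls c = \<one>\<^bsub>tensor R M N\<^esub> \<longleftrightarrow> c \<in> rels"
  using cls_eq_iff[of c 0] by (simp add: one_tensor)

lemma frag_eval_rels:
  assumes "balanced R M N h" "c \<in> rels"
  shows "frag_eval h c = 0"
  using assms(2,1)
  by (induction rule: rels_induct) (auto simp: balanced_def)

lemma frag_eval_cls_eq:
  assumes "balanced R M N h" "Poly_Mapping.keys c \<subseteq> pairs" "Poly_Mapping.keys d \<subseteq> pairs"
    "cls c = cls d"
  shows "frag_eval h c = frag_eval h d"
  using frag_eval_rels[OF assms(1), of "c - d"] assms by (simp add: cls_eq_iff)

end

locale tensor_factors_map =
  dom: tensor_factors R M N + cod: tensor_factors R M' N'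
  for R :: "'a set"
    and M :: "('a, 'm, 'x) bimod_scheme" and N :: "('a, 'n, 'y) lmod_scheme"
    and M' :: "('a, 'p, 'z) bimod_scheme" and N' :: "('a, 'q, 'w) lmod_scheme" +
  fixes f :: "'m \<Rightarrow> 'p" and g :: "'n \<Rightarrow> 'q"
  assumes f: "f \<in> hom M M'" and g: "g \<in> hom N N'"
    and f_act: "\<And>m r. m \<in> carrier M \<Longrightarrow> r \<in> R \<Longrightarrow> f (ract M m r) = ract M' (f m) r"
    and g_act: "\<And>n r. n \<in> carrier N \<Longrightarrow> r \<in> R \<Longrightarrow> g (lact N r n) = lact N' r (g n)"
begin

lemma frag_map_rels:
  assumes "c \<in> dom.rels"
  shows "frag_map f g c \<in> cod.rels"
  using assms
proof (induction rule: dom.rels_induct)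
  case (left m m' n)
  then show ?case using f g cod.rels_basic(1) by (simp add: hom_def Pi_iff)
next
  case (right m n n')
  then show ?case using f g cod.rels_basic(2) by (simp add: hom_def Pi_iff)
next
  case (middle m r n)
  then show ?case using f g cod.rels_basic(3) by (simp add: hom_def Pi_iff f_act g_act)
qed (auto simp: cod.rels_closed simp del: add_uminus_conv_diff)

lemma keys_map:
  "Poly_Mapping.keys c \<subseteq> dom.pairs \<Longrightarrow> Poly_Mapping.keys (frag_map f g c) \<subseteq> cod.pairs"
  using f g by (intro keys_frag_map) (auto simp: hom_def)

lemma tensor_map_cls:
  assumes "Poly_Mapping.keys c \<subseteq> dom.pairs"
  shows "tensor_map R M' N' f g (dom.cls c) = cod.cls (frag_map f g c)"
proof -
  have "cod.cls (frag_map f g d) = cod.cls (frag_map f g c)" if "d \<in> dom.cls c" for d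
  proof -
    have "d - c \<in> dom.rels"
      using that by (simp add: dom.mem_cls_iff)
    moreover from this have "Poly_Mapping.keys d \<subseteq> dom.pairs"
      using dom.rels_keys[of "d - c"] assms keys_add[of "d - c" c] by auto
    ultimately show ?thesis
      using frag_map_rels[of "d - c"] assms by (simp add: cod.cls_eq_iff keys_map)
  qed
  moreover have "c \<in> dom.cls c"
    by (simp add: dom.mem_cls_iff dom.rels_closed)
  ultimately show ?thesis
    unfolding tensor_map_def frag_map_def[symmetric] tensor_class_def[symmetric] by blast
qed

end

section \<open>Direct summands as retracts\<close>

text \<open>
  Projecting onto \<open>X\<close> along \<open>Y\<close> and undoing \<open>f\<close> gives a left inverse of \<open>f\<close>. It commutes with every
  operator that preserves both summands, which is how it is seen to be linear, whatever rings act.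
\<close>

lemma summand_projection:
  assumes P: "comm_group P" and M: "group M" and X: "subgroup X P" and Y: "subgroup Y P"
    and XY: "internal_direct_sum P X Y"
    and f: "f \<in> hom M (P\<lparr>carrier := X\<rparr>)" and bij: "bij_betw f (carrier M) X"
  obtains g where "f \<in> hom M P" "g \<in> hom P M" "\<And>m. m \<in> carrier M \<Longrightarrow> g (f m) = m"
    "\<And>\<phi> \<psi>. \<psi> \<in> hom P P \<Longrightarrow> \<psi> ` X \<subseteq> X \<Longrightarrow> \<psi> ` Y \<subseteq> Y \<Longrightarrow>
       (\<And>m. m \<in> carrier M \<Longrightarrow> \<phi> m \<in> carrier M \<and> f (\<phi> m) = \<psi> (f m)) \<Longrightarrow>
       (\<And>w. w \<in> carrier P \<Longrightarrow> g (\<psi> w) = \<phi> (g w))"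
proof -
  interpret P: comm_group P by fact
  interpret M: group M by fact
  note XP = subgroup.mem_carrier[OF X] and YP = subgroup.mem_carrier[OF Y]
  define g where "g w = (THE m. m \<in> carrier M \<and> (\<exists>y\<in>Y. w = f m \<otimes>\<^bsub>P\<^esub> y))" for w
  have inj: "inj_on f (carrier M)" and im: "f ` carrier M = X"
    using bij by (auto simp: bij_betw_def)
  have fX: "m \<in> carrier M \<Longrightarrow> f m \<in> X" for m
    using im by blast
  have fP: "f \<in> hom M P"
    using f X by (auto simp: hom_def Pi_iff fX XP)
  have uniq: "x = x'" if x: "x \<in> X" "x' \<in> X" "y \<in> Y" "y' \<in> Y" and eq: "x \<otimes>\<^bsub>P\<^esub> y = x' \<otimes>\<^bsub>P\<^esub> y'"
    for x x' y y'
  proof -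
    define d where "d = inv\<^bsub>P\<^esub> x' \<otimes>\<^bsub>P\<^esub> x"
    have c: "x \<in> carrier P" "x' \<in> carrier P" "y \<in> carrier P" "y' \<in> carrier P"
      using x XP YP by auto
    then have d: "d \<in> carrier P" "x' \<otimes>\<^bsub>P\<^esub> d = x"
      by (simp_all add: d_def P.m_assoc[symmetric])
    then have "x' \<otimes>\<^bsub>P\<^esub> (d \<otimes>\<^bsub>P\<^esub> y) = x' \<otimes>\<^bsub>P\<^esub> y'"
      using c eq by (simp add: P.m_assoc[symmetric])
    then have "d \<otimes>\<^bsub>P\<^esub> y = y'"
      using c d by simp
    then have "d = y' \<otimes>\<^bsub>P\<^esub> inv\<^bsub>P\<^esub> y"
      using c d by (subst P.inv_solve_right) auto
    then have "d \<in> Y"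
      using x Y by (simp add: subgroup.m_closed subgroup.m_inv_closed)
    moreover have "d \<in> X"
      using x X by (simp add: d_def subgroup.m_closed subgroup.m_inv_closed)
    ultimately have "d = \<one>\<^bsub>P\<^esub>"
      using XY by (auto simp: internal_direct_sum_def)
    then show "x = x'"
      using d c by simp
  qed
  have g: "g (f m \<otimes>\<^bsub>P\<^esub> y) = m" if "m \<in> carrier M" "y \<in> Y" for m y
    unfolding g_def
  proof (rule the_equality)
    fix m' assume m': "m' \<in> carrier M \<and> (\<exists>y'\<in>Y. f m \<otimes>\<^bsub>P\<^esub> y = f m' \<otimes>\<^bsub>P\<^esub> y')"
    then have "f m = f m'"
      using uniq that fX by blast
    then show "m' = m"
      using inj m' that by (auto dest: inj_onD)
  qed (use that in blast)
  have ex: "\<exists>m\<in>carrier M. \<exists>y\<in>Y. w = f m \<otimes>\<^bsub>P\<^esub> y" if "w \<in> carrier P" for w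
    using XY that im by (force simp: internal_direct_sum_def set_mult_def)
  show thesis
  proof
    show "f \<in> hom M P" by fact
    show "g (f m) = m" if "m \<in> carrier M" for m
      using g[OF that subgroup.one_closed[OF Y]] that fX XP by simp
    show "g \<in> hom P M"
    proof (rule homI)
      fix w assume "w \<in> carrier P"
      then show "g w \<in> carrier M" using ex[of w] g by fastforce
    next
      fix w w' assume "w \<in> carrier P" "w' \<in> carrier P"
      then obtain m y m' y' where w: "m \<in> carrier M" "y \<in> Y" "w = f m \<otimes>\<^bsub>P\<^esub> y"
        "m' \<in> carrier M" "y' \<in> Y" "w' = f m' \<otimes>\<^bsub>P\<^esub> y'"
        using ex by meson
      have "w \<otimes>\<^bsub>P\<^esub> w' = f (m \<otimes>\<^bsub>M\<^esub> m') \<otimes>\<^bsub>P\<^esub> (y \<otimes>\<^bsub>P\<^esub> y')"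
        using w fP fX XP YP by (simp add: hom_mult P.m_ac)
      then show "g (w \<otimes>\<^bsub>P\<^esub> w') = g w \<otimes>\<^bsub>M\<^esub> g w'"
        using w g subgroup.m_closed[OF Y] by simp
    qed
    fix \<phi> \<psi> w
    assume \<psi>: "\<psi> \<in> hom P P" "\<psi> ` X \<subseteq> X" "\<psi> ` Y \<subseteq> Y"
      and \<phi>: "\<And>m. m \<in> carrier M \<Longrightarrow> \<phi> m \<in> carrier M \<and> f (\<phi> m) = \<psi> (f m)"
      and "w \<in> carrier P"
    then obtain m y where w: "m \<in> carrier M" "y \<in> Y" "w = f m \<otimes>\<^bsub>P\<^esub> y"
      using ex by meson
    have "\<psi> w = f (\<phi> m) \<otimes>\<^bsub>P\<^esub> \<psi> y"
      using w \<psi>(1) \<phi> fX XP YP by (simp add: hom_mult)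
    moreover have "g (f (\<phi> m) \<otimes>\<^bsub>P\<^esub> \<psi> y) = \<phi> m"
      using \<psi>(3) w \<phi> by (intro g) auto
    moreover have "g w = m"
      using w g by simp
    ultimately show "g (\<psi> w) = \<phi> (g w)"
      by simp
  qed
qed

text \<open>
  The converse of the preceding projection: \<open>P\<close> splits as the image of \<open>f\<close> plus the kernel of \<open>g\<close>,
  because \<open>w = f(g(w)) + (w - f(g(w)))\<close>.
\<close>

lemma retract_internal_direct_sum:
  assumes P: "comm_group P" and M: "group M" and f: "f \<in> hom M P" and g: "g \<in> hom P M"
    and gf: "\<And>m. m \<in> carrier M \<Longrightarrow> g (f m) = m"
  shows "subgroup (f ` carrier M) P" "subgroup (kernel P M g) P"
    "internal_direct_sum P (f ` carrier M) (kernel P M g)"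
    "f \<in> hom M (P\<lparr>carrier := f ` carrier M\<rparr>)" "bij_betw f (carrier M) (f ` carrier M)"
proof -
  interpret P: comm_group P by fact
  interpret M: group M by fact
  interpret f: group_hom M P f using f by unfold_locales
  interpret g: group_hom P M g using g by unfold_locales
  show "subgroup (f ` carrier M) P" by (rule f.img_is_subgroup)
  show "subgroup (kernel P M g) P" by (rule g.subgroup_kernel)
  show "f \<in> hom M (P\<lparr>carrier := f ` carrier M\<rparr>)" using f by (auto simp: hom_def)
  show "bij_betw f (carrier M) (f ` carrier M)"
    by (rule inj_on_imp_bij_betw) (metis gf inj_onI)
  have "w \<in> f ` carrier M <#>\<^bsub>P\<^esub> kernel P M g" if w: "w \<in> carrier P" for w
  proof -
    have "w = f (g w) \<otimes>\<^bsub>P\<^esub> (inv\<^bsub>P\<^esub> (f (g w)) \<otimes>\<^bsub>P\<^esub> w)"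
      using w by (simp add: P.m_assoc[symmetric])
    moreover have "inv\<^bsub>P\<^esub> (f (g w)) \<otimes>\<^bsub>P\<^esub> w \<in> kernel P M g"
      using w by (simp add: kernel_def gf)
    ultimately show ?thesis
      using w g.hom_closed unfolding set_mult_def by blast
  qed
  moreover have "f ` carrier M <#>\<^bsub>P\<^esub> kernel P M g \<subseteq> carrier P"
    by (auto simp: set_mult_def kernel_def)
  moreover have "f ` carrier M \<inter> kernel P M g = {\<one>\<^bsub>P\<^esub>}"
  proof -
    have "\<one>\<^bsub>P\<^esub> \<in> f ` carrier M"
      using f.hom_one M.one_closed by (metis image_eqI)
    moreover have "f m = \<one>\<^bsub>P\<^esub>" if "m \<in> carrier M" "f m \<in> kernel P M g" for m
      using that gf[of m] by (simp add: kernel_def)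
    moreover have "\<one>\<^bsub>P\<^esub> \<in> kernel P M g"
      by (simp add: kernel_def)
    ultimately show ?thesis
      by auto
  qed
  ultimately show "internal_direct_sum P (f ` carrier M) (kernel P M g)"
    by (auto simp: internal_direct_sum_def)
qed

lemma lmodule_summand_retraction:
  assumes "lmodule_summand R M P" "comm_group P" "group M"
    and P: "\<And>r. r \<in> R \<Longrightarrow> lact P r \<in> hom P P" and M: "\<And>r. r \<in> R \<Longrightarrow> lact M r \<in> hom M M"
  obtains f g where "f \<in> lmodule_hom R M P" "g \<in> lmodule_hom R P M"
    "\<And>m. m \<in> carrier M \<Longrightarrow> g (f m) = m"
proof -
  obtain X Y f where XY: "lsubmodule R P X" "lsubmodule R P Y" "internal_direct_sum P X Y"
    "f \<in> lmodule_hom R M (P\<lparr>carrier := X\<rparr>)" "bij_betw f (carrier M) X"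
    using assms(1) by (auto simp: lmodule_summand_def)
  have s: "subgroup X P" "subgroup Y P" "f \<in> hom M (P\<lparr>carrier := X\<rparr>)"
    using XY by (auto simp: lsubmodule_def lmodule_hom_def)
  show thesis
  proof (rule summand_projection[OF assms(2,3) s(1,2) XY(3) s(3) XY(5)], rule that)
    fix g
    assume g: "f \<in> hom M P" "g \<in> hom P M" "\<And>m. m \<in> carrier M \<Longrightarrow> g (f m) = m"
      "\<And>\<phi> \<psi> w. \<psi> \<in> hom P P \<Longrightarrow> \<psi> ` X \<subseteq> X \<Longrightarrow> \<psi> ` Y \<subseteq> Y \<Longrightarrow>
         (\<And>m. m \<in> carrier M \<Longrightarrow> \<phi> m \<in> carrier M \<and> f (\<phi> m) = \<psi> (f m)) \<Longrightarrow>
         w \<in> carrier P \<Longrightarrow> g (\<psi> w) = \<phi> (g w)"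
    show "f \<in> lmodule_hom R M P"
      using g(1) XY(4) by (auto simp: lmodule_hom_def)
    have "g (lact P r w) = lact M r (g w)" if r: "r \<in> R" and "w \<in> carrier P" for r w
      using XY r that(2) M[OF r] by (intro g(4) P) (auto simp: lsubmodule_def lmodule_hom_def hom_def)
    then show "g \<in> lmodule_hom R P M"
      using g(2) by (simp add: lmodule_hom_def)
    show "g (f m) = m" if "m \<in> carrier M" for m by (rule g(3)[OF that])
  qed
qed

lemma bimodule_summand_retraction:
  assumes "bimodule_summand L R M P" "comm_group P" "group M"
    and P: "\<And>r. r \<in> L \<Longrightarrow> lact P r \<in> hom P P" "\<And>r. r \<in> R \<Longrightarrow> (\<lambda>w. ract P w r) \<in> hom P P"
    and M: "\<And>r. r \<in> L \<Longrightarrow> lact M r \<in> hom M M" "\<And>r. r \<in> R \<Longrightarrow> (\<lambda>m. ract M m r) \<in> hom M M"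
  obtains f g where "f \<in> bimodule_hom L R M P" "g \<in> bimodule_hom L R P M"
    "\<And>m. m \<in> carrier M \<Longrightarrow> g (f m) = m"
proof -
  obtain X Y f where XY: "subbimodule L R P X" "subbimodule L R P Y" "internal_direct_sum P X Y"
    "f \<in> bimodule_hom L R M (P\<lparr>carrier := X\<rparr>)" "bij_betw f (carrier M) X"
    using assms(1) by (auto simp: bimodule_summand_def)
  have s: "subgroup X P" "subgroup Y P" "f \<in> hom M (P\<lparr>carrier := X\<rparr>)"
    using XY by (auto simp: subbimodule_def lsubmodule_def lmodule_hom_def bimodule_hom_def)
  show thesis
  proof (rule summand_projection[OF assms(2,3) s(1,2) XY(3) s(3) XY(5)], rule that)
    fix g
    assume g: "f \<in> hom M P" "g \<in> hom P M" "\<And>m. m \<in> carrier M \<Longrightarrow> g (f m) = m"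
      "\<And>\<phi> \<psi> w. \<psi> \<in> hom P P \<Longrightarrow> \<psi> ` X \<subseteq> X \<Longrightarrow> \<psi> ` Y \<subseteq> Y \<Longrightarrow>
         (\<And>m. m \<in> carrier M \<Longrightarrow> \<phi> m \<in> carrier M \<and> f (\<phi> m) = \<psi> (f m)) \<Longrightarrow>
         w \<in> carrier P \<Longrightarrow> g (\<psi> w) = \<phi> (g w)"
    show "f \<in> bimodule_hom L R M P"
      using g(1) XY(4) by (auto simp: lmodule_hom_def bimodule_hom_def)
    have "g (lact P r w) = lact M r (g w)" if r: "r \<in> L" and "w \<in> carrier P" for r w
      using XY r that(2) M(1)[OF r]
      by (intro g(4) P) (auto simp: subbimodule_def lsubmodule_def bimodule_hom_def lmodule_hom_def hom_def)
    moreover have "g (ract P w r) = ract M (g w) r" if r: "r \<in> R" and w: "w \<in> carrier P" for r w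
      using XY r M(2)[OF r]
      by (intro g(4)[OF P(2)[OF r] _ _ _ w])
        (auto simp: subbimodule_def lsubmodule_def bimodule_hom_def lmodule_hom_def hom_def)
    ultimately show "g \<in> bimodule_hom L R P M"
      using g(2) by (simp add: lmodule_hom_def bimodule_hom_def)
    show "g (f m) = m" if "m \<in> carrier M" for m by (rule g(3)[OF that])
  qed
qed

lemma lmodule_summandI:
  assumes "comm_group P" "group M" "f \<in> lmodule_hom R M P" "g \<in> lmodule_hom R P M"
    and gf: "\<And>m. m \<in> carrier M \<Longrightarrow> g (f m) = m"
    and P: "\<And>r. r \<in> R \<Longrightarrow> lact P r \<in> hom P P" and M: "\<And>r. r \<in> R \<Longrightarrow> lact M r \<in> hom M M"
  shows "lmodule_summand R M P"
proof -
  have h: "f \<in> hom M P" "g \<in> hom P M"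
    using assms(3,4) by (auto simp: lmodule_hom_def)
  note * = retract_internal_direct_sum[OF assms(1,2) h gf]
  have one: "lact M r \<one>\<^bsub>M\<^esub> = \<one>\<^bsub>M\<^esub>" if "r \<in> R" for r
    using hom_one[OF M[OF that] assms(2) assms(2)] .
  have "lact P r (f m) \<in> f ` carrier M" if "r \<in> R" "m \<in> carrier M" for r m
    using that assms(3) M[OF that(1)]
    by (intro image_eqI[of _ _ "lact M r m"]) (auto simp: lmodule_hom_def hom_def)
  moreover have "lact P r w \<in> kernel P M g" if "r \<in> R" "w \<in> kernel P M g" for r w
    using that assms(4) P[OF that(1)] one by (auto simp: kernel_def lmodule_hom_def hom_def)
  ultimately have "lsubmodule R P (f ` carrier M)" "lsubmodule R P (kernel P M g)"
    using *(1,2) by (auto simp: lsubmodule_def)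
  moreover have "f \<in> lmodule_hom R M (P\<lparr>carrier := f ` carrier M\<rparr>)"
    using *(4) assms(3) by (simp add: lmodule_hom_def)
  ultimately show ?thesis
    unfolding lmodule_summand_def using *(3,5) by blast
qed

lemma bimodule_summandI:
  assumes "comm_group P" "group M" "f \<in> bimodule_hom L R M P" "g \<in> bimodule_hom L R P M"
    and gf: "\<And>m. m \<in> carrier M \<Longrightarrow> g (f m) = m"
    and P: "\<And>r. r \<in> L \<Longrightarrow> lact P r \<in> hom P P" "\<And>r. r \<in> R \<Longrightarrow> (\<lambda>w. ract P w r) \<in> hom P P"
    and M: "\<And>r. r \<in> L \<Longrightarrow> lact M r \<in> hom M M" "\<And>r. r \<in> R \<Longrightarrow> (\<lambda>m. ract M m r) \<in> hom M M"
  shows "bimodule_summand L R M P"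
proof -
  have h: "f \<in> hom M P" "g \<in> hom P M"
    using assms(3,4) by (auto simp: lmodule_hom_def bimodule_hom_def)
  note * = retract_internal_direct_sum[OF assms(1,2) h gf]
  have one: "r \<in> L \<Longrightarrow> lact M r \<one>\<^bsub>M\<^esub> = \<one>\<^bsub>M\<^esub>" "r \<in> R \<Longrightarrow> ract M \<one>\<^bsub>M\<^esub> r = \<one>\<^bsub>M\<^esub>" for r
    using hom_one[OF M(1) assms(2) assms(2)] hom_one[OF M(2) assms(2) assms(2)] by auto
  have "lact P r (f m) \<in> f ` carrier M" if "r \<in> L" "m \<in> carrier M" for r m
    using that assms(3) M(1)[OF that(1)]
    by (intro image_eqI[of _ _ "lact M r m"]) (auto simp: bimodule_hom_def lmodule_hom_def hom_def)
  moreover have "lact P r w \<in> kernel P M g" if "r \<in> L" "w \<in> kernel P M g" for r w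
    using that assms(4) P(1)[OF that(1)] one by (auto simp: kernel_def bimodule_hom_def lmodule_hom_def hom_def)
  moreover have "ract P (f m) r \<in> f ` carrier M" if "r \<in> R" "m \<in> carrier M" for r m
    using that assms(3) M(2)[OF that(1)]
    by (intro image_eqI[of _ _ "ract M m r"]) (auto simp: bimodule_hom_def hom_def)
  moreover have "ract P w r \<in> kernel P M g" if "r \<in> R" "w \<in> kernel P M g" for r w
    using that assms(4) P(2)[OF that(1)] one by (auto simp: kernel_def bimodule_hom_def hom_def)
  ultimately have "subbimodule L R P (f ` carrier M)" "subbimodule L R P (kernel P M g)"
    using *(1,2) by (auto simp: lsubmodule_def subbimodule_def)
  moreover have "f \<in> bimodule_hom L R M (P\<lparr>carrier := f ` carrier M\<rparr>)"
    using *(4) assms(3) by (simp add: lmodule_hom_def bimodule_hom_def)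
  ultimately show ?thesis
    unfolding bimodule_summand_def using *(3,5) by blast
qed

section \<open>The regular bimodule, its powers and its tensor square\<close>

lemma regular_simps [simp]:
  "carrier regular = UNIV" "x \<otimes>\<^bsub>regular\<^esub> y = x + y" "\<one>\<^bsub>regular\<^esub> = 0"
  "lact regular a x = a * x" "ract regular x a = x * a"
  by (simp_all add: regular_def)

lemma power_bimod_regular_simps [simp]:
  "carrier (power_bimod regular N) = extensional {..<N}"
  "x \<otimes>\<^bsub>power_bimod regular N\<^esub> y = (\<lambda>i\<in>{..<N}. x i + y i)"
  "\<one>\<^bsub>power_bimod regular N\<^esub> = (\<lambda>i\<in>{..<N}. 0)"
  "lact (power_bimod regular N) a x = (\<lambda>i\<in>{..<N}. a * x i)"
  "ract (power_bimod regular N) x a = (\<lambda>i\<in>{..<N}. x i * a)"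
  by (auto simp: power_bimod_def Let_def PiE_def)

lemma comm_group_power_regular: "comm_group (power_bimod (regular :: ('a::ring_1, 'a) bimod) N)"
proof (rule comm_groupI)
  fix x :: "nat \<Rightarrow> 'a" assume x: "x \<in> carrier (power_bimod regular N)"
  show "\<one>\<^bsub>power_bimod regular N\<^esub> \<otimes>\<^bsub>power_bimod regular N\<^esub> x = x"
    using x by (auto simp: fun_eq_iff extensional_def)
  show "\<exists>y\<in>carrier (power_bimod regular N).
      y \<otimes>\<^bsub>power_bimod regular N\<^esub> x = \<one>\<^bsub>power_bimod regular N\<^esub>"
    by (rule bexI[of _ "\<lambda>i\<in>{..<N}. - x i"]) (auto simp: fun_eq_iff)
qed (auto simp: fun_eq_iff add_ac)

lemma power_regular_act_hom:
  "lact (power_bimod regular N) a \<in> hom (power_bimod regular N) (power_bimod regular N)"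
  "(\<lambda>w. ract (power_bimod regular N) w a) \<in> hom (power_bimod regular N) (power_bimod regular N)"
  by (auto simp: hom_def fun_eq_iff distrib_left distrib_right)

interpretation reg: tensor_factors R regular regular for R
  by unfold_locales auto

lemma balanced_regular:
  "balanced R regular regular h \<longleftrightarrow> (\<forall>x x' y. h (x + x') y = h x y + h x' y) \<and>
     (\<forall>x y y'. h x (y + y') = h x y + h x y') \<and> (\<forall>x r y. r \<in> R \<longrightarrow> h (x * r) y = h x (r * y))"
  by (auto simp: balanced_def)

abbreviation tensor_square :: "'a::ring_1 set \<Rightarrow> ('a, ('a \<times> 'a \<Rightarrow>\<^sub>0 int) set) bimod" where
  "tensor_square R \<equiv> tensor_bimod R regular regular"

abbreviation square_class :: "'a::ring_1 set \<Rightarrow> ('a \<times> 'a \<Rightarrow>\<^sub>0 int) \<Rightarrow> ('a \<times> 'a \<Rightarrow>\<^sub>0 int) set" where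
  "square_class R \<equiv> tensor_class R regular regular"

lemma tensor_square_simps:
  "carrier (tensor_square R) = range (square_class R)"
  "square_class R c \<otimes>\<^bsub>tensor_square R\<^esub> square_class R d = square_class R (c + d)"
  "\<one>\<^bsub>tensor_square R\<^esub> = square_class R 0"
  using reg.carrier_tensor[of R] reg.mult_tensor[of c d R] reg.one_tensor[of R]
  by (simp_all add: tensor_bimod_def Let_def)

lemma tensor_square_lact:
  "lact (tensor_square R) a (square_class R c) = square_class R (frag_map ((*) a) id c)"
proof -
  interpret tensor_factors_map R regular regular regular regular "(*) a" id
    by unfold_locales (auto simp: hom_def distrib_left mult.assoc)
  show ?thesis
    using tensor_map_cls[of c] by (simp add: tensor_bimod_def Let_def regular_def)
qed

lemma tensor_square_ract:
  "ract (tensor_square R) (square_class R c) a = square_class R (frag_map id (\<lambda>n. n * a) c)"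
proof -
  interpret tensor_factors_map R regular regular regular regular id "\<lambda>n. n * a"
    by unfold_locales (auto simp: hom_def distrib_right mult.assoc)
  show ?thesis
    using tensor_map_cls[of c] by (simp add: tensor_bimod_def Let_def)
qed

lemma group_tensor_square: "group (tensor_square R)"
proof -
  have "group (tensor R regular regular)" by (rule reg.group_tensor)
  then show ?thesis
    unfolding group_def monoid_def group_axioms_def Units_def tensor_bimod_def Let_def by simp
qed

lemma tensor_square_act_hom:
  "lact (tensor_square R) a \<in> hom (tensor_square R) (tensor_square R)"
  "(\<lambda>t. ract (tensor_square R) t a) \<in> hom (tensor_square R) (tensor_square R)"
  by (auto simp: hom_def tensor_square_simps tensor_square_lact tensor_square_ract)

text \<open>
  Being a direct summand of \<open>A\<^sup>N\<close> means that the identity of \<open>A \<otimes>\<^sub>R A\<close> is \<open>\<Sum> G\<^sub>i \<circ> F\<^sub>i\<close> with bimodule maps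
  \<open>F\<^sub>i\<close> to \<open>A\<close> and \<open>G\<^sub>i\<close> from \<open>A\<close>. The maps \<open>G\<^sub>i\<close> are recorded through representatives of their values.
\<close>

lemma tensor_square_summand_decomposition:
  assumes "bimodule_summand L T (tensor_square R) (power_bimod regular N)"
  obtains F G where
    "\<And>i. i < N \<Longrightarrow> F i \<in> bimodule_hom L T (tensor_square R) regular"
    "\<And>i. i < N \<Longrightarrow> (\<lambda>a. square_class R (G i a)) \<in> bimodule_hom L T regular (tensor_square R)"
    "\<And>c. square_class R c = square_class R (\<Sum>i<N. G i (F i (square_class R c)))"
proof -
  let ?P = "power_bimod regular N" and ?T = "tensor_square R" and ?c = "square_class R"
  obtain f g where f: "f \<in> bimodule_hom L T ?T ?P" and g: "g \<in> bimodule_hom L T ?P ?T"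
    and gf: "\<And>m. m \<in> carrier ?T \<Longrightarrow> g (f m) = m"
    by (rule bimodule_summand_retraction[OF assms comm_group_power_regular group_tensor_square
          power_regular_act_hom tensor_square_act_hom]) (rule that; assumption)
  define \<delta> where "\<delta> i a = (\<lambda>j\<in>{..<N}. if j = i then a else 0)" for i :: nat and a :: 'a
  define G where "G i a = (SOME c. g (\<delta> i a) = ?c c)" for i a
  have ghom: "g \<in> hom ?P ?T" and fhom: "f \<in> hom ?T ?P"
    using f g by (auto simp: bimodule_hom_def lmodule_hom_def)
  have gT: "\<exists>c. g w = ?c c" if "w \<in> extensional {..<N}" for w
    using ghom that by (force simp: hom_def Pi_iff tensor_square_simps)
  have \<delta>E: "\<delta> i a \<in> extensional {..<N}" for i a
    by (simp add: \<delta>_def)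
  have G: "g (\<delta> i a) = ?c (G i a)" for i a
    unfolding G_def by (rule someI_ex) (rule gT[OF \<delta>E])
  have fE: "f (?c c) \<in> extensional {..<N}" for c
    using fhom by (force simp: hom_def Pi_iff tensor_square_simps)
  have gmult: "g (\<lambda>i\<in>{..<N}. x i + y i) = g x \<otimes>\<^bsub>?T\<^esub> g y"
    if "x \<in> extensional {..<N}" "y \<in> extensional {..<N}" for x y
    using hom_mult[OF ghom, of x y] that by simp
  \<comment> \<open>Truncating a vector after n entries lets induction on n replace finite sums in the tensor product.\<close>
  have partial: "g (\<lambda>j\<in>{..<N}. if j < n then w j else 0) = ?c (\<Sum>i<n. G i (w i))" for w n
  proof -
    define cut where "cut n = (\<lambda>j\<in>{..<N}. if j < n then w j else 0)" for n
    have cutE: "cut n \<in> extensional {..<N}" for n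
      by (simp add: cut_def)
    have step: "cut (Suc n) = (\<lambda>j\<in>{..<N}. cut n j + \<delta> n (w n) j)" for n
      by (auto simp: \<delta>_def cut_def fun_eq_iff less_Suc_eq)
    have zero: "cut 0 = \<one>\<^bsub>?P\<^esub>"
      by (auto simp: cut_def)
    have "g (cut n) = ?c (\<Sum>i<n. G i (w i))"
    proof (induction n)
      case 0
      have "g \<one>\<^bsub>?P\<^esub> = \<one>\<^bsub>?T\<^esub>"
        by (rule hom_one[OF ghom comm_group.axioms(2)[OF comm_group_power_regular]
              group_tensor_square])
      then show ?case
        by (simp only: zero tensor_square_simps) simp
    next
      case (Suc n)
      show ?case
        unfolding step gmult[OF cutE \<delta>E] Suc G tensor_square_simps by simp
    qed
    then show ?thesis
      by (simp only: cut_def)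
  qed
  show thesis
  proof
    fix i assume i: "i < N"
    show "(\<lambda>t. f t i) \<in> bimodule_hom L T ?T regular"
      using f i by (auto simp: bimodule_hom_def lmodule_hom_def hom_def)
    have \<delta>_simps: "\<delta> i (x + y) = (\<lambda>j\<in>{..<N}. \<delta> i x j + \<delta> i y j)"
      "\<delta> i (a * x) = lact ?P a (\<delta> i x)" "\<delta> i (x * a) = ract ?P (\<delta> i x) a" for x y a
      by (auto simp: \<delta>_def fun_eq_iff)
    have \<delta>P: "\<delta> i x \<in> carrier ?P" for x
      using \<delta>E by simp
    have "g (\<delta> i (x + y)) = g (\<delta> i x) \<otimes>\<^bsub>?T\<^esub> g (\<delta> i y)" for x y
      unfolding \<delta>_simps(1) by (rule gmult[OF \<delta>E \<delta>E])
    moreover have "g (\<delta> i (a * x)) = lact ?T a (g (\<delta> i x))" if "a \<in> L" for a x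
      unfolding \<delta>_simps(2) using g \<delta>P[of x] that
      unfolding bimodule_hom_def lmodule_hom_def by blast
    moreover have "g (\<delta> i (x * a)) = ract ?T (g (\<delta> i x)) a" if "a \<in> T" for a x
      unfolding \<delta>_simps(3) using g \<delta>P[of x] that
      unfolding bimodule_hom_def by blast
    moreover have "g (\<delta> i x) \<in> carrier ?T" for x
      unfolding G tensor_square_simps by blast
    ultimately show "(\<lambda>a. ?c (G i a)) \<in> bimodule_hom L T regular ?T"
      unfolding G[symmetric] bimodule_hom_def lmodule_hom_def hom_def by simp
  next
    fix c
    have "(\<lambda>j\<in>{..<N}. if j < N then f (?c c) j else 0) = f (?c c)"
      using fE[of c] by (auto simp: fun_eq_iff extensional_def)
    moreover have "g (\<lambda>j\<in>{..<N}. if j < N then f (?c c) j else 0) = ?c (\<Sum>i<N. G i (f (?c c) i))"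
      by (rule partial)
    ultimately have "g (f (?c c)) = ?c (\<Sum>i<N. G i (f (?c c) i))"
      by simp
    then show "?c c = ?c (\<Sum>i<N. G i (f (?c c) i))"
      using gf by (simp add: tensor_square_simps)
  qed
qed

section \<open>Quasibases\<close>

lemma End_bimod_iff:
  "f \<in> End_bimod L R \<longleftrightarrow> (\<forall>x y. f (x + y) = f x + f y) \<and>
     (\<forall>r\<in>L. \<forall>x. f (r * x) = r * f x) \<and> (\<forall>r\<in>R. \<forall>x. f (x * r) = f x * r)"
  by (auto simp: End_bimod_def bimodule_hom_def lmodule_hom_def hom_def)

lemma unital_subring_centralizer: "unital_subring (centralizer C)"
  by (auto simp: unital_subring_def centralizer_def left_diff_distrib right_diff_distrib mult.assoc)
    (simp add: mult.assoc[symmetric])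

lemma unital_subring_closed:
  assumes "unital_subring R"
  shows "0 \<in> R" "1 \<in> R" "x \<in> R \<Longrightarrow> - x \<in> R" "x \<in> R \<Longrightarrow> y \<in> R \<Longrightarrow> x + y \<in> R"
    "x \<in> R \<Longrightarrow> y \<in> R \<Longrightarrow> x - y \<in> R" "x \<in> R \<Longrightarrow> y \<in> R \<Longrightarrow> x * y \<in> R"
proof -
  have d: "x \<in> R \<Longrightarrow> y \<in> R \<Longrightarrow> x - y \<in> R" for x y
    using assms by (simp add: unital_subring_def)
  show one: "1 \<in> R" using assms by (simp add: unital_subring_def)
  show z: "0 \<in> R" using d[OF one one] by simp
  show m: "x \<in> R \<Longrightarrow> - x \<in> R" for x using d[OF z, of x] by simp
  show "x \<in> R \<Longrightarrow> y \<in> R \<Longrightarrow> x + y \<in> R" using d[of x "- y"] m[of y] by simp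
  show "x \<in> R \<Longrightarrow> y \<in> R \<Longrightarrow> x - y \<in> R" by (rule d)
  show "x \<in> R \<Longrightarrow> y \<in> R \<Longrightarrow> x * y \<in> R" using assms by (simp add: unital_subring_def)
qed

lemma additive_rules:
  fixes f :: "'a::ab_group_add \<Rightarrow> 'b::ab_group_add"
  assumes "\<And>x y. f (x + y) = f x + f y"
  shows "f 0 = 0" "f (- x) = - f x" "f (x - y) = f x - f y" "f (sum g I) = (\<Sum>i\<in>I. f (g i))"
proof -
  show z: "f 0 = 0" using assms[of 0 0] by simp
  show "f (- x) = - f x" using assms[of x "- x"] z by (simp add: add_eq_0_iff)
  show "f (x - y) = f x - f y" using assms[of "x - y" y] by (simp add: eq_diff_eq)
  show "f (sum g I) = (\<Sum>i\<in>I. f (g i))"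
    by (induction I rule: infinite_finite_induct) (auto simp: z assms)
qed

lemma frag_eval_square_class_eq:
  assumes "balanced R regular regular h" "square_class R c = square_class R d"
  shows "frag_eval h c = frag_eval h d"
  using assms by (intro reg.frag_eval_cls_eq[of R]) auto

text \<open>
  With \<open>u\<^sub>i \<in> (A \<otimes>\<^sub>C A)\<^sup>C\<close>, this is the identity \<open>x \<otimes> y = \<Sum> x \<gamma>\<^sub>i(y) u\<^sub>i\<close>. It is stated after applying an
  arbitrary balanced map \<open>h\<close> with values in \<open>A\<close>, since this is the form in which it is used and it
  frees later arguments from cosets: \<open>u\<^sub>i\<close> may be any representative.
\<close>

locale left_quasibasis =
  fixes C :: "'a::ring_1 set" and N :: nat and \<gamma> :: "nat \<Rightarrow> 'a \<Rightarrow> 'a"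
    and u :: "nat \<Rightarrow> 'a \<times> 'a \<Rightarrow>\<^sub>0 int"
  assumes gamma: "\<And>i. i < N \<Longrightarrow> \<gamma> i \<in> End_bimod C C"
    and expand: "\<And>h :: 'a \<Rightarrow> 'a \<Rightarrow> 'a. balanced C regular regular h \<Longrightarrow>
      h x y = (\<Sum>i<N. frag_eval (\<lambda>m n. h (x * \<gamma> i y * m) n) (u i))"
    and central: "\<And>(h :: 'a \<Rightarrow> 'a \<Rightarrow> 'a) i c. balanced C regular regular h \<Longrightarrow> i < N \<Longrightarrow> c \<in> C \<Longrightarrow>
      frag_eval (\<lambda>m n. h (c * m) n) (u i) = frag_eval (\<lambda>m n. h m (n * c)) (u i)"

text \<open>
  The mirror image, \<open>x \<otimes> y = \<Sum> u\<^sub>i \<gamma>\<^sub>i(x) y\<close> in \<open>A \<otimes>\<^sub>B A\<close>, with \<open>u\<^sub>i\<close> commuting with \<open>C\<close>. For \<open>B = C\<close> it comes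
  from depth two, and in general it is the left D3 condition.
\<close>

locale right_quasibasis =
  fixes C B :: "'a::ring_1 set" and N :: nat and \<gamma> :: "nat \<Rightarrow> 'a \<Rightarrow> 'a"
    and u :: "nat \<Rightarrow> 'a \<times> 'a \<Rightarrow>\<^sub>0 int"
  assumes gamma: "\<And>i. i < N \<Longrightarrow> \<gamma> i \<in> End_bimod C B"
    and expand: "\<And>h :: 'a \<Rightarrow> 'a \<Rightarrow> 'a. balanced B regular regular h \<Longrightarrow>
      h x y = (\<Sum>i<N. frag_eval (\<lambda>m n. h m (n * (\<gamma> i x * y))) (u i))"
    and central: "\<And>(h :: 'a \<Rightarrow> 'a \<Rightarrow> 'a) i c. balanced B regular regular h \<Longrightarrow> i < N \<Longrightarrow> c \<in> C \<Longrightarrow>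
      frag_eval (\<lambda>m n. h (c * m) n) (u i) = frag_eval (\<lambda>m n. h m (n * c)) (u i)"

lemma square_class_add_left:
  "square_class R (frag_of (x + x', y)) = square_class R (frag_of (x, y) + frag_of (x', y))"
  using reg.rels_basic(1)[of x x' y R] by (subst reg.cls_eq_iff) (auto simp: algebra_simps)

lemma square_class_add_right:
  "square_class R (frag_of (x, y + y')) = square_class R (frag_of (x, y) + frag_of (x, y'))"
  using reg.rels_basic(2)[of x y y' R] by (subst reg.cls_eq_iff) (auto simp: algebra_simps)

lemma square_class_middle:
  "r \<in> R \<Longrightarrow> square_class R (frag_of (x * r, y)) = square_class R (frag_of (x, r * y))"
  using reg.rels_basic(3)[of x r R y] by (subst reg.cls_eq_iff) auto

text \<open>
  Since \<open>F\<^sub>i\<close> is right \<open>A\<close>-linear, \<open>F\<^sub>i(x \<otimes> y) = \<gamma>\<^sub>i(x) y\<close> with \<open>\<gamma>\<^sub>i(x) = F\<^sub>i(x \<otimes> 1)\<close>; since \<open>G\<^sub>i\<close> is so too,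
  \<open>G\<^sub>i(a) = u\<^sub>i a\<close> with \<open>u\<^sub>i = G\<^sub>i(1)\<close>, and left \<open>C\<close>-linearity of \<open>G\<^sub>i\<close> makes \<open>u\<^sub>i\<close> commute with \<open>C\<close>.
\<close>

lemma ex_right_quasibasis:
  assumes "bimodule_summand C UNIV (tensor_square B) (power_bimod regular N)"
  obtains \<gamma> u where "right_quasibasis C B N \<gamma> u"
proof -
  let ?c = "square_class B" and ?T = "tensor_square B"
  obtain F G where F: "\<And>i. i < N \<Longrightarrow> F i \<in> bimodule_hom C UNIV ?T regular"
    and G: "\<And>i. i < N \<Longrightarrow> (\<lambda>a. ?c (G i a)) \<in> bimodule_hom C UNIV regular ?T"
    and dec: "\<And>c. ?c c = ?c (\<Sum>i<N. G i (F i (?c c)))"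
    by (rule tensor_square_summand_decomposition[OF assms]) (rule that; assumption)
  have F': "F i (?c (c + d)) = F i (?c c) + F i (?c d)"
    "r \<in> C \<Longrightarrow> F i (?c (frag_map ((*) r) id c)) = r * F i (?c c)"
    "F i (?c (frag_map id (\<lambda>n. n * a) c)) = F i (?c c) * a" if "i < N" for i c d r a
    using F[OF that]
    by (auto simp: bimodule_hom_def lmodule_hom_def hom_def tensor_square_simps
        simp flip: tensor_square_lact tensor_square_ract)
  have G': "r \<in> C \<Longrightarrow> ?c (G i (r * a)) = ?c (frag_map ((*) r) id (G i a))"
    "?c (G i (a * b)) = ?c (frag_map id (\<lambda>n. n * b) (G i a))" if "i < N" for i r a b
    using G[OF that]
    by (auto simp: bimodule_hom_def lmodule_hom_def hom_def simp flip: tensor_square_lact tensor_square_ract)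
  define \<gamma> where "\<gamma> i x = F i (?c (frag_of (x, 1)))" for i x
  define u where "u i = G i 1" for i
  have Fxy: "F i (?c (frag_of (x, y))) = \<gamma> i x * y" if "i < N" for i x y
    using F'(3)[OF that, of y "frag_of (x, 1)"] by (simp add: \<gamma>_def)
  have "right_quasibasis C B N \<gamma> u"
  proof
    fix i assume i: "i < N"
    show "\<gamma> i \<in> End_bimod C B"
      unfolding End_bimod_iff
    proof (intro conjI allI ballI)
      show "\<gamma> i (x + y) = \<gamma> i x + \<gamma> i y" for x y
        using i by (simp add: \<gamma>_def square_class_add_left F')
      show "\<gamma> i (r * x) = r * \<gamma> i x" if "r \<in> C" for r x
        using F'(2)[OF i that, of "frag_of (x, 1)"] by (simp add: \<gamma>_def)
      show "\<gamma> i (x * r) = \<gamma> i x * r" if "r \<in> B" for r x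
        using square_class_middle[OF that, of x 1] Fxy[OF i, of x r] by (simp add: \<gamma>_def)
    qed
  next
    fix h :: "'a \<Rightarrow> 'a \<Rightarrow> 'a" and x y assume h: "balanced B regular regular h"
    have "h x y = frag_eval h (\<Sum>i<N. G i (F i (?c (frag_of (x, y)))))"
      using frag_eval_square_class_eq[OF h dec[of "frag_of (x, y)"]] by simp
    also have "\<dots> = (\<Sum>i<N. frag_eval h (G i (\<gamma> i x * y)))"
      by (simp add: Fxy)
    also have "\<dots> = (\<Sum>i<N. frag_eval h (frag_map id (\<lambda>n. n * (\<gamma> i x * y)) (u i)))"
    proof (intro sum.cong refl frag_eval_square_class_eq[OF h])
      fix i assume "i \<in> {..<N}"
      then show "?c (G i (\<gamma> i x * y)) = ?c (frag_map id (\<lambda>n. n * (\<gamma> i x * y)) (u i))"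
        using G'(2)[of i 1 "\<gamma> i x * y"] by (simp add: u_def)
    qed
    finally show "h x y = (\<Sum>i<N. frag_eval (\<lambda>m n. h m (n * (\<gamma> i x * y))) (u i))"
      by (simp add: frag_eval_frag_map)
  next
    fix h :: "'a \<Rightarrow> 'a \<Rightarrow> 'a" and i c
    assume h: "balanced B regular regular h" and i: "i < N" "c \<in> C"
    have "?c (frag_map ((*) c) id (u i)) = ?c (frag_map id (\<lambda>n. n * c) (u i))"
      using G'(1)[OF i, of 1] G'(2)[OF i(1), of 1 c] by (simp add: u_def)
    from frag_eval_square_class_eq[OF h this]
    show "frag_eval (\<lambda>m n. h (c * m) n) (u i) = frag_eval (\<lambda>m n. h m (n * c)) (u i)"
      by (simp add: frag_eval_frag_map)
  qed
  then show thesis by (rule that)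
qed

lemma ex_left_quasibasis:
  assumes "bimodule_summand UNIV C (tensor_square C) (power_bimod regular N)"
  obtains \<gamma> u where "left_quasibasis C N \<gamma> u"
proof -
  let ?c = "square_class C" and ?T = "tensor_square C"
  obtain F G where F: "\<And>i. i < N \<Longrightarrow> F i \<in> bimodule_hom UNIV C ?T regular"
    and G: "\<And>i. i < N \<Longrightarrow> (\<lambda>a. ?c (G i a)) \<in> bimodule_hom UNIV C regular ?T"
    and dec: "\<And>c. ?c c = ?c (\<Sum>i<N. G i (F i (?c c)))"
    by (rule tensor_square_summand_decomposition[OF assms]) (rule that; assumption)
  have F': "F i (?c (c + d)) = F i (?c c) + F i (?c d)"
    "F i (?c (frag_map ((*) a) id c)) = a * F i (?c c)"
    "r \<in> C \<Longrightarrow> F i (?c (frag_map id (\<lambda>n. n * r) c)) = F i (?c c) * r" if "i < N" for i c d r a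
    using F[OF that]
    by (auto simp: bimodule_hom_def lmodule_hom_def hom_def tensor_square_simps
        simp flip: tensor_square_lact tensor_square_ract)
  have G': "?c (G i (b * a)) = ?c (frag_map ((*) b) id (G i a))"
    "r \<in> C \<Longrightarrow> ?c (G i (a * r)) = ?c (frag_map id (\<lambda>n. n * r) (G i a))" if "i < N" for i r a b
    using G[OF that]
    by (auto simp: bimodule_hom_def lmodule_hom_def hom_def simp flip: tensor_square_lact tensor_square_ract)
  define \<gamma> where "\<gamma> i y = F i (?c (frag_of (1, y)))" for i y
  define u where "u i = G i 1" for i
  have Fxy: "F i (?c (frag_of (x, y))) = x * \<gamma> i y" if "i < N" for i x y
    using F'(2)[OF that, of x "frag_of (1, y)"] by (simp add: \<gamma>_def)
  have "left_quasibasis C N \<gamma> u"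
  proof
    fix i assume i: "i < N"
    show "\<gamma> i \<in> End_bimod C C"
      unfolding End_bimod_iff
    proof (intro conjI allI ballI)
      show "\<gamma> i (x + y) = \<gamma> i x + \<gamma> i y" for x y
        using i by (simp add: \<gamma>_def square_class_add_right F')
      show "\<gamma> i (r * x) = r * \<gamma> i x" if "r \<in> C" for r x
        using square_class_middle[OF that, of 1 x] Fxy[OF i, of r x] by (simp add: \<gamma>_def)
      show "\<gamma> i (x * r) = \<gamma> i x * r" if "r \<in> C" for r x
        using F'(3)[OF i that, of "frag_of (1, x)"] by (simp add: \<gamma>_def)
    qed
  next
    fix h :: "'a \<Rightarrow> 'a \<Rightarrow> 'a" and x y assume h: "balanced C regular regular h"
    have "h x y = frag_eval h (\<Sum>i<N. G i (F i (?c (frag_of (x, y)))))"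
      using frag_eval_square_class_eq[OF h dec[of "frag_of (x, y)"]] by simp
    also have "\<dots> = (\<Sum>i<N. frag_eval h (G i (x * \<gamma> i y)))"
      by (simp add: Fxy)
    also have "\<dots> = (\<Sum>i<N. frag_eval h (frag_map ((*) (x * \<gamma> i y)) id (u i)))"
    proof (intro sum.cong refl frag_eval_square_class_eq[OF h])
      fix i assume "i \<in> {..<N}"
      then show "?c (G i (x * \<gamma> i y)) = ?c (frag_map ((*) (x * \<gamma> i y)) id (u i))"
        using G'(1)[of i "x * \<gamma> i y" 1] by (simp add: u_def)
    qed
    finally show "h x y = (\<Sum>i<N. frag_eval (\<lambda>m n. h (x * \<gamma> i y * m) n) (u i))"
      by (simp add: frag_eval_frag_map)
  next
    fix h :: "'a \<Rightarrow> 'a \<Rightarrow> 'a" and i c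
    assume h: "balanced C regular regular h" and i: "i < N" "c \<in> C"
    have "?c (frag_map ((*) c) id (u i)) = ?c (frag_map id (\<lambda>n. n * c) (u i))"
      using G'(1)[OF i(1), of c 1] G'(2)[OF i, of 1] by (simp add: u_def)
    from frag_eval_square_class_eq[OF h this]
    show "frag_eval (\<lambda>m n. h (c * m) n) (u i) = frag_eval (\<lambda>m n. h m (n * c)) (u i)"
      by (simp add: frag_eval_frag_map)
  qed
  then show thesis by (rule that)
qed

context right_quasibasis
begin

text \<open>
  The coefficient \<open>F(u\<^sub>i\<^sup>1) u\<^sub>i\<^sup>2\<close> of \<open>\<gamma>\<^sub>i\<close> in \<open>F\<close>, obtained by applying \<open>a \<otimes> b \<mapsto> F(a) b\<close> to the quasibasis.
\<close>

definition coeff :: "('a \<Rightarrow> 'a) \<Rightarrow> nat \<Rightarrow> 'a" where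
  "coeff F i = frag_eval (\<lambda>m n. F m * n) (u i)"

lemma expand_right_linear:
  assumes "\<And>x y. F (x + y) = F x + F y" "\<And>x b. b \<in> B \<Longrightarrow> F (x * b) = F x * b"
  shows "F x = (\<Sum>i<N. coeff F i * \<gamma> i x)"
proof -
  have "balanced B regular regular (\<lambda>m n. F m * n)"
    by (simp add: balanced_regular assms distrib_left distrib_right mult.assoc)
  from expand[OF this, of x 1] show ?thesis
    by (simp add: coeff_def frag_eval_mult_right mult.assoc[symmetric])
qed

text \<open>
  For left \<open>C\<close>-linear \<open>F\<close> one has \<open>c F(u\<^sub>i\<^sup>1) u\<^sub>i\<^sup>2 = F(c u\<^sub>i\<^sup>1) u\<^sub>i\<^sup>2 = F(u\<^sub>i\<^sup>1) u\<^sub>i\<^sup>2 c\<close>, because \<open>u\<^sub>i\<close> commutes with \<open>C\<close>.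
\<close>

lemma coeff_centralizer:
  assumes "F \<in> End_bimod C B" "i < N"
  shows "coeff F i \<in> centralizer C"
  unfolding centralizer_def
proof (intro CollectI ballI)
  fix c assume c: "c \<in> C"
  have "balanced B regular regular (\<lambda>m n. F m * n)"
    using assms(1) by (simp add: balanced_regular End_bimod_iff distrib_left distrib_right mult.assoc)
  from central[OF this assms(2) c] assms(1) c show "coeff F i * c = c * coeff F i"
    by (simp add: coeff_def End_bimod_iff mult.assoc[symmetric] frag_eval_mult_right frag_eval_mult_left)
      (simp add: mult.assoc frag_eval_mult_left)
qed

lemma coeff_linear:
  "coeff (\<lambda>a. F a + F' a) i = coeff F i + coeff F' i"
  "coeff (\<lambda>a. v * F a) i = v * coeff F i"
  by (simp_all add: coeff_def distrib_right mult.assoc frag_eval_add_fun frag_eval_mult_left)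

end

section \<open>Modules of endomorphisms\<close>

lemma S_bimod_simps [simp]:
  "carrier (S_bimod C) = End_bimod C C"
  "\<alpha> \<otimes>\<^bsub>S_bimod C\<^esub> \<beta> = (\<lambda>a. \<alpha> a + \<beta> a)" "\<one>\<^bsub>S_bimod C\<^esub> = (\<lambda>_. 0)"
  "lact (S_bimod C) v \<beta> = (\<lambda>a. v * \<beta> a)" "ract (S_bimod C) \<beta> v = (\<lambda>a. \<beta> a * v)"
  by (simp_all add: S_bimod_def)

text \<open>
  Negation is multiplication by \<open>-1 \<in> V\<close>, so closure under it is implied.
\<close>

definition fun_submodule :: "'a::ring_1 set \<Rightarrow> ('a \<Rightarrow> 'a) set \<Rightarrow> bool" where
  "fun_submodule V J \<longleftrightarrow> (\<lambda>_. 0) \<in> J \<and> (\<forall>\<alpha>\<in>J. \<forall>\<beta>\<in>J. (\<lambda>a. \<alpha> a + \<beta> a) \<in> J) \<and>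
     (\<forall>v\<in>V. \<forall>\<alpha>\<in>J. (\<lambda>a. v * \<alpha> a) \<in> J)"

lemma fun_submoduleD:
  assumes "fun_submodule V J"
  shows "(\<lambda>_. 0) \<in> J" "\<alpha> \<in> J \<Longrightarrow> \<beta> \<in> J \<Longrightarrow> (\<lambda>a. \<alpha> a + \<beta> a) \<in> J"
    "v \<in> V \<Longrightarrow> \<alpha> \<in> J \<Longrightarrow> (\<lambda>a. v * \<alpha> a) \<in> J"
  using assms by (auto simp: fun_submodule_def)

lemma fun_submodule_sum:
  assumes "fun_submodule V J" "\<And>i. i \<in> I \<Longrightarrow> v i \<in> V" "\<And>i. i \<in> I \<Longrightarrow> e i \<in> J"
  shows "(\<lambda>a. \<Sum>i\<in>I. v i * e i a) \<in> J"
  using assms(2,3)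
proof (induction I rule: infinite_finite_induct)
  case (insert i I)
  then show ?case
    using fun_submoduleD(2)[OF assms(1), of "\<lambda>a. v i * e i a" "\<lambda>a. \<Sum>i\<in>I. v i * e i a"]
      fun_submoduleD(3)[OF assms(1)] by simp
qed (auto simp: fun_submoduleD(1)[OF assms(1)])

lemma fun_submodule_End: "fun_submodule (centralizer C) (End_bimod C B)"
  by (auto simp: fun_submodule_def End_bimod_iff centralizer_def algebra_simps)
    (simp add: mult.assoc[symmetric])

lemma fun_submodule_minus:
  assumes "fun_submodule (centralizer C) J" "\<alpha> \<in> J"
  shows "(\<lambda>a. - \<alpha> a) \<in> J"
  using fun_submoduleD(3)[OF assms(1), of "- 1" \<alpha>] assms(2) by (simp add: centralizer_def)

lemma comm_group_fun_submodule:
  assumes "fun_submodule (centralizer C) J"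
  shows "comm_group ((S_bimod C)\<lparr>carrier := J\<rparr>)"
proof (rule comm_groupI)
  fix \<alpha> assume "\<alpha> \<in> carrier ((S_bimod C)\<lparr>carrier := J\<rparr>)"
  then show "\<exists>\<beta>\<in>carrier ((S_bimod C)\<lparr>carrier := J\<rparr>).
      \<beta> \<otimes>\<^bsub>(S_bimod C)\<lparr>carrier := J\<rparr>\<^esub> \<alpha> = \<one>\<^bsub>(S_bimod C)\<lparr>carrier := J\<rparr>\<^esub>"
    using fun_submodule_minus[OF assms, of \<alpha>] by (intro bexI[of _ "\<lambda>a. - \<alpha> a"]) auto
qed (auto simp: fun_submoduleD[OF assms] add_ac)

lemma comm_group_S_bimod: "comm_group (S_bimod C)"
proof -
  have "(S_bimod C)\<lparr>carrier := End_bimod C C\<rparr> = S_bimod C"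
    by (simp add: S_bimod_def)
  then show ?thesis
    using comm_group_fun_submodule[OF fun_submodule_End, of C C] by metis
qed

lemma inv_S_bimod:
  assumes "\<alpha> \<in> End_bimod C C"
  shows "inv\<^bsub>S_bimod C\<^esub> \<alpha> = (\<lambda>a. - \<alpha> a)"
  by (rule group.inv_equality[OF comm_group.axioms(2)[OF comm_group_S_bimod]])
    (use assms in \<open>auto simp: End_bimod_iff\<close>)

lemma lsubmodule_S_iff:
  "lsubmodule (centralizer C) (S_bimod C) J \<longleftrightarrow>
     J \<subseteq> End_bimod C C \<and> fun_submodule (centralizer C) J"
proof
  assume "lsubmodule (centralizer C) (S_bimod C) J"
  then show "J \<subseteq> End_bimod C C \<and> fun_submodule (centralizer C) J"
    by (auto simp: lsubmodule_def subgroup_def fun_submodule_def)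
next
  assume J: "J \<subseteq> End_bimod C C \<and> fun_submodule (centralizer C) J"
  then have "(\<lambda>a. - \<alpha> a) \<in> J" if "\<alpha> \<in> J" for \<alpha>
    using that fun_submodule_minus by blast
  then show "lsubmodule (centralizer C) (S_bimod C) J"
    using J by (auto simp: lsubmodule_def subgroup_def inv_S_bimod subset_iff fun_submodule_def)
qed

lemma free_lmod_simps:
  assumes "unital_subring R"
  shows "carrier (free_lmod R I) = {w \<in> I \<rightarrow>\<^sub>E R. finite {i \<in> I. w i \<noteq> 0}}"
    "w \<otimes>\<^bsub>free_lmod R I\<^esub> w' = (\<lambda>i\<in>I. w i + w' i)" "\<one>\<^bsub>free_lmod R I\<^esub> = (\<lambda>i\<in>I. 0)"
    "lact (free_lmod R I) a w = (\<lambda>i\<in>I. a * w i)"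
proof -
  have "comm_group (regular\<lparr>carrier := R\<rparr>)"
  proof (rule comm_groupI)
    fix x assume "x \<in> carrier (regular\<lparr>carrier := R\<rparr>)"
    then show "\<exists>y\<in>carrier (regular\<lparr>carrier := R\<rparr>).
        y \<otimes>\<^bsub>regular\<lparr>carrier := R\<rparr>\<^esub> x = \<one>\<^bsub>regular\<lparr>carrier := R\<rparr>\<^esub>"
      using unital_subring_closed[OF assms] by (intro bexI[of _ "- x"]) auto
  qed (auto simp: unital_subring_closed[OF assms] add_ac)
  then have "group (regular\<lparr>carrier := R\<rparr>)"
    by (rule comm_group.axioms(2))
  then show "carrier (free_lmod R I) = {w \<in> I \<rightarrow>\<^sub>E R. finite {i \<in> I. w i \<noteq> 0}}"
    by (simp add: free_lmod_def Let_def carrier_sum_group)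
qed (simp_all add: free_lmod_def Let_def)

lemma finite_support_add:
  fixes w w' :: "'i \<Rightarrow> 'a::ring_1"
  assumes "finite {i \<in> I. w i \<noteq> 0}" "finite {i \<in> I. w' i \<noteq> 0}"
  shows "finite {i \<in> I. w i + w' i \<noteq> 0}" "finite {i \<in> I. a * w i \<noteq> 0}"
  by (rule finite_subset[of _ "{i \<in> I. w i \<noteq> 0} \<union> {i \<in> I. w' i \<noteq> 0}"]; use assms in auto)
    (rule finite_subset[OF _ assms(1)]; auto)

lemma comm_group_free_lmod:
  assumes R: "unital_subring R"
  shows "comm_group (free_lmod R I)"
proof (rule comm_groupI)
  fix w assume w: "w \<in> carrier (free_lmod R I)"
  show "\<one>\<^bsub>free_lmod R I\<^esub> \<otimes>\<^bsub>free_lmod R I\<^esub> w = w"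
    using w by (auto simp: free_lmod_simps[OF R] fun_eq_iff PiE_def extensional_def)
  show "\<exists>w'\<in>carrier (free_lmod R I). w' \<otimes>\<^bsub>free_lmod R I\<^esub> w = \<one>\<^bsub>free_lmod R I\<^esub>"
    using w finite_support_add(2)[of I w, where a = "- 1"] unital_subring_closed[OF R]
    by (intro bexI[of _ "\<lambda>i\<in>I. - 1 * w i"])
      (auto simp: free_lmod_simps[OF R] PiE_iff fun_eq_iff cong: conj_cong)
qed (auto simp: free_lmod_simps[OF R] fun_eq_iff add_ac PiE_iff unital_subring_closed[OF R]
      finite_support_add cong: conj_cong)

lemma free_lmod_act_hom:
  assumes R: "unital_subring R" and a: "a \<in> R"
  shows "lact (free_lmod R I) a \<in> hom (free_lmod R I) (free_lmod R I)"
  using a by (auto simp: hom_def free_lmod_simps[OF R] fun_eq_iff PiE_iff distrib_left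
      unital_subring_closed[OF R] finite_support_add cong: conj_cong)

text \<open>
  A dual basis \<open>(e\<^sub>i, \<phi>\<^sub>i)\<close> with finitely many members; the dual basis lemma below identifies its
  existence with finite generation and projectivity of \<open>J\<close>. It is indexed by numbers, so repetitions
  among the \<open>e\<^sub>i\<close> are possible.
\<close>

definition dual_basis ::
  "'a::ring_1 set \<Rightarrow> ('a \<Rightarrow> 'a) set \<Rightarrow> nat \<Rightarrow> (nat \<Rightarrow> 'a \<Rightarrow> 'a) \<Rightarrow> (nat \<Rightarrow> ('a \<Rightarrow> 'a) \<Rightarrow> 'a) \<Rightarrow> bool"
where
  "dual_basis V J k e \<phi> \<longleftrightarrow> (\<forall>i<k. e i \<in> J) \<and>
     (\<forall>i<k. \<forall>\<alpha>\<in>J. \<phi> i \<alpha> \<in> V \<and> (\<forall>\<beta>\<in>J. \<phi> i (\<lambda>a. \<alpha> a + \<beta> a) = \<phi> i \<alpha> + \<phi> i \<beta>) \<and>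
       (\<forall>v\<in>V. \<phi> i (\<lambda>a. v * \<alpha> a) = v * \<phi> i \<alpha>)) \<and>
     (\<forall>\<alpha>\<in>J. \<forall>a. \<alpha> a = (\<Sum>i<k. \<phi> i \<alpha> * e i a))"

lemma fun_module_act_hom:
  assumes "fun_submodule (centralizer C) J" "v \<in> centralizer C"
  shows "lact ((S_bimod C)\<lparr>carrier := J\<rparr>) v
    \<in> hom ((S_bimod C)\<lparr>carrier := J\<rparr>) ((S_bimod C)\<lparr>carrier := J\<rparr>)"
  using assms by (auto simp: hom_def distrib_left fun_submoduleD)

text \<open>
  The coordinates embed \<open>J\<close> into a free module, split by \<open>w \<mapsto> \<Sum> w\<^sub>i e\<^sub>i\<close>. The basis of that free
  module has to be a set of functions, so coordinates that belong to the same \<open>e\<^sub>i\<close> are added up.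
\<close>

lemma fin_generated_projective_if_dual_basis:
  assumes J: "fun_submodule (centralizer C) J" and db: "dual_basis (centralizer C) J k e \<phi>"
  shows "fin_generated (centralizer C) ((S_bimod C)\<lparr>carrier := J\<rparr>)"
    and "projective (centralizer C) ((S_bimod C)\<lparr>carrier := J\<rparr>)"
proof -
  let ?V = "centralizer C" and ?M = "(S_bimod C)\<lparr>carrier := J\<rparr>"
  note V = unital_subring_centralizer[of C]
  have e: "e i \<in> J" and \<phi>: "\<alpha> \<in> J \<Longrightarrow> \<phi> i \<alpha> \<in> ?V"
    "\<alpha> \<in> J \<Longrightarrow> \<beta> \<in> J \<Longrightarrow> \<phi> i (\<lambda>a. \<alpha> a + \<beta> a) = \<phi> i \<alpha> + \<phi> i \<beta>"
    "\<alpha> \<in> J \<Longrightarrow> v \<in> ?V \<Longrightarrow> \<phi> i (\<lambda>a. v * \<alpha> a) = v * \<phi> i \<alpha>" if "i < k" for i \<alpha> \<beta> v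
    using db that by (auto simp: dual_basis_def)
  have exp: "(\<lambda>a. \<Sum>i<k. \<phi> i \<alpha> * e i a) = \<alpha>" if "\<alpha> \<in> J" for \<alpha>
    using db that by (auto simp: dual_basis_def)
  show "fin_generated ?V ?M"
    unfolding fin_generated_def
  proof (intro exI[of _ "e ` {..<k}"] conjI allI impI)
    fix X assume X: "lsubmodule ?V ?M X \<and> e ` {..<k} \<subseteq> X"
    then have "fun_submodule ?V X" "X \<subseteq> J"
      by (auto simp: lsubmodule_def subgroup_def fun_submodule_def)
    moreover have "\<alpha> \<in> X" if "\<alpha> \<in> J" for \<alpha>
      using fun_submodule_sum[OF \<open>fun_submodule ?V X\<close>, of "{..<k}" "\<lambda>i. \<phi> i \<alpha>" e] X \<phi>(1) that
      by (force simp: exp)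
    ultimately show "X = carrier ?M" by auto
  qed (use e in auto)
  define I where "I = e ` {..<k}"
  define f where "f \<alpha> = (\<lambda>s\<in>I. \<Sum>i | i < k \<and> e i = s. \<phi> i \<alpha>)" for \<alpha>
  define g :: "(('a \<Rightarrow> 'a) \<Rightarrow> 'a) \<Rightarrow> 'a \<Rightarrow> 'a" where "g w = (\<lambda>a. \<Sum>s\<in>I. w s * s a)" for w
  have I: "finite I" "I \<subseteq> J"
    using e by (auto simp: I_def)
  have sumV: "(\<Sum>i | i < k \<and> e i = s. \<phi> i \<alpha>) \<in> ?V" if "\<alpha> \<in> J" for s \<alpha>
  proof -
    have "finite K \<Longrightarrow> K \<subseteq> {..<k} \<Longrightarrow> (\<Sum>i\<in>K. \<phi> i \<alpha>) \<in> ?V" for K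
      by (induction K rule: finite_induct) (auto simp: unital_subring_closed[OF V] \<phi> that)
    from this[of "{i. i < k \<and> e i = s}"] show ?thesis by auto
  qed
  have "lmodule_summand ?V ?M (free_lmod ?V I)"
  proof (rule lmodule_summandI)
    show "f \<in> lmodule_hom ?V ?M (free_lmod ?V I)"
      unfolding lmodule_hom_def hom_def
      using I sumV
      by (auto simp: free_lmod_simps[OF V] f_def fun_eq_iff \<phi> sum.distrib sum_distrib_left)
    show "g \<in> lmodule_hom ?V (free_lmod ?V I) ?M"
      unfolding lmodule_hom_def hom_def
      using I fun_submodule_sum[OF J, of I _ "\<lambda>s. s"]
      by (auto simp: free_lmod_simps[OF V] g_def fun_eq_iff distrib_right sum.distrib
          sum_distrib_left mult.assoc PiE_iff subset_iff)
    show "g (f \<alpha>) = \<alpha>" if "\<alpha> \<in> carrier ?M" for \<alpha>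
    proof
      fix a
      have "g (f \<alpha>) a = (\<Sum>s\<in>I. \<Sum>i | i \<in> {..<k} \<and> e i = s. \<phi> i \<alpha> * e i a)"
        by (simp add: g_def f_def sum_distrib_right)
      also have "\<dots> = (\<Sum>i<k. \<phi> i \<alpha> * e i a)"
        unfolding I_def by (rule sum.image_gen[symmetric]) simp
      also have "\<dots> = \<alpha> a"
        using exp[of \<alpha>] that by (auto dest: fun_cong)
      finally show "g (f \<alpha>) a = \<alpha> a" .
    qed
  qed (rule comm_group_free_lmod[OF V] comm_group.axioms(2)[OF comm_group_fun_submodule[OF J]]
      free_lmod_act_hom[OF V] fun_module_act_hom[OF J], assumption?)+
  then show "projective ?V ?M"
    unfolding projective_def by blast
qed

text \<open>
  A splitting over a free module provides coordinates. Finitely many generators have coordinates in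
  finitely many places, and the elements with coordinates only there form a submodule; so finitely
  many coordinates suffice for all of \<open>J\<close>.
\<close>

lemma ex_dual_basis:
  assumes J: "fun_submodule (centralizer C) J"
    and fg: "fin_generated (centralizer C) ((S_bimod C)\<lparr>carrier := J\<rparr>)"
    and proj: "projective (centralizer C) ((S_bimod C)\<lparr>carrier := J\<rparr>)"
  obtains k e \<phi> where "dual_basis (centralizer C) J k e \<phi>"
proof -
  let ?V = "centralizer C" and ?M = "(S_bimod C)\<lparr>carrier := J\<rparr>"
  note V = unital_subring_centralizer[of C]
  obtain I :: "('a \<Rightarrow> 'a) set" where "lmodule_summand ?V ?M (free_lmod ?V I)"
    using proj by (auto simp: projective_def)
  then have "\<exists>f g. f \<in> lmodule_hom ?V ?M (free_lmod ?V I) \<and> g \<in> lmodule_hom ?V (free_lmod ?V I) ?M \<and>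
      (\<forall>\<alpha>\<in>J. g (f \<alpha>) = \<alpha>)"
  proof (rule lmodule_summand_retraction)
    show "comm_group (free_lmod ?V I)" by (rule comm_group_free_lmod[OF V])
    show "group ?M" by (rule comm_group.axioms(2)[OF comm_group_fun_submodule[OF J]])
    show "lact (free_lmod ?V I) r \<in> hom (free_lmod ?V I) (free_lmod ?V I)" if "r \<in> ?V" for r
      by (rule free_lmod_act_hom[OF V that])
    show "lact ?M r \<in> hom ?M ?M" if "r \<in> ?V" for r
      by (rule fun_module_act_hom[OF J that])
  qed (intro exI conjI ballI, assumption, assumption, simp)
  then obtain f g where f: "f \<in> lmodule_hom ?V ?M (free_lmod ?V I)"
    and g: "g \<in> lmodule_hom ?V (free_lmod ?V I) ?M" and gf: "\<And>\<alpha>. \<alpha> \<in> J \<Longrightarrow> g (f \<alpha>) = \<alpha>"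
    by blast
  have ghom: "g \<in> hom (free_lmod ?V I) ?M"
    using g by (simp add: lmodule_hom_def)
  have gact: "g (lact (free_lmod ?V I) v w) = lact ?M v (g w)"
    if "v \<in> ?V" "w \<in> carrier (free_lmod ?V I)" for v w
    using g that unfolding lmodule_hom_def by blast
  have fP: "f \<alpha> \<in> carrier (free_lmod ?V I)" if "\<alpha> \<in> J" for \<alpha>
    using f that by (auto simp: lmodule_hom_def hom_def)
  have fJ: "f \<alpha> \<in> I \<rightarrow>\<^sub>E ?V" "finite {i \<in> I. f \<alpha> i \<noteq> 0}" if "\<alpha> \<in> J" for \<alpha>
    using fP[OF that] by (simp_all add: free_lmod_simps[OF V])
  have fadd: "f (\<lambda>a. \<alpha> a + \<beta> a) = (\<lambda>i\<in>I. f \<alpha> i + f \<beta> i)" if "\<alpha> \<in> J" "\<beta> \<in> J" for \<alpha> \<beta>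
    using f that by (simp add: lmodule_hom_def hom_def free_lmod_simps[OF V])
  have fscale: "f (\<lambda>a. v * \<alpha> a) = (\<lambda>i\<in>I. v * f \<alpha> i)" if "\<alpha> \<in> J" "v \<in> ?V" for \<alpha> v
    using f that by (simp add: lmodule_hom_def free_lmod_simps[OF V])
  have f0: "f (\<lambda>_. 0) = (\<lambda>i\<in>I. 0)"
    using fscale[of "\<lambda>_. 0" 0] fun_submoduleD(1)[OF J] unital_subring_closed[OF V] by simp
  obtain F where F: "finite F" "F \<subseteq> J" "\<And>X. lsubmodule ?V ?M X \<Longrightarrow> F \<subseteq> X \<Longrightarrow> X = J"
    using fg by (auto simp: fin_generated_def)
  define I0 where "I0 = (\<Union>s\<in>F. {i \<in> I. f s i \<noteq> 0})"
  have I0: "finite I0" "I0 \<subseteq> I"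
    using F fJ(2) by (auto simp: I0_def)
  define X where "X = {\<alpha> \<in> J. \<forall>i\<in>I - I0. f \<alpha> i = 0}"
  have XM: "fun_submodule ?V X"
    unfolding fun_submodule_def X_def by (auto simp: fun_submoduleD[OF J] f0 fadd fscale)
  have "lsubmodule ?V ?M X"
  proof -
    interpret M: comm_group ?M by (rule comm_group_fun_submodule[OF J])
    have "inv\<^bsub>?M\<^esub> \<alpha> \<in> X" if "\<alpha> \<in> X" for \<alpha>
    proof -
      have m: "(\<lambda>a. - \<alpha> a) \<in> X"
        by (rule fun_submodule_minus[OF XM that])
      then have "inv\<^bsub>?M\<^esub> \<alpha> = (\<lambda>a. - \<alpha> a)"
        using that by (intro M.inv_equality) (auto simp: X_def)
      then show ?thesis using m by simp
    qed
    then show ?thesis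
      using XM by (auto simp: lsubmodule_def subgroup_def X_def[symmetric] fun_submodule_def)
        (auto simp: X_def)
  qed
  then have "X = J"
    by (rule F(3)) (use F in \<open>auto simp: X_def I0_def\<close>)
  then have supp: "f \<alpha> i = 0" if "\<alpha> \<in> J" "i \<in> I - I0" for \<alpha> i
    using that by (auto simp: X_def)
  define \<delta> where "\<delta> j = (\<lambda>i\<in>I. if i = j then 1 else 0 :: 'a)" for j
  have \<delta>: "\<delta> j \<in> carrier (free_lmod ?V I)" for j
  proof -
    have "finite {i \<in> I. \<delta> j i \<noteq> 0}"
      by (rule finite_subset[of _ "{j}"]) (auto simp: \<delta>_def)
    then show ?thesis
      by (auto simp: free_lmod_simps[OF V] \<delta>_def unital_subring_closed[OF V])
  qed
  have partial: "g (\<lambda>i\<in>I. if i \<in> K then w i else 0) = (\<lambda>a. \<Sum>j\<in>K. w j * g (\<delta> j) a)"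
    if "finite K" "K \<subseteq> I" and w: "w \<in> I \<rightarrow>\<^sub>E ?V" for K w
    using that(1,2)
  proof (induction K)
    case empty
    have "group (free_lmod ?V I)" "group ?M"
      by (rule comm_group.axioms(2), rule comm_group_free_lmod[OF V] comm_group_fun_submodule[OF J])+
    then have "g \<one>\<^bsub>free_lmod ?V I\<^esub> = \<one>\<^bsub>?M\<^esub>"
      using hom_one[OF ghom] by blast
    moreover have "(\<lambda>i\<in>I. if i \<in> {} then w i else 0) = \<one>\<^bsub>free_lmod ?V I\<^esub>"
      unfolding free_lmod_simps[OF V] by simp
    ultimately show ?case by simp
  next
    case (insert j K)
    let ?w = "\<lambda>i\<in>I. if i \<in> K then w i else 0"
    have wP: "?w \<in> carrier (free_lmod ?V I)"
    proof -
      have "finite {i \<in> I. ?w i \<noteq> 0}"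
        by (rule finite_subset[OF _ \<open>finite K\<close>]) auto
      then show ?thesis
        using w by (auto simp: free_lmod_simps[OF V] unital_subring_closed[OF V] PiE_iff)
    qed
    have wj: "w j \<in> ?V"
      using w insert by auto
    have split: "(\<lambda>i\<in>I. if i \<in> insert j K then w i else 0)
        = ?w \<otimes>\<^bsub>free_lmod ?V I\<^esub> lact (free_lmod ?V I) (w j) (\<delta> j)"
      by (rule ext) (use insert.hyps insert.prems in \<open>auto simp: free_lmod_simps[OF V] \<delta>_def\<close>)
    have "lact (free_lmod ?V I) (w j) (\<delta> j) \<in> carrier (free_lmod ?V I)"
      by (rule hom_in_carrier[OF free_lmod_act_hom[OF V wj] \<delta>])
    then have eq: "g (\<lambda>i\<in>I. if i \<in> insert j K then w i else 0)
        = g ?w \<otimes>\<^bsub>?M\<^esub> lact ?M (w j) (g (\<delta> j))"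
      unfolding split gact[OF wj \<delta>, symmetric] by (rule hom_mult[OF ghom wP])
    have IH: "g ?w = (\<lambda>a. \<Sum>j\<in>K. w j * g (\<delta> j) a)"
      by (rule insert.IH) (use insert.prems in simp)
    show ?case
      unfolding eq IH by (simp add: insert.hyps add.commute)
  qed
  have exp: "\<alpha> a = (\<Sum>j\<in>I0. f \<alpha> j * g (\<delta> j) a)" if "\<alpha> \<in> J" for \<alpha> a
  proof -
    have "(\<lambda>i\<in>I. if i \<in> I0 then f \<alpha> i else 0) = f \<alpha>"
      by (rule ext) (use fJ(1)[OF that] supp[OF that] in \<open>auto simp: PiE_def extensional_def\<close>)
    then have "\<alpha> = (\<lambda>a. \<Sum>j\<in>I0. f \<alpha> j * g (\<delta> j) a)"
      using partial[OF I0 fJ(1)[OF that]] gf[OF that] by metis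
    then show ?thesis by (rule fun_cong)
  qed
  obtain b where b: "bij_betw b {..<card I0} I0"
    using ex_bij_betw_nat_finite[OF I0(1)] by (auto simp: atLeast0LessThan)
  have bI: "i < card I0 \<Longrightarrow> b i \<in> I0" for i
    using b by (auto simp: bij_betw_def)
  have gJ: "g (\<delta> j) \<in> J" for j
    using hom_in_carrier[OF ghom \<delta>] by simp
  have "dual_basis ?V J (card I0) (\<lambda>i. g (\<delta> (b i))) (\<lambda>i \<alpha>. f \<alpha> (b i))"
    unfolding dual_basis_def
  proof (intro conjI allI impI ballI)
    show "\<alpha> a = (\<Sum>i<card I0. f \<alpha> (b i) * g (\<delta> (b i)) a)" if "\<alpha> \<in> J" for \<alpha> a
      by (rule trans[OF exp[OF that]
            sum.reindex_bij_betw[OF b, of "\<lambda>j. f \<alpha> j * g (\<delta> j) a", symmetric]])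
    fix i assume "i < card I0"
    then have i: "b i \<in> I"
      using bI I0 by blast
    show "g (\<delta> (b i)) \<in> J" by (rule gJ)
    fix \<alpha> assume \<alpha>: "\<alpha> \<in> J"
    show "f \<alpha> (b i) \<in> ?V" using fJ(1)[OF \<alpha>] i by (rule PiE_mem)
    show "f (\<lambda>a. \<alpha> a + \<beta> a) (b i) = f \<alpha> (b i) + f \<beta> (b i)" if "\<beta> \<in> J" for \<beta>
      unfolding fadd[OF \<alpha> that] using i by simp
    show "f (\<lambda>a. v * \<alpha> a) (b i) = v * f \<alpha> (b i)" if "v \<in> ?V" for v
      unfolding fscale[OF \<alpha> that] using i by simp
  qed
  then show thesis by (rule that)
qed

section \<open>Evaluation of tensors and the coproduct\<close>

lemma frag_eval_diff_fun: "frag_eval (\<lambda>m n. h m n - h' m n) c = frag_eval h c - frag_eval h' c"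
  by (simp add: frag_eval_def right_diff_distrib sum_subtractf case_prod_unfold)

lemma frag_eval_swap:
  "frag_eval (\<lambda>a b. frag_eval (h a b) d) c = frag_eval (\<lambda>m n. frag_eval (\<lambda>a b. h a b m n) c) d"
  by (induction c rule: frag_pair_induct) (auto simp: frag_eval_diff_fun)

lemma (in tensor_factors) rels_sum: "(\<And>i. i \<in> I \<Longrightarrow> c i \<in> rels) \<Longrightarrow> sum c I \<in> rels"
  by (induction I rule: infinite_finite_induct) (auto simp: rels_closed)

lemma frag_keys_induct [consumes 1, case_names zero diff pair]:
  assumes "Poly_Mapping.keys c \<subseteq> S" "P 0"
    "\<And>c d. Poly_Mapping.keys c \<subseteq> S \<Longrightarrow> Poly_Mapping.keys d \<subseteq> S \<Longrightarrow> P c \<Longrightarrow> P d \<Longrightarrow> P (c - d)"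
    "\<And>p. p \<in> S \<Longrightarrow> P (frag_of p)"
  shows "P c"
  using assms by (rule free_Abelian_group_induct)

text \<open>
  If \<open>n = \<Sum> w\<^sub>j(n) \<gamma>\<^sub>j\<close> holds for the elements of \<open>N\<close>, then \<open>m \<otimes> n = \<Sum> m w\<^sub>j(n) \<otimes> \<gamma>\<^sub>j\<close>, so every tensor
  has the form \<open>\<Sum> \<mu>\<^sub>j \<otimes> \<gamma>\<^sub>j\<close> with \<open>\<mu>\<^sub>j\<close> depending additively on it. The maps \<open>\<mu>\<^sub>j\<close> are passed as
  parameters because they are computed differently for \<open>M = A\<close> and for \<open>M = S\<close>.
\<close>

lemma (in tensor_factors) expand_along_generators:
  fixes k :: nat
  assumes \<gamma>: "\<And>j. j < k \<Longrightarrow> \<gamma> j \<in> carrier N"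
    and w: "\<And>j n. j < k \<Longrightarrow> n \<in> carrier N \<Longrightarrow> w j n \<in> R"
    and split: "\<And>m n. m \<in> carrier M \<Longrightarrow> n \<in> carrier N \<Longrightarrow>
       frag_of (m, n) - (\<Sum>j<k. frag_of (m, lact N (w j n) (\<gamma> j))) \<in> rels"
    and \<mu>: "\<And>j c. j < k \<Longrightarrow> Poly_Mapping.keys c \<subseteq> pairs \<Longrightarrow> \<mu> j c \<in> carrier M"
    and \<mu>_pair: "\<And>j m n. j < k \<Longrightarrow> m \<in> carrier M \<Longrightarrow> n \<in> carrier N \<Longrightarrow>
       \<mu> j (frag_of (m, n)) = ract M m (w j n)"
    and \<mu>_diff: "\<And>j c d. j < k \<Longrightarrow> \<mu> j c = \<mu> j (c - d) \<otimes>\<^bsub>M\<^esub> \<mu> j d"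
    and "Poly_Mapping.keys c \<subseteq> pairs"
  shows "c - (\<Sum>j<k. frag_of (\<mu> j c, \<gamma> j)) \<in> rels"
  using assms(7)
proof (induction c rule: frag_keys_induct)
  case zero
  have "frag_of (\<mu> j 0, \<gamma> j) \<in> rels" if "j < k" for j
    using rels_closed(3)[OF rels_basic(1)[of "\<mu> j 0" "\<mu> j 0" "\<gamma> j"]] \<mu>[OF that, of 0]
      \<mu>_diff[OF that, of 0 0] \<gamma>[OF that] by simp
  then have "- (\<Sum>j<k. frag_of (\<mu> j 0, \<gamma> j)) \<in> rels"
    by (intro rels_closed rels_sum) auto
  then show ?case by simp
next
  case (diff c d)
  have "frag_of (\<mu> j c, \<gamma> j) - frag_of (\<mu> j (c - d), \<gamma> j) - frag_of (\<mu> j d, \<gamma> j) \<in> rels"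
    if "j < k" for j
  proof -
    have "Poly_Mapping.keys (c - d) \<subseteq> pairs"
      using diff keys_diff[of c d] by blast
    then show ?thesis
      using rels_basic(1)[of "\<mu> j (c - d)" "\<mu> j d" "\<gamma> j"] \<mu>_diff[OF that, of c d] \<mu> \<gamma> that diff by auto
  qed
  then have "(\<Sum>j<k. frag_of (\<mu> j c, \<gamma> j) - frag_of (\<mu> j (c - d), \<gamma> j) - frag_of (\<mu> j d, \<gamma> j)) \<in> rels"
    by (intro rels_sum) auto
  then have "(c - (\<Sum>j<k. frag_of (\<mu> j c, \<gamma> j))) - (d - (\<Sum>j<k. frag_of (\<mu> j d, \<gamma> j)))
    + (\<Sum>j<k. frag_of (\<mu> j c, \<gamma> j) - frag_of (\<mu> j (c - d), \<gamma> j) - frag_of (\<mu> j d, \<gamma> j)) \<in> rels"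
    by (intro rels_closed(2)[OF rels_closed(4)[OF diff(3,4)]])
  then show ?case
    by (simp add: sum_subtractf sum.distrib algebra_simps)
next
  case (pair p)
  then obtain m n where p: "p = (m, n)" "m \<in> carrier M" "n \<in> carrier N"
    by auto
  have "- (\<Sum>j<k. frag_of (ract M m (w j n), \<gamma> j) - frag_of (m, lact N (w j n) (\<gamma> j))) \<in> rels"
    using p w \<gamma> by (intro rels_closed rels_sum rels_basic) auto
  from rels_closed(2)[OF split[OF p(2,3)] this] show ?case
    using p by (simp add: \<mu>_pair sum_subtractf)
qed

lemma frag_of_fun_sum:
  fixes N :: "('a, 'b \<Rightarrow> 'c::ab_group_add, 'y) lmod_scheme" and k :: nat
  assumes "tensor_factors R M N" and add: "\<And>\<alpha> \<beta>. \<alpha> \<otimes>\<^bsub>N\<^esub> \<beta> = (\<lambda>a. \<alpha> a + \<beta> a)"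
    and "(\<lambda>_. 0) \<in> carrier N" "m \<in> carrier M" "\<And>j. j < k \<Longrightarrow> \<nu> j \<in> carrier N"
  shows "frag_of (m, \<lambda>a. \<Sum>j<k. \<nu> j a) - (\<Sum>j<k. frag_of (m, \<nu> j)) \<in> tensor_rels R M N \<and>
    (\<lambda>a. \<Sum>j<k. \<nu> j a) \<in> carrier N"
  using assms(5)
proof (induction k)
  interpret tensor_factors R M N by fact
  case 0
  show ?case
    using rels_closed(3)[OF rels_basic(2)[OF assms(4,3,3)]] assms(3) by (simp add: add)
next
  interpret tensor_factors R M N by fact
  case (Suc k)
  let ?s = "\<lambda>a. \<Sum>j<k. \<nu> j a"
  have IH: "frag_of (m, ?s) - (\<Sum>j<k. frag_of (m, \<nu> j)) \<in> rels" "?s \<in> carrier N"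
    using Suc by auto
  have "frag_of (m, \<lambda>a. ?s a + \<nu> k a) - frag_of (m, ?s) - frag_of (m, \<nu> k) \<in> rels"
    using rels_basic(2)[OF assms(4) IH(2), of "\<nu> k"] Suc.prems by (simp add: add)
  moreover have "(\<lambda>a. ?s a + \<nu> k a) \<in> carrier N"
    using N_mult[OF IH(2), of "\<nu> k"] Suc.prems by (simp add: add)
  ultimately show ?case
    using rels_closed(2)[OF _ IH(1), of "frag_of (m, \<lambda>a. ?s a + \<nu> k a) - frag_of (m, ?s) - frag_of (m, \<nu> k)"]
    by (simp add: algebra_simps)
qed

definition fun_lmod :: "('a::ring_1 \<Rightarrow> 'a) set \<Rightarrow> ('a, 'a \<Rightarrow> 'a) lmod" where
  "fun_lmod J = \<lparr>carrier = J, monoid.mult = (\<lambda>\<alpha> \<beta> a. \<alpha> a + \<beta> a), one = (\<lambda>_. 0),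
     lact = (\<lambda>v \<beta> a. v * \<beta> a)\<rparr>"

lemma fun_lmod_simps [simp]:
  "carrier (fun_lmod J) = J" "\<alpha> \<otimes>\<^bsub>fun_lmod J\<^esub> \<beta> = (\<lambda>a. \<alpha> a + \<beta> a)" "\<one>\<^bsub>fun_lmod J\<^esub> = (\<lambda>_. 0)"
  "lact (fun_lmod J) v \<beta> = (\<lambda>a. v * \<beta> a)"
  by (simp_all add: fun_lmod_def)

lemma tensor_factors_fun_lmod:
  assumes "fun_submodule V J"
  shows "tensor_factors V regular (fun_lmod J)"
  by unfold_locales (auto simp: fun_submoduleD[OF assms])

lemma End_bimod_scale_right:
  assumes "\<alpha> \<in> End_bimod C C" "v \<in> centralizer C"
  shows "(\<lambda>a. \<alpha> a * v) \<in> End_bimod C C"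
  using assms by (auto simp: End_bimod_iff centralizer_def distrib_right mult.assoc)

lemma tensor_factors_S:
  assumes "fun_submodule (centralizer C) J"
  shows "tensor_factors (centralizer C) (S_bimod C) ((S_bimod C)\<lparr>carrier := J\<rparr>)"
  by unfold_locales (auto simp: fun_submoduleD[OF assms] End_bimod_scale_right
      fun_submoduleD(2)[OF fun_submodule_End])

lemma tensor_factors_SS: "tensor_factors (centralizer C) (S_bimod C) (S_bimod C)"
  by unfold_locales (auto simp: fun_submoduleD[OF fun_submodule_End] End_bimod_scale_right)

context
  fixes C :: "'a::ring_1 set" and N \<gamma> u
  assumes qb: "right_quasibasis C C N \<gamma> u"
begin

interpretation right_quasibasis C C N \<gamma> u by (rule qb)

text \<open>
  Every \<open>\<beta> \<in> S\<close> is \<open>\<Sum> v\<^sub>j \<gamma>\<^sub>j\<close> with coefficients \<open>v\<^sub>j \<in> V\<close>, so a tensor over \<open>V\<close> with right factor \<open>S\<close> has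
  coordinates \<open>\<mu>\<^sub>j\<close> with respect to the \<open>\<gamma>\<^sub>j\<close>; it is zero when these coordinates are those of \<open>0\<close>.
\<close>

lemma mem_tensor_rels_if_coordinates_vanish:
  assumes tf: "tensor_factors (centralizer C) M F"
    and F: "carrier F = End_bimod C C" "\<And>\<alpha> \<beta>. \<alpha> \<otimes>\<^bsub>F\<^esub> \<beta> = (\<lambda>a. \<alpha> a + \<beta> a)"
      "\<And>v \<alpha>. lact F v \<alpha> = (\<lambda>a. v * \<alpha> a)"
    and \<mu>: "\<And>j c. j < N \<Longrightarrow> Poly_Mapping.keys c \<subseteq> carrier M \<times> End_bimod C C \<Longrightarrow> \<mu> j c \<in> carrier M"
      "\<And>j m \<beta>. j < N \<Longrightarrow> \<mu> j (frag_of (m, \<beta>)) = ract M m (coeff \<beta> j)"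
      "\<And>j c d. j < N \<Longrightarrow> \<mu> j c = \<mu> j (c - d) \<otimes>\<^bsub>M\<^esub> \<mu> j d"
    and c: "Poly_Mapping.keys c \<subseteq> carrier M \<times> End_bimod C C" "\<And>j. j < N \<Longrightarrow> \<mu> j c = \<mu> j 0"
  shows "c \<in> tensor_rels (centralizer C) M F"
proof -
  interpret tensor_factors "centralizer C" M F by (rule tf)
  have z: "(\<lambda>_. 0) \<in> carrier F"
    using fun_submoduleD(1)[OF fun_submodule_End] F by simp
  have "frag_of (m, \<beta>) - (\<Sum>j<N. frag_of (m, lact F (coeff \<beta> j) (\<gamma> j))) \<in> rels"
    if m: "m \<in> carrier M" and \<beta>: "\<beta> \<in> carrier F" for m \<beta>
  proof -
    have "\<beta> = (\<lambda>a. \<Sum>j<N. coeff \<beta> j * \<gamma> j a)"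
      using \<beta> F by (intro ext expand_right_linear) (auto simp: End_bimod_iff)
    moreover have "(\<lambda>a. coeff \<beta> j * \<gamma> j a) \<in> carrier F" if "j < N" for j
      using fun_submoduleD(3)[OF fun_submodule_End coeff_centralizer gamma] that \<beta> F by simp
    ultimately show ?thesis
      using frag_of_fun_sum[OF tf F(2) z m, of N "\<lambda>j a. coeff \<beta> j * \<gamma> j a"] by (simp add: F)
  qed
  then have *: "c - (\<Sum>j<N. frag_of (\<mu> j c, \<gamma> j)) \<in> rels" if "Poly_Mapping.keys c \<subseteq> pairs" for c
    using that by (intro expand_along_generators[of N \<gamma> "\<lambda>j \<beta>. coeff \<beta> j"] \<mu>(3))
      (auto simp: F gamma coeff_centralizer \<mu>)
  have "(c - (\<Sum>j<N. frag_of (\<mu> j c, \<gamma> j))) - (0 - (\<Sum>j<N. frag_of (\<mu> j 0, \<gamma> j))) \<in> rels"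
    by (intro rels_closed(4) *) (use c(1) in \<open>auto simp: F\<close>)
  then show ?thesis
    using c(2) by simp
qed

text \<open>
  The map \<open>A \<otimes>\<^sub>V S \<rightarrow> End A\<^sub>C\<close>, \<open>a \<otimes> \<beta> \<mapsto> a \<beta>\<close>, is injective: the coordinate
  \<open>\<Sum> a \<beta>(u\<^sub>j\<^sup>1) u\<^sub>j\<^sup>2\<close> of a tensor is obtained from the function \<open>\<Sum> a \<beta>\<close>, so it vanishes with it.
\<close>

lemma eval_injective:
  assumes "Poly_Mapping.keys c \<subseteq> UNIV \<times> End_bimod C C" "\<And>x. frag_eval (\<lambda>a \<beta>. a * \<beta> x) c = 0"
  shows "c \<in> tensor_rels (centralizer C) regular (fun_lmod (End_bimod C C))"
proof (rule mem_tensor_rels_if_coordinates_vanish[where \<mu> = "\<lambda>j c. frag_eval (\<lambda>a \<beta>. a * coeff \<beta> j) c"])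
  show "frag_eval (\<lambda>a \<beta>. a * coeff \<beta> j) c = frag_eval (\<lambda>a \<beta>. a * coeff \<beta> j) 0" for j
  proof -
    have "frag_eval (\<lambda>a \<beta>. a * coeff \<beta> j) c
        = frag_eval (\<lambda>a \<beta>. frag_eval (\<lambda>m n. a * \<beta> m * n) (u j)) c"
      by (simp only: coeff_def frag_eval_mult_left mult.assoc)
    also have "\<dots> = frag_eval (\<lambda>m n. frag_eval (\<lambda>a \<beta>. a * \<beta> m) c * n) (u j)"
      by (subst frag_eval_swap) (simp only: frag_eval_mult_right)
    finally show ?thesis by (simp add: assms(2))
  qed
qed (use assms(1) in \<open>simp_all add: tensor_factors_fun_lmod[OF fun_submodule_End]\<close>)

text \<open>
  An element of \<open>S \<otimes>\<^sub>V S\<close> is determined by its evaluations \<open>\<Sum> \<alpha>(x) \<beta>(y)\<close>, again because its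
  coordinates \<open>x \<mapsto> \<Sum> \<alpha>(x) \<beta>(u\<^sub>j\<^sup>1) u\<^sub>j\<^sup>2\<close> can be read off from them. This is the uniqueness of the coproduct.
\<close>

lemma tensor_eval_injective:
  assumes "Poly_Mapping.keys c \<subseteq> End_bimod C C \<times> End_bimod C C" "\<And>x y. tensor_eval c x y = 0"
  shows "c \<in> tensor_rels (centralizer C) (S_bimod C) (S_bimod C)"
proof (rule mem_tensor_rels_if_coordinates_vanish[where \<mu> = "\<lambda>j c x. frag_eval (\<lambda>\<alpha> \<beta>. \<alpha> x * coeff \<beta> j) c"])
  show "(\<lambda>x. frag_eval (\<lambda>\<alpha> \<beta>. \<alpha> x * coeff \<beta> j) c) = (\<lambda>x. frag_eval (\<lambda>\<alpha> \<beta>. \<alpha> x * coeff \<beta> j) 0)" for j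
  proof
    fix x
    have "frag_eval (\<lambda>\<alpha> \<beta>. \<alpha> x * coeff \<beta> j) c
        = frag_eval (\<lambda>\<alpha> \<beta>. frag_eval (\<lambda>m n. \<alpha> x * \<beta> m * n) (u j)) c"
      by (simp only: coeff_def frag_eval_mult_left mult.assoc)
    also have "\<dots> = frag_eval (\<lambda>m n. frag_eval (\<lambda>\<alpha> \<beta>. \<alpha> x * \<beta> m) c * n) (u j)"
      by (subst frag_eval_swap) (simp only: frag_eval_mult_right)
    finally show "frag_eval (\<lambda>\<alpha> \<beta>. \<alpha> x * coeff \<beta> j) c = frag_eval (\<lambda>\<alpha> \<beta>. \<alpha> x * coeff \<beta> j) 0"
      using assms(2) by (simp add: tensor_eval_frag_eval)
  qed
  fix j :: nat and d :: "('a \<Rightarrow> 'a) \<times> ('a \<Rightarrow> 'a) \<Rightarrow>\<^sub>0 int"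
  assume j: "j < N" and d: "Poly_Mapping.keys d \<subseteq> carrier (S_bimod C) \<times> End_bimod C C"
  have dE: "\<alpha> \<in> End_bimod C C \<and> \<beta> \<in> End_bimod C C" if "(\<alpha>, \<beta>) \<in> Poly_Mapping.keys d" for \<alpha> \<beta>
    using d that by auto
  have *: "frag_eval (\<lambda>\<alpha> \<beta>. \<alpha> (x * c) * coeff \<beta> j) d = frag_eval (\<lambda>\<alpha> \<beta>. \<alpha> x * coeff \<beta> j * c) d"
    if c: "c \<in> C" for x c
  proof (rule frag_eval_cong)
    fix \<alpha> \<beta> assume "(\<alpha>, \<beta>) \<in> Poly_Mapping.keys d"
    then have \<alpha>\<beta>: "\<alpha> \<in> End_bimod C C" "\<beta> \<in> End_bimod C C"
      using d by auto
    have "coeff \<beta> j * c = c * coeff \<beta> j"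
      using coeff_centralizer[OF \<alpha>\<beta>(2) j] c by (simp add: centralizer_def)
    then show "\<alpha> (x * c) * coeff \<beta> j = \<alpha> x * coeff \<beta> j * c"
      using \<alpha>\<beta>(1) c by (simp add: End_bimod_iff mult.assoc)
  qed
  have **: "frag_eval (\<lambda>\<alpha> \<beta>. \<alpha> (c * x) * coeff \<beta> j) d = frag_eval (\<lambda>\<alpha> \<beta>. c * (\<alpha> x * coeff \<beta> j)) d"
    if "c \<in> C" for x c
  proof (rule frag_eval_cong)
    fix \<alpha> \<beta> assume "(\<alpha>, \<beta>) \<in> Poly_Mapping.keys d"
    from dE[OF this] that show "\<alpha> (c * x) * coeff \<beta> j = c * (\<alpha> x * coeff \<beta> j)"
      by (simp add: End_bimod_iff mult.assoc)
  qed
  have "frag_eval (\<lambda>\<alpha> \<beta>. \<alpha> (x + y) * coeff \<beta> j) d = frag_eval (\<lambda>\<alpha> \<beta>. \<alpha> x * coeff \<beta> j + \<alpha> y * coeff \<beta> j) d"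
    for x y
  proof (rule frag_eval_cong)
    fix \<alpha> \<beta> assume "(\<alpha>, \<beta>) \<in> Poly_Mapping.keys d"
    from dE[OF this] show "\<alpha> (x + y) * coeff \<beta> j = \<alpha> x * coeff \<beta> j + \<alpha> y * coeff \<beta> j"
      by (simp add: End_bimod_iff distrib_right)
  qed
  with * ** show "(\<lambda>x. frag_eval (\<lambda>\<alpha> \<beta>. \<alpha> x * coeff \<beta> j) d) \<in> carrier (S_bimod C)"
    by (simp add: End_bimod_iff frag_eval_add_fun frag_eval_mult_left frag_eval_mult_right)
qed (use assms(1) in \<open>simp_all add: tensor_factors_SS\<close>)

end

context left_quasibasis
begin

text \<open>
  A representative of \<open>\<Delta>(\<beta>) = \<Sum> \<gamma>\<^sub>i \<otimes> u\<^sub>i\<^sup>1 \<beta>(u\<^sub>i\<^sup>2 -)\<close>.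
\<close>

definition comult :: "('a \<Rightarrow> 'a) \<Rightarrow> ('a \<Rightarrow> 'a) \<times> ('a \<Rightarrow> 'a) \<Rightarrow>\<^sub>0 int" where
  "comult \<beta> = (\<Sum>i<N. frag_of (\<gamma> i, \<lambda>y. frag_eval (\<lambda>m n. m * \<beta> (n * y)) (u i)))"

text \<open>
  Applying \<open>a \<otimes> b \<mapsto> a \<beta>(b y)\<close> to the quasibasis at \<open>1 \<otimes> x\<close> gives \<open>\<beta>(x y) = \<Sum> \<gamma>\<^sub>i(x) u\<^sub>i\<^sup>1 \<beta>(u\<^sub>i\<^sup>2 y)\<close>. The
  second factors inherit right \<open>B\<close>-linearity from \<open>\<beta>\<close>, so \<open>End\<^sub>C A\<^sub>B\<close> is a left coideal.
\<close>

lemma comult: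
  assumes "\<beta> \<in> End_bimod C B"
  shows "Poly_Mapping.keys (comult \<beta>) \<subseteq> End_bimod C C \<times> End_bimod C B"
    and "tensor_eval (comult \<beta>) x y = \<beta> (x * y)"
proof -
  have bal: "balanced C regular regular (\<lambda>m n. m * \<beta> (n * y))" for y
    using assms by (simp add: balanced_regular End_bimod_iff distrib_left distrib_right mult.assoc)
  have "(\<lambda>y. frag_eval (\<lambda>m n. m * \<beta> (n * y)) (u i)) \<in> End_bimod C B" if "i < N" for i
    unfolding End_bimod_iff
  proof (intro conjI allI ballI)
    fix x y
    show "frag_eval (\<lambda>m n. m * \<beta> (n * (x + y))) (u i)
        = frag_eval (\<lambda>m n. m * \<beta> (n * x)) (u i) + frag_eval (\<lambda>m n. m * \<beta> (n * y)) (u i)"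
      using assms by (simp add: End_bimod_iff distrib_left frag_eval_add_fun)
  next
    fix c y assume c: "c \<in> C"
    have "frag_eval (\<lambda>m n. m * \<beta> (n * (c * y))) (u i) = frag_eval (\<lambda>m n. c * m * \<beta> (n * y)) (u i)"
      unfolding central[OF bal that c] by (simp only: mult.assoc)
    then show "frag_eval (\<lambda>m n. m * \<beta> (n * (c * y))) (u i) = c * frag_eval (\<lambda>m n. m * \<beta> (n * y)) (u i)"
      by (simp only: mult.assoc frag_eval_mult_left)
  next
    fix b y assume "b \<in> B"
    then have "\<beta> (n * (y * b)) = \<beta> (n * y) * b" for n
      using assms by (metis End_bimod_iff mult.assoc)
    then show "frag_eval (\<lambda>m n. m * \<beta> (n * (y * b))) (u i) = frag_eval (\<lambda>m n. m * \<beta> (n * y)) (u i) * b"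
      by (simp only: mult.assoc[symmetric] frag_eval_mult_right)
  qed
  then have "comult \<beta> \<in> carrier (free_Abelian_group (End_bimod C C \<times> End_bimod C B))"
    unfolding comult_def by (intro sum_closed_free_Abelian_group) (simp add: gamma)
  then show "Poly_Mapping.keys (comult \<beta>) \<subseteq> End_bimod C C \<times> End_bimod C B"
    by simp
  show "tensor_eval (comult \<beta>) x y = \<beta> (x * y)"
    using expand[OF bal, of 1 x]
    by (simp add: comult_def tensor_eval_frag_eval mult.assoc frag_eval_mult_left)
qed

end

text \<open>
  Existence and uniqueness of the coproduct turn the condition \<open>\<Delta>(J) \<subseteq> S \<otimes>\<^sub>V J\<close> into an elementary
  one: \<open>\<beta>(x y)\<close> is a finite sum of terms \<open>\<sigma>(x) \<tau>(y)\<close> with \<open>\<sigma> \<in> S\<close> and \<open>\<tau> \<in> J\<close>.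
\<close>

lemma left_coideal_subring_iff:
  assumes "left_quasibasis C N \<gamma> u" "right_quasibasis C C N' \<gamma>' u'"
  shows "left_coideal_subring C J \<longleftrightarrow>
    J \<subseteq> End_bimod C C \<and> fun_submodule (centralizer C) J \<and> id \<in> J \<and> (\<forall>\<alpha>\<in>J. \<forall>\<beta>\<in>J. \<alpha> \<circ> \<beta> \<in> J) \<and>
    (\<forall>\<beta>\<in>J. \<exists>c. Poly_Mapping.keys c \<subseteq> End_bimod C C \<times> J \<and> (\<forall>x y. \<beta> (x * y) = tensor_eval c x y))"
proof -
  let ?V = "centralizer C" and ?S = "S_bimod C"
  interpret left_quasibasis C N \<gamma> u by fact
  interpret S: tensor_factors ?V ?S ?S by (rule tensor_factors_SS)
  have bal: "balanced ?V ?S ?S (\<lambda>\<alpha> \<beta>. \<alpha> x * \<beta> y)" for x y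
    by (simp add: balanced_def distrib_left distrib_right mult.assoc)
  have eq_iff: "S.cls c = S.cls d \<longleftrightarrow> tensor_eval c = tensor_eval d"
    if "Poly_Mapping.keys c \<subseteq> S.pairs" "Poly_Mapping.keys d \<subseteq> S.pairs" for c d
  proof
    assume "S.cls c = S.cls d"
    then show "tensor_eval c = tensor_eval d"
      using S.frag_eval_cls_eq[OF bal that] by (simp add: fun_eq_iff tensor_eval_frag_eval)
  next
    assume "tensor_eval c = tensor_eval d"
    moreover have "Poly_Mapping.keys (c - d) \<subseteq> End_bimod C C \<times> End_bimod C C"
      using keys_diff[of c d] that by auto
    ultimately have "c - d \<in> S.rels"
      by (intro tensor_eval_injective[OF assms(2)]) (auto simp: tensor_eval_frag_eval fun_eq_iff)
    then show "S.cls c = S.cls d"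
      using S.cls_eq_iff[OF that] by simp
  qed
  have coproduct: "coproduct C \<beta> = S.cls c"
    if c: "Poly_Mapping.keys c \<subseteq> S.pairs" "\<And>x y. \<beta> (x * y) = tensor_eval c x y" for \<beta> c
    unfolding coproduct_def
  proof (rule the_equality)
    have "tensor_eval d = tensor_eval c" if "d \<in> S.cls c" for d
    proof -
      have "d - c \<in> S.rels" using that by (simp add: S.mem_cls_iff)
      from S.frag_eval_rels[OF bal this] show ?thesis
        by (simp add: fun_eq_iff tensor_eval_frag_eval)
    qed
    then show "S.cls c \<in> carrier (tensor ?V ?S ?S) \<and> (\<forall>d\<in>S.cls c. \<forall>x y. \<beta> (x * y) = tensor_eval d x y)"
      using c by (auto simp: S.carrier_tensor)
  next
    fix t assume t: "t \<in> carrier (tensor ?V ?S ?S) \<and> (\<forall>d\<in>t. \<forall>x y. \<beta> (x * y) = tensor_eval d x y)"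
    then obtain d where d: "Poly_Mapping.keys d \<subseteq> S.pairs" "t = S.cls d"
      by (auto simp: S.carrier_tensor)
    moreover have "d \<in> S.cls d"
      by (simp add: S.mem_cls_iff S.rels_closed)
    ultimately have "tensor_eval d = tensor_eval c"
      using t c by (simp add: fun_eq_iff)
    then show "t = S.cls c"
      using d c eq_iff by simp
  qed
  have "coproduct C ` J \<subseteq> tensor_map ?V ?S ?S id id ` carrier (tensor ?V ?S (?S\<lparr>carrier := J\<rparr>)) \<longleftrightarrow>
    (\<forall>\<beta>\<in>J. \<exists>c. Poly_Mapping.keys c \<subseteq> End_bimod C C \<times> J \<and> (\<forall>x y. \<beta> (x * y) = tensor_eval c x y))"
    if J: "J \<subseteq> End_bimod C C" "fun_submodule ?V J"
  proof -
    interpret J: tensor_factors ?V ?S "?S\<lparr>carrier := J\<rparr>" by (rule tensor_factors_S[OF J(2)])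
    interpret tensor_factors_map ?V ?S "?S\<lparr>carrier := J\<rparr>" ?S ?S id id
      by unfold_locales (use J in \<open>auto simp: hom_def\<close>)
    have img: "tensor_map ?V ?S ?S id id ` carrier (tensor ?V ?S (?S\<lparr>carrier := J\<rparr>))
        = S.cls ` {c. Poly_Mapping.keys c \<subseteq> End_bimod C C \<times> J}"
      using tensor_map_cls by (auto simp: J.carrier_tensor image_image cong: image_cong)
    have "coproduct C \<beta> \<in> S.cls ` {c. Poly_Mapping.keys c \<subseteq> End_bimod C C \<times> J} \<longleftrightarrow>
       (\<exists>c. Poly_Mapping.keys c \<subseteq> End_bimod C C \<times> J \<and> (\<forall>x y. \<beta> (x * y) = tensor_eval c x y))"
      if "\<beta> \<in> J" for \<beta>
    proof -
      have \<beta>: "\<beta> \<in> End_bimod C C"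
        using that J by blast
      note cm = comult[OF \<beta>]
      have "coproduct C \<beta> = S.cls (comult \<beta>)"
        by (rule coproduct) (use cm in auto)
      moreover have "S.cls (comult \<beta>) = S.cls c \<longleftrightarrow> (\<forall>x y. \<beta> (x * y) = tensor_eval c x y)"
        if "Poly_Mapping.keys c \<subseteq> End_bimod C C \<times> J" for c
      proof -
        have "Poly_Mapping.keys c \<subseteq> S.pairs"
          using that J by auto
        then show ?thesis
          using cm by (subst eq_iff) (auto simp: fun_eq_iff)
      qed
      ultimately show ?thesis
        unfolding image_iff by (metis (no_types, lifting) mem_Collect_eq)
    qed
    then show ?thesis
      unfolding img image_subset_iff by (rule ball_cong[OF refl])
  qed
  then show ?thesis
    unfolding left_coideal_subring_def Let_def lsubmodule_S_iff by argo
qed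

section \<open>From intermediate division rings to coideal subrings\<close>

definition right_subspace :: "'a::ring_1 set \<Rightarrow> 'a set \<Rightarrow> bool" where
  "right_subspace B W \<longleftrightarrow> 0 \<in> W \<and> (\<forall>x\<in>W. \<forall>y\<in>W. x + y \<in> W) \<and> (\<forall>x\<in>W. \<forall>b\<in>B. x * b \<in> W)"

text \<open>
  Linear algebra over the division ring \<open>B\<close>: by Zorn's lemma there is a maximal subspace \<open>W\<close>
  containing \<open>W\<^sub>0\<close> but not \<open>x\<close>. Then \<open>A = W \<oplus> x B\<close>, and \<open>F\<close> is the coordinate along \<open>x\<close>.
\<close>

lemma ex_separating_functional:
  fixes B :: "'a::ring_1 set"
  assumes B: "division_subring B" and W0: "right_subspace B W0" and x: "x \<notin> W0"
  obtains F where "\<And>a a'. F (a + a') = F a + F a'" "\<And>a b. b \<in> B \<Longrightarrow> F (a * b) = F a * b"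
    "\<And>w. w \<in> W0 \<Longrightarrow> F w = 0" "F x = 1"
proof -
  have ring: "unital_subring B"
    using B by (simp add: division_subring_def)
  note Bc = unital_subring_closed[OF ring]
  define \<S> where "\<S> = {W. right_subspace B W \<and> W0 \<subseteq> W \<and> x \<notin> W}"
  have "\<exists>W\<in>\<S>. \<forall>X\<in>\<S>. W \<subseteq> X \<longrightarrow> X = W"
  proof (rule subset_Zorn_nonempty)
    show "\<S> \<noteq> {}"
      using W0 x by (auto simp: \<S>_def)
    fix \<C> assume ne: "\<C> \<noteq> {}" and ch: "subset.chain \<S> \<C>"
    then have sub: "right_subspace B W" "W0 \<subseteq> W" "x \<notin> W" if "W \<in> \<C>" for W
      using that by (auto simp: subset_chain_def \<S>_def)
    have "right_subspace B (\<Union>\<C>)"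
      unfolding right_subspace_def
    proof (intro conjI ballI)
      obtain Y where "Y \<in> \<C>" using ne by blast
      then show "0 \<in> \<Union>\<C>"
        using sub(1)[of Y] unfolding right_subspace_def by blast
      fix y assume "y \<in> \<Union>\<C>"
      then obtain Y where Y: "y \<in> Y" "Y \<in> \<C>" by blast
      show "y * b \<in> \<Union>\<C>" if "b \<in> B" for b
        using sub(1)[OF Y(2)] Y that unfolding right_subspace_def by blast
      fix z assume "z \<in> \<Union>\<C>"
      then obtain Z where Z: "z \<in> Z" "Z \<in> \<C>" by blast
      with Y ch have "Y \<subseteq> Z \<or> Z \<subseteq> Y"
        by (auto simp: subset_chain_def)
      with Y Z obtain X where "X \<in> \<C>" "y \<in> X" "z \<in> X" by blast
      then show "y + z \<in> \<Union>\<C>"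
        using sub(1)[of X] unfolding right_subspace_def by blast
    qed
    moreover have "W0 \<subseteq> \<Union>\<C>" "x \<notin> \<Union>\<C>"
      using ne sub(2,3) by blast+
    ultimately show "\<Union>\<C> \<in> \<S>"
      by (simp add: \<S>_def)
  qed
  then obtain W where WS: "W \<in> \<S>" "\<And>X. X \<in> \<S> \<Longrightarrow> W \<subseteq> X \<Longrightarrow> X = W"
    by blast
  have W: "right_subspace B W" "W0 \<subseteq> W" "x \<notin> W"
    using WS(1) by (simp_all add: \<S>_def)
  have max: "X = W" if "right_subspace B X" "x \<notin> X" "W \<subseteq> X" for X
    using WS(2)[of X] W(2) that by (simp add: \<S>_def)
  have Wadd: "y + z \<in> W" and Wsc: "b \<in> B \<Longrightarrow> y * b \<in> W" and Wdiff: "y - z \<in> W"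
    if "y \<in> W" "z \<in> W" for y z b
  proof -
    show "y + z \<in> W" and "b \<in> B \<Longrightarrow> y * b \<in> W"
      using W(1) that by (auto simp: right_subspace_def)
    have "z * (- 1) \<in> W"
      using W(1) that Bc(2,3) unfolding right_subspace_def by blast
    with W(1) that have "y + z * (- 1) \<in> W"
      unfolding right_subspace_def by blast
    then show "y - z \<in> W" by simp
  qed
  have W0in: "0 \<in> W"
    using W(1) by (simp add: right_subspace_def)
  have ex: "\<exists>b\<in>B. a - x * b \<in> W" for a
  proof (cases "a \<in> W")
    case True
    then show ?thesis using Bc(1) by (intro bexI[of _ 0]) auto
  next
    case False
    let ?X = "{w + a * b | w b. w \<in> W \<and> b \<in> B}"
    have "right_subspace B ?X"
      unfolding right_subspace_def
    proof (intro conjI ballI)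
      show "0 \<in> ?X" using W0in Bc(1) by force
      fix y assume "y \<in> ?X"
      then obtain w b where y: "y = w + a * b" "w \<in> W" "b \<in> B" by blast
      {
        fix z assume "z \<in> ?X"
        then obtain w' b' where z: "z = w' + a * b'" "w' \<in> W" "b' \<in> B" by blast
        have "y + z = (w + w') + a * (b + b')"
          by (simp add: y z distrib_left)
        then show "y + z \<in> ?X" using Wadd Bc(4) y z by blast
      }
      fix c assume "c \<in> B"
      moreover have "y * c = w * c + a * (b * c)"
        by (simp add: y distrib_right mult.assoc)
      ultimately show "y * c \<in> ?X" using Wsc Bc(6) y by blast
    qed
    moreover have "W \<subseteq> ?X"
    proof
      fix w assume "w \<in> W"
      moreover have "w = w + a * 0" by simp
      ultimately show "w \<in> ?X" using Bc(1) by blast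
    qed
    moreover have "a \<in> ?X"
    proof -
      have "a = 0 + a * 1" by simp
      then show ?thesis using W0in Bc(2) by blast
    qed
    ultimately have "x \<in> ?X"
      using max[of ?X] False by blast
    then obtain w b where xw: "x = w + a * b" "w \<in> W" "b \<in> B" by blast
    then have "b \<noteq> 0" using W(3) by auto
    then obtain b' where b': "b' \<in> B" "b * b' = 1"
      using B xw(3) unfolding division_subring_def by blast
    have "a - x * b' = 0 - w * b'"
      by (simp add: xw(1) distrib_right mult.assoc b')
    then show ?thesis
      using Wdiff[OF W0in Wsc[OF xw(2) xw(2) b'(1)]] b'(1) by force
  qed
  have uniq: "b = b'" if "b \<in> B" "b' \<in> B" "a - x * b \<in> W" "a - x * b' \<in> W" for a b b'
  proof (rule ccontr)
    assume "b \<noteq> b'"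
    moreover have "b' - b \<in> B"
      using that Bc(5) by blast
    ultimately obtain c where c: "c \<in> B" "(b' - b) * c = 1"
      using B unfolding division_subring_def by fastforce
    have "(a - x * b) - (a - x * b') \<in> W"
      by (rule Wdiff[OF that(3,4)])
    then have "x * (b' - b) * c \<in> W"
      using Wsc[OF _ W0in c(1), of "x * (b' - b)"] by (simp add: right_diff_distrib)
    then show False
      using W(3) by (simp add: mult.assoc c)
  qed
  define F where "F a = (THE b. b \<in> B \<and> a - x * b \<in> W)" for a
  have F: "F a = b" if "b \<in> B" "a - x * b \<in> W" for a b
    unfolding F_def by (rule the_equality) (use that uniq in blast)+
  have F': "F a \<in> B \<and> a - x * F a \<in> W" for a
    using ex[of a] F by auto
  show thesis
  proof
    show "F (a + a') = F a + F a'" for a a'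
      using Wadd[of "a - x * F a" "a' - x * F a'"] F'[of a] F'[of a'] Bc(4)
      by (intro F) (auto simp: algebra_simps)
    show "F (a * b) = F a * b" if "b \<in> B" for a b
      using Wsc[OF _ W0in that, of "a - x * F a"] F'[of a] Bc(6) that
      by (intro F) (auto simp: left_diff_distrib mult.assoc)
    show "F w = 0" if "w \<in> W0" for w
      using that W(2) Bc(1) by (intro F) auto
    show "F x = 1"
      using W0in Bc(2) by (intro F) auto
  qed
qed

lemma lsubmodule_regular_iff:
  "lsubmodule UNIV (regular :: ('a::ring_1, 'a) bimod) I \<longleftrightarrow>
     0 \<in> I \<and> (\<forall>x\<in>I. \<forall>y\<in>I. x + y \<in> I) \<and> (\<forall>a. \<forall>x\<in>I. a * x \<in> I)"
proof -
  have "comm_group (regular :: ('a, 'a) bimod)"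
  proof (rule comm_groupI)
    show "\<exists>y\<in>carrier regular. y \<otimes>\<^bsub>regular\<^esub> x = \<one>\<^bsub>regular\<^esub>" for x :: 'a
      by (intro bexI[of _ "- x"]) auto
  qed (auto simp: add_ac)
  then have "group (regular :: ('a, 'a) bimod)"
    by (rule comm_group.axioms(2))
  then have inv: "inv\<^bsub>regular\<^esub> x = - x" for x :: 'a
    by (rule group.inv_equality) auto
  have "- x \<in> I" if "\<forall>a. \<forall>x\<in>I. a * x \<in> I" "x \<in> I" for x
    using that(1)[rule_format, of x "- 1"] that(2) by simp
  then show ?thesis
    by (auto simp: lsubmodule_def subgroup_def inv)
qed

text \<open>
  A functional with \<open>F(x) = 1\<close> has the form \<open>\<Sum> a\<^sub>i \<gamma>\<^sub>i\<close>, so a stable left ideal containing \<open>x \<noteq> 0\<close>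
  contains \<open>1\<close>.
\<close>

lemma (in right_quasibasis) stable_left_ideal_trivial:
  assumes B: "division_subring B"
    and I: "0 \<in> I" "\<And>x y. x \<in> I \<Longrightarrow> y \<in> I \<Longrightarrow> x + y \<in> I" "\<And>a x. x \<in> I \<Longrightarrow> a * x \<in> I"
    and stable: "\<And>\<alpha> x. \<alpha> \<in> End_bimod C B \<Longrightarrow> x \<in> I \<Longrightarrow> \<alpha> x \<in> I"
  shows "I = {0} \<or> I = UNIV"
proof (rule disjCI)
  assume "I \<noteq> UNIV"
  have False if x: "x \<in> I" "x \<noteq> 0" for x
  proof -
    have "right_subspace B {0}" "x \<notin> {0}"
      using x by (simp_all add: right_subspace_def)
    then obtain F where F: "\<And>a a'. F (a + a') = F a + F a'" "\<And>a b. b \<in> B \<Longrightarrow> F (a * b) = F a * b"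
      "\<And>w. w \<in> {0} \<Longrightarrow> F w = 0" "F x = 1"
      by (rule ex_separating_functional[OF B]) (rule that; assumption)
    have "(\<Sum>i\<in>K. coeff F i * \<gamma> i x) \<in> I" if "K \<subseteq> {..<N}" "finite K" for K
      using that(2,1) by (induction K rule: finite_induct) (auto intro!: I stable[OF gamma] x)
    from this[of "{..<N}"] have "F x \<in> I"
      using expand_right_linear[OF F(1,2), of x] by simp
    then have "a \<in> I" for a
      using I(3)[of 1 a] F(4) by simp
    with \<open>I \<noteq> UNIV\<close> show False by blast
  qed
  with I(1) show "I = {0}" by blast
qed

text \<open>
  If \<open>x\<close> is fixed then \<open>F(x) = F(1) x\<close> for all right \<open>B\<close>-linear \<open>F = \<Sum> a\<^sub>i \<gamma>\<^sub>i\<close>. For \<open>x\<close> outside \<open>B\<close> there is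
  such an \<open>F\<close> with \<open>F(1) = 0\<close> and \<open>F(x) = 1\<close>, which is absurd.
\<close>

lemma (in right_quasibasis) fixed_points_End:
  assumes B: "division_subring B"
  shows "fixed_points (End_bimod C B) = B"
proof
  have ring: "unital_subring B"
    using B by (simp add: division_subring_def)
  show "B \<subseteq> fixed_points (End_bimod C B)"
  proof
    fix b assume "b \<in> B"
    then have "\<alpha> (1 * b) = \<alpha> 1 * b" if "\<alpha> \<in> End_bimod C B" for \<alpha>
      using that unfolding End_bimod_iff by blast
    then show "b \<in> fixed_points (End_bimod C B)"
      by (simp add: fixed_points_def)
  qed
  show "fixed_points (End_bimod C B) \<subseteq> B"
  proof (rule subsetI, rule ccontr)
    fix x assume x: "x \<in> fixed_points (End_bimod C B)" and "x \<notin> B"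
    have "right_subspace B B"
      using unital_subring_closed[OF ring] by (simp add: right_subspace_def)
    then obtain F where F: "\<And>a a'. F (a + a') = F a + F a'" "\<And>a b. b \<in> B \<Longrightarrow> F (a * b) = F a * b"
      "\<And>w. w \<in> B \<Longrightarrow> F w = 0" "F x = 1"
      using \<open>x \<notin> B\<close> by (rule ex_separating_functional[OF B]) (rule that; assumption)
    have "\<gamma> i x = \<gamma> i 1 * x" if "i < N" for i
      using x gamma[OF that] by (simp add: fixed_points_def)
    then have "F x = (\<Sum>i<N. coeff F i * \<gamma> i 1) * x"
      using expand_right_linear[OF F(1,2), of x] by (simp add: sum_distrib_right mult.assoc)
    also have "\<dots> = F 1 * x"
      using expand_right_linear[OF F(1,2), of 1] by simp
    finally show False
      using F unital_subring_closed(2)[OF ring] by simp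
  qed
qed

lemma (in right_quasibasis) dual_basis_End:
  "dual_basis (centralizer C) (End_bimod C B) N \<gamma> (\<lambda>i F. coeff F i)"
  unfolding dual_basis_def
proof (intro conjI allI impI ballI)
  show "\<alpha> a = (\<Sum>i<N. coeff \<alpha> i * \<gamma> i a)" if "\<alpha> \<in> End_bimod C B" for \<alpha> a
    using that by (intro expand_right_linear) (auto simp: End_bimod_iff)
qed (auto simp: gamma coeff_centralizer coeff_linear)

lemma left_coideal_subring_End:
  assumes "left_quasibasis C N \<gamma> u" "right_quasibasis C C N' \<gamma>' u'" "C \<subseteq> B"
  shows "left_coideal_subring C (End_bimod C B)"
  unfolding left_coideal_subring_iff[OF assms(1,2)]
proof (intro conjI ballI)
  interpret left_quasibasis C N \<gamma> u by fact
  fix \<beta> assume \<beta>: "\<beta> \<in> End_bimod C B"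
  show "\<exists>c. Poly_Mapping.keys c \<subseteq> End_bimod C C \<times> End_bimod C B \<and>
      (\<forall>x y. \<beta> (x * y) = tensor_eval c x y)"
    using comult[OF \<beta>] by metis
next
  show "fun_submodule (centralizer C) (End_bimod C B)" by (rule fun_submodule_End)
next
  show "End_bimod C B \<subseteq> End_bimod C C"
    using assms(3) unfolding End_bimod_iff subset_iff by blast
qed (auto simp: End_bimod_iff)

lemma galois_left_coideal_subring_End:
  assumes "left_quasibasis C N \<gamma> u" "right_quasibasis C C N' \<gamma>' u'"
    and "right_quasibasis C B n e v" "division_subring B" "C \<subseteq> B"
  shows "galois_left_coideal_subring C (End_bimod C B)"
proof -
  interpret right_quasibasis C B n e v by fact
  show ?thesis
    unfolding galois_left_coideal_subring_def
  proof (intro conjI allI impI)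
    fix I assume "lsubmodule UNIV regular I \<and> (\<forall>\<alpha>\<in>End_bimod C B. \<alpha> ` I \<subseteq> I)"
    then show "I = {0} \<or> I = UNIV"
      unfolding lsubmodule_regular_iff by (intro stable_left_ideal_trivial[OF assms(4)]) blast+
  qed (rule left_coideal_subring_End[OF assms(1,2,5)]
      fin_generated_projective_if_dual_basis[OF fun_submodule_End dual_basis_End])+
qed

section \<open>From Galois coideal subrings to intermediate division rings\<close>

text \<open>
  Gaussian elimination over a division ring: more than \<open>n\<close> rows of length \<open>n\<close> are left linearly
  dependent. The rows form an arbitrary finite family so that the pivot row can be removed.
\<close>

lemma ex_left_kernel_vector:
  fixes M :: "'i \<Rightarrow> nat \<Rightarrow> 'd::division_ring"
  assumes "finite I" "card I > n"
  shows "\<exists>d. (\<exists>i\<in>I. d i \<noteq> 0) \<and> (\<forall>l<n. (\<Sum>i\<in>I. d i * M i l) = 0)"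
  using assms
proof (induction n arbitrary: I M)
  case 0
  then obtain i where "i \<in> I"
    by (metis card_gt_0_iff ex_in_conv)
  then show ?case
    by (intro exI[of _ "\<lambda>_. 1"]) auto
next
  case (Suc n)
  show ?case
  proof (cases "\<forall>i\<in>I. M i n = 0")
    case True
    obtain d where "\<exists>i\<in>I. d i \<noteq> 0" "\<forall>l<n. (\<Sum>i\<in>I. d i * M i l) = 0"
      using Suc.IH[OF Suc.prems(1) Suc_lessD[OF Suc.prems(2)], of M] by blast
    moreover have "(\<Sum>i\<in>I. d i * M i n) = 0"
      using True by (intro sum.neutral) simp
    ultimately show ?thesis
      by (intro exI[of _ d] conjI) (simp_all add: less_Suc_eq_le le_less)
  next
    case False
    then obtain p where p: "p \<in> I" "M p n \<noteq> 0" by blast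
    define r where "r i = M i n * inverse (M p n)" for i
    have "card (I - {p}) > n" "finite (I - {p})"
      using Suc.prems p by simp_all
    then obtain d where d: "\<exists>i\<in>I - {p}. d i \<noteq> 0"
      "\<And>l. l < n \<Longrightarrow> (\<Sum>i\<in>I - {p}. d i * (M i l - r i * M p l)) = 0"
      using Suc.IH[of "I - {p}" "\<lambda>i l. M i l - r i * M p l"] by blast
    define d' where "d' i = (if i = p then - (\<Sum>i\<in>I - {p}. d i * r i) else d i)" for i
    have eq: "(\<Sum>i\<in>I. d' i * M i l) = (\<Sum>i\<in>I - {p}. d i * (M i l - r i * M p l))" for l
    proof -
      have "(\<Sum>i\<in>I. d' i * M i l) = d' p * M p l + (\<Sum>i\<in>I - {p}. d' i * M i l)"
        using Suc.prems p by (simp add: sum.remove)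
      also have "(\<Sum>i\<in>I - {p}. d' i * M i l) = (\<Sum>i\<in>I - {p}. d i * M i l)"
        by (intro sum.cong) (auto simp: d'_def)
      finally show ?thesis
        by (simp add: d'_def right_diff_distrib sum_subtractf sum_distrib_right mult.assoc)
    qed
    have r: "M i n - r i * M p n = 0" for i
      using p(2) by (simp add: r_def mult.assoc)
    have "(\<Sum>i\<in>I. d' i * M i l) = 0" if l: "l < Suc n" for l
    proof (cases "l = n")
      case True
      show ?thesis
        unfolding eq True r by simp
    next
      case False
      with l have "l < n" by simp
      from d(2)[OF this] show ?thesis
        unfolding eq .
    qed
    moreover obtain i where "i \<in> I - {p}" "d i \<noteq> 0"
      using d(1) by blast
    then have "\<exists>i\<in>I. d' i \<noteq> 0"
      by (intro bexI[of _ i]) (simp_all add: d'_def)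
    ultimately show ?thesis by blast
  qed
qed

lemma fixed_pointsD: "x \<in> fixed_points J \<Longrightarrow> \<alpha> \<in> J \<Longrightarrow> \<alpha> x = \<alpha> 1 * x"
  by (auto simp: fixed_points_def)

lemma fixed_pointsI: "(\<And>\<alpha>. \<alpha> \<in> J \<Longrightarrow> \<alpha> x = \<alpha> 1 * x) \<Longrightarrow> x \<in> fixed_points J"
  unfolding fixed_points_def by blast

locale coideal_subring =
  fixes C :: "'a::ring_1 set" and J :: "('a \<Rightarrow> 'a) set"
  assumes J_subset_S: "J \<subseteq> End_bimod C C" and J_mod: "fun_submodule (centralizer C) J"
    and J_id: "id \<in> J" and J_comp: "\<And>\<alpha> \<beta>. \<alpha> \<in> J \<Longrightarrow> \<beta> \<in> J \<Longrightarrow> \<alpha> \<circ> \<beta> \<in> J"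
    and J_coideal: "\<And>\<beta>. \<beta> \<in> J \<Longrightarrow> \<exists>c. Poly_Mapping.keys c \<subseteq> End_bimod C C \<times> J \<and>
      (\<forall>x y. \<beta> (x * y) = tensor_eval c x y)"
begin

abbreviation "B \<equiv> fixed_points J"

text \<open>
  The map \<open>A \<otimes> J \<rightarrow> End A\<close>, \<open>a \<otimes> \<alpha> \<mapsto> a \<alpha>\<close>, on formal sums; its range is the left \<open>A\<close>-module \<open>A J\<close> spanned by \<open>J\<close>.
\<close>

definition span_map :: "('a \<times> ('a \<Rightarrow> 'a) \<Rightarrow>\<^sub>0 int) \<Rightarrow> 'a \<Rightarrow> 'a" where
  "span_map c x = frag_eval (\<lambda>a \<alpha>. a * \<alpha> x) c"

definition A_span :: "('a \<Rightarrow> 'a) set" where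
  "A_span = span_map ` {c. Poly_Mapping.keys c \<subseteq> UNIV \<times> J}"

lemma J_linear:
  assumes "\<alpha> \<in> J"
  shows "\<alpha> (x + y) = \<alpha> x + \<alpha> y" "c \<in> C \<Longrightarrow> \<alpha> (c * x) = c * \<alpha> x"
    "c \<in> C \<Longrightarrow> \<alpha> (x * c) = \<alpha> x * c"
proof -
  have "\<alpha> \<in> End_bimod C C" using assms J_subset_S by blast
  then show "\<alpha> (x + y) = \<alpha> x + \<alpha> y" "c \<in> C \<Longrightarrow> \<alpha> (c * x) = c * \<alpha> x"
    "c \<in> C \<Longrightarrow> \<alpha> (x * c) = \<alpha> x * c"
    by (simp_all add: End_bimod_iff)
qed

lemma J_zero: "\<alpha> \<in> J \<Longrightarrow> \<alpha> 0 = 0"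
  by (rule additive_rules(1)) (rule J_linear(1))

lemma J_diff: "\<alpha> \<in> J \<Longrightarrow> \<alpha> (x - y) = \<alpha> x - \<alpha> y"
  by (rule additive_rules(3)) (rule J_linear(1))

text \<open>
  For \<open>b\<close> fixed by \<open>J\<close>, the coideal condition gives
  \<open>\<alpha>(x b) = \<Sum> \<sigma>(x) \<tau>(b) = \<Sum> \<sigma>(x) \<tau>(1) b = \<alpha>(x) b\<close>.
\<close>

lemma J_right_linear:
  assumes "\<alpha> \<in> J" "b \<in> B"
  shows "\<alpha> (x * b) = \<alpha> x * b"
proof -
  obtain c where c: "Poly_Mapping.keys c \<subseteq> End_bimod C C \<times> J" "\<And>x y. \<alpha> (x * y) = tensor_eval c x y"
    using J_coideal[OF assms(1)] by blast
  have "\<alpha> (x * b) = frag_eval (\<lambda>\<sigma> \<tau>. \<sigma> x * \<tau> b) c"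
    by (simp add: c tensor_eval_frag_eval)
  also have "\<dots> = frag_eval (\<lambda>\<sigma> \<tau>. \<sigma> x * \<tau> 1 * b) c"
  proof (rule frag_eval_cong)
    fix \<sigma> \<tau> assume "(\<sigma>, \<tau>) \<in> Poly_Mapping.keys c"
    then have "\<tau> \<in> J" using c by blast
    from fixed_pointsD[OF assms(2) this] show "\<sigma> x * \<tau> b = \<sigma> x * \<tau> 1 * b"
      by (simp add: mult.assoc)
  qed
  also have "\<dots> = \<alpha> (x * 1) * b"
    unfolding c(2) by (simp add: tensor_eval_frag_eval frag_eval_mult_right)
  finally show ?thesis by simp
qed

lemma J_subset_End_fixed: "J \<subseteq> End_bimod C B"
proof
  fix \<alpha> assume "\<alpha> \<in> J"
  then show "\<alpha> \<in> End_bimod C B"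
    using J_linear(1,2)[of \<alpha>] J_right_linear[of \<alpha>] unfolding End_bimod_iff by simp
qed

lemma C_subset_fixed: "C \<subseteq> B"
proof
  fix c assume c: "c \<in> C"
  show "c \<in> B"
    by (rule fixed_pointsI) (use J_linear(3)[OF _ c, of _ 1] in simp)
qed

lemma unital_subring_fixed: "unital_subring B"
  unfolding unital_subring_def
proof (intro conjI ballI)
  show "1 \<in> B" by (rule fixed_pointsI) simp
  fix x y assume xy: "x \<in> B" "y \<in> B"
  show "x - y \<in> B"
  proof (rule fixed_pointsI)
    fix \<alpha> assume \<alpha>: "\<alpha> \<in> J"
    show "\<alpha> (x - y) = \<alpha> 1 * (x - y)"
      unfolding J_diff[OF \<alpha>] right_diff_distrib
      using fixed_pointsD[OF xy(1) \<alpha>] fixed_pointsD[OF xy(2) \<alpha>] by (rule arg_cong2)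
  qed
  show "x * y \<in> B"
  proof (rule fixed_pointsI)
    fix \<alpha> assume \<alpha>: "\<alpha> \<in> J"
    show "\<alpha> (x * y) = \<alpha> 1 * (x * y)"
      unfolding J_right_linear[OF \<alpha> xy(2)] fixed_pointsD[OF xy(1) \<alpha>] by (rule mult.assoc)
  qed
qed

lemma span_map_simps:
  "span_map (c + d) x = span_map c x + span_map d x" "span_map (c - d) x = span_map c x - span_map d x"
  "span_map (frag_of (a, \<alpha>)) x = a * \<alpha> x" "span_map 0 x = 0"
  by (simp_all add: span_map_def)

lemma A_span_additive:
  assumes "F \<in> A_span"
  shows "F (x + y) = F x + F y"
proof -
  obtain c where c: "F = span_map c" "Poly_Mapping.keys c \<subseteq> UNIV \<times> J"
    using assms by (auto simp: A_span_def)
  have "frag_eval (\<lambda>a \<alpha>. a * \<alpha> (x + y)) c = frag_eval (\<lambda>a \<alpha>. a * \<alpha> x + a * \<alpha> y) c"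
  proof (rule frag_eval_cong)
    fix a \<alpha> assume "(a, \<alpha>) \<in> Poly_Mapping.keys c"
    then have "\<alpha> \<in> J" using c by blast
    from J_linear(1)[OF this] show "a * \<alpha> (x + y) = a * \<alpha> x + a * \<alpha> y"
      by (simp add: distrib_left)
  qed
  then show ?thesis
    by (simp add: c span_map_def frag_eval_add_fun)
qed

lemma A_span_right_linear:
  assumes "F \<in> A_span" "b \<in> B"
  shows "F (x * b) = F x * b"
proof -
  obtain c where c: "F = span_map c" "Poly_Mapping.keys c \<subseteq> UNIV \<times> J"
    using assms by (auto simp: A_span_def)
  have "frag_eval (\<lambda>a \<alpha>. a * \<alpha> (x * b)) c = frag_eval (\<lambda>a \<alpha>. a * \<alpha> x * b) c"
  proof (rule frag_eval_cong)
    fix a \<alpha> assume "(a, \<alpha>) \<in> Poly_Mapping.keys c"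
    then have "\<alpha> \<in> J" using c by blast
    from J_right_linear[OF this assms(2)] show "a * \<alpha> (x * b) = a * \<alpha> x * b"
      by (simp add: mult.assoc)
  qed
  then show ?thesis
    by (simp add: c span_map_def frag_eval_mult_right)
qed

lemma A_span_diff: "F \<in> A_span \<Longrightarrow> G \<in> A_span \<Longrightarrow> (\<lambda>x. F x - G x) \<in> A_span"
proof -
  assume "F \<in> A_span" "G \<in> A_span"
  then obtain c d where "F = span_map c" "G = span_map d" "Poly_Mapping.keys c \<subseteq> UNIV \<times> J"
    "Poly_Mapping.keys d \<subseteq> UNIV \<times> J"
    by (auto simp: A_span_def)
  moreover from this have "Poly_Mapping.keys (c - d) \<subseteq> UNIV \<times> J"
    using keys_diff[of c d] by blast
  ultimately show ?thesis
    unfolding A_span_def by (intro image_eqI[of _ _ "c - d"]) (auto simp: span_map_simps)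
qed

lemma A_span_zero: "(\<lambda>_. 0) \<in> A_span"
  unfolding A_span_def by (intro image_eqI[of _ _ 0]) (auto simp: span_map_simps)

lemma A_span_add: "F \<in> A_span \<Longrightarrow> G \<in> A_span \<Longrightarrow> (\<lambda>x. F x + G x) \<in> A_span"
  using A_span_diff[of F "\<lambda>x. 0 - G x"] A_span_diff[OF A_span_zero] by simp

lemma A_span_scale: "F \<in> A_span \<Longrightarrow> (\<lambda>x. a * F x) \<in> A_span"
proof -
  assume "F \<in> A_span"
  then obtain c where c: "F = span_map c" "Poly_Mapping.keys c \<subseteq> UNIV \<times> J"
    by (auto simp: A_span_def)
  then have "Poly_Mapping.keys (frag_map ((*) a) id c) \<subseteq> UNIV \<times> J"
    by (intro keys_frag_map) auto
  moreover have "(\<lambda>x. a * F x) = span_map (frag_map ((*) a) id c)"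
    by (simp add: fun_eq_iff c span_map_def frag_eval_frag_map mult.assoc frag_eval_mult_left)
  ultimately show ?thesis
    unfolding A_span_def by blast
qed

lemma A_span_base: "\<alpha> \<in> J \<Longrightarrow> \<alpha> \<in> A_span"
  unfolding A_span_def by (intro image_eqI[of _ _ "frag_of (1, \<alpha>)"]) (auto simp: span_map_simps)

lemma A_span_sum: "(\<And>i. i \<in> I \<Longrightarrow> F i \<in> A_span) \<Longrightarrow> (\<lambda>x. \<Sum>i\<in>I. a i * F i x) \<in> A_span"
  by (induction I rule: infinite_finite_induct)
    (auto simp: A_span_zero intro!: A_span_add[of "\<lambda>x. _ * _ x"] A_span_scale)

text \<open>
  The coideal condition lets \<open>\<alpha> \<in> J\<close> pass a left multiplication: \<open>\<alpha>(a \<beta>(x)) = \<Sum> \<sigma>(a) \<tau>(\<beta>(x))\<close> is again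
  in \<open>A J\<close>. So \<open>A J\<close> is a subring of \<open>End A\<close>.
\<close>

lemma A_span_comp:
  assumes "\<alpha> \<in> J" "F \<in> A_span"
  shows "(\<lambda>x. \<alpha> (F x)) \<in> A_span"
proof -
  have "(\<lambda>x. \<alpha> (span_map c x)) \<in> A_span" if "Poly_Mapping.keys c \<subseteq> UNIV \<times> J" for c
    using that
  proof (induction c rule: frag_keys_induct)
    case zero
    then show ?case
      using J_zero[OF assms(1)] by (simp add: span_map_simps A_span_zero)
  next
    case (diff c d)
    then show ?case
      using J_diff[OF assms(1)] A_span_diff by (simp add: span_map_simps)
  next
    case (pair p)
    then obtain a \<beta> where p: "p = (a, \<beta>)" "\<beta> \<in> J" by auto
    obtain d where d: "Poly_Mapping.keys d \<subseteq> End_bimod C C \<times> J" "\<And>x y. \<alpha> (x * y) = tensor_eval d x y"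
      using J_coideal[OF assms(1)] by blast
    have "Poly_Mapping.keys (frag_map (\<lambda>\<sigma>. \<sigma> a) (\<lambda>\<tau>. \<tau> \<circ> \<beta>) d) \<subseteq> UNIV \<times> J"
      using d(1) p J_comp by (intro keys_frag_map) auto
    moreover have "(\<lambda>x. \<alpha> (span_map (frag_of p) x)) = span_map (frag_map (\<lambda>\<sigma>. \<sigma> a) (\<lambda>\<tau>. \<tau> \<circ> \<beta>) d)"
      by (simp add: fun_eq_iff p span_map_simps d) (simp add: span_map_def tensor_eval_frag_eval frag_eval_frag_map)
    ultimately show ?case
      unfolding A_span_def by blast
  qed
  then show ?thesis
    using assms(2) by (auto simp: A_span_def)
qed

end

locale galois_subring = coideal_subring +
  assumes stable_trivial: "\<And>I. 0 \<in> I \<Longrightarrow> (\<And>x y. x \<in> I \<Longrightarrow> y \<in> I \<Longrightarrow> x + y \<in> I) \<Longrightarrow>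
    (\<And>a x. x \<in> I \<Longrightarrow> a * x \<in> I) \<Longrightarrow> (\<And>\<alpha> x. \<alpha> \<in> J \<Longrightarrow> x \<in> I \<Longrightarrow> \<alpha> x \<in> I) \<Longrightarrow> I = {0} \<or> I = UNIV"
begin

text \<open>
  Schur's lemma: right multiplication by \<open>x \<in> A\<^sup>J\<close> commutes with \<open>A\<close> and \<open>J\<close>, hence its image \<open>A x\<close> and its
  kernel are stable left ideals. For \<open>x \<noteq> 0\<close> it is bijective, and \<open>1 = y x\<close> yields the inverse.
\<close>

lemma division_subring_fixed: "division_subring B"
  unfolding division_subring_def
proof (intro conjI ballI impI)
  show "unital_subring B" by (rule unital_subring_fixed)
  fix x assume x: "x \<in> B" "x \<noteq> 0"
  have "range (\<lambda>a. a * x) = {0} \<or> range (\<lambda>a. a * x) = UNIV"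
  proof (rule stable_trivial)
    show "0 \<in> range (\<lambda>a. a * x)" by (rule image_eqI[of _ _ 0]) auto
    show "u + v \<in> range (\<lambda>a. a * x)" if "u \<in> range (\<lambda>a. a * x)" "v \<in> range (\<lambda>a. a * x)" for u v
      using that by (auto simp flip: distrib_right)
    show "a * u \<in> range (\<lambda>a. a * x)" if "u \<in> range (\<lambda>a. a * x)" for a u
      using that by (auto simp flip: mult.assoc)
    show "\<alpha> u \<in> range (\<lambda>a. a * x)" if "\<alpha> \<in> J" "u \<in> range (\<lambda>a. a * x)" for \<alpha> u
      using that J_right_linear[OF that(1) x(1)] by auto
  qed
  moreover have "x \<in> range (\<lambda>a. a * x)" by (rule image_eqI[of _ _ 1]) auto
  ultimately have "1 \<in> range (\<lambda>a. a * x)" using x by auto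
  then obtain y where y: "y * x = 1" by (metis rangeE)
  have "{a. a * x = 0} = {0} \<or> {a. a * x = 0} = UNIV"
  proof (rule stable_trivial)
    show "\<alpha> u \<in> {a. a * x = 0}" if "\<alpha> \<in> J" "u \<in> {a. a * x = 0}" for \<alpha> u
      using that J_right_linear[OF that(1) x(1), of u] J_zero[OF that(1)] by simp
  qed (auto simp: distrib_right mult.assoc)
  moreover have "1 \<notin> {a. a * x = 0}" using x by simp
  ultimately have inj: "a = 0" if "a * x = 0" for a
    using that by blast
  have "(x * y - 1) * x = 0"
    using y by (simp add: left_diff_distrib mult.assoc)
  then have xy: "x * y = 1" using inj by force
  have "\<alpha> y = \<alpha> 1 * y" if "\<alpha> \<in> J" for \<alpha>
  proof -
    have "\<alpha> y * x = \<alpha> 1"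
      using J_right_linear[OF that x(1), of y] y by simp
    then have "\<alpha> y * (x * y) = \<alpha> 1 * y"
      by (simp only: mult.assoc[symmetric])
    then show ?thesis by (simp add: xy)
  qed
  then have "y \<in> B" by (rule fixed_pointsI)
  with xy y show "\<exists>y\<in>B. x * y = 1 \<and> y * x = 1" by blast
qed

text \<open>
  Elements \<open>x\<^sub>j\<close> of \<open>A\<close> together with functionals \<open>F\<^sub>i \<in> A J\<close> satisfying \<open>F\<^sub>i(x\<^sub>j) = \<delta>\<^sub>i\<^sub>j\<close>. A dual system of
  maximal length turns out to be a basis of \<open>A\<close> over \<open>A\<^sup>J\<close> with its dual basis.
\<close>

definition dual_system :: "nat \<Rightarrow> (nat \<Rightarrow> 'a) \<Rightarrow> (nat \<Rightarrow> 'a \<Rightarrow> 'a) \<Rightarrow> bool" where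
  "dual_system k x F \<longleftrightarrow>
     (\<forall>i<k. F i \<in> A_span \<and> (\<forall>j<k. F i (x j) = (if i = j then 1 else 0)))"

lemma dual_systemD:
  assumes "dual_system k x F" "i < k"
  shows "F i \<in> A_span" "j < k \<Longrightarrow> F i (x j) = (if i = j then 1 else 0)"
  using assms by (simp_all add: dual_system_def)

text \<open>
  Jacobson density. If every \<open>G \<in> A J\<close> that kills all \<open>x\<^sub>j\<close> kills \<open>y\<close>, apply this to \<open>G - \<Sum> G(x\<^sub>j) F\<^sub>j\<close> and
  obtain \<open>G(y) = \<Sum> G(x\<^sub>j) F\<^sub>j(y)\<close> for all \<open>G \<in> A J\<close>. The choice \<open>G = id\<close> expands \<open>y\<close> in the \<open>x\<^sub>j\<close>, and
  \<open>G = \<alpha> \<circ> F\<^sub>j\<close> shows that the coefficients \<open>F\<^sub>j(y)\<close> are fixed by \<open>J\<close>.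
\<close>

lemma dual_system_expand_or_separate:
  assumes ds: "dual_system k x F"
    and "\<And>G. G \<in> A_span \<Longrightarrow> (\<And>j. j < k \<Longrightarrow> G (x j) = 0) \<Longrightarrow> G y = 0"
  shows "y = (\<Sum>j<k. x j * F j y)" "\<And>j. j < k \<Longrightarrow> F j y \<in> B"
proof -
  note F = dual_systemD[OF ds]
  have G: "G y = (\<Sum>j<k. G (x j) * F j y)" if "G \<in> A_span" for G
  proof -
    let ?G = "\<lambda>z. G z - (\<Sum>j<k. G (x j) * F j z)"
    have "?G y = 0"
    proof (rule assms(2)[of ?G])
      show "?G \<in> A_span"
        by (rule A_span_diff[OF that A_span_sum[of "{..<k}" F "\<lambda>j. G (x j)"]]) (simp add: F(1))
      fix i assume i: "i < k"
      have "(\<Sum>j<k. G (x j) * F j (x i)) = (\<Sum>j<k. if j = i then G (x j) else 0)"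
        by (intro sum.cong refl) (simp add: F(2) i)
      then show "?G (x i) = 0"
        using i by simp
    qed
    then show ?thesis by simp
  qed
  show "y = (\<Sum>j<k. x j * F j y)"
    using G[of id] A_span_base[OF J_id] by simp
  fix j assume j: "j < k"
  have "\<alpha> (F j y) = \<alpha> 1 * F j y" if \<alpha>: "\<alpha> \<in> J" for \<alpha>
  proof -
    have "(\<Sum>i<k. \<alpha> (F j (x i)) * F i y) = (\<Sum>i<k. if j = i then \<alpha> 1 * F i y else 0)"
    proof (intro sum.cong refl)
      fix i assume "i \<in> {..<k}"
      then have "F j (x i) = (if j = i then 1 else 0)"
        by (intro F(2)[OF j]) simp
      then show "\<alpha> (F j (x i)) * F i y = (if j = i then \<alpha> 1 * F i y else 0)"
        by (simp add: J_zero[OF \<alpha>])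
    qed
    then have "(\<Sum>i<k. \<alpha> (F j (x i)) * F i y) = \<alpha> 1 * F j y"
      using j by simp
    then show ?thesis
      using G[of "\<lambda>z. \<alpha> (F j z)", OF A_span_comp[OF \<alpha> F(1)[OF j]]] by (rule trans[rotated])
  qed
  then show "F j y \<in> B" by (rule fixed_pointsI)
qed

text \<open>
  The values at \<open>y\<close> of the elements of \<open>A J\<close> killing all \<open>x\<^sub>j\<close> form a stable left ideal. It is nonzero,
  so some \<open>H\<close> has \<open>H(y) = 1\<close>, and the old functionals are corrected by multiples of \<open>H\<close>.
\<close>

lemma dual_system_extend:
  assumes ds: "dual_system k x F" and G: "G \<in> A_span" "\<And>j. j < k \<Longrightarrow> G (x j) = 0" "G y \<noteq> 0"
  shows "\<exists>x' F'. dual_system (Suc k) x' F'"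
proof -
  note F = dual_systemD[OF ds]
  define K where "K = {H \<in> A_span. \<forall>j<k. H (x j) = 0}"
  define I where "I = (\<lambda>H. H y) ` K"
  have "I = {0} \<or> I = UNIV"
  proof (rule stable_trivial)
    have "(\<lambda>_. 0) \<in> K" using A_span_zero by (simp add: K_def)
    then show "0 \<in> I" unfolding I_def by (rule rev_image_eqI) simp
  next
    fix u v assume "u \<in> I" "v \<in> I"
    then obtain H H' where H: "u = H y" "H \<in> K" "v = H' y" "H' \<in> K"
      unfolding I_def by blast
    then have "(\<lambda>z. H z + H' z) \<in> K"
      using A_span_add[of H H'] by (simp add: K_def)
    then show "u + v \<in> I" unfolding I_def by (rule rev_image_eqI) (simp add: H)
  next
    fix a u assume "u \<in> I"
    then obtain H where H: "u = H y" "H \<in> K"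
      unfolding I_def by blast
    then have "(\<lambda>z. a * H z) \<in> K"
      using A_span_scale[of H a] by (simp add: K_def)
    then show "a * u \<in> I" unfolding I_def by (rule rev_image_eqI) (simp add: H)
  next
    fix \<alpha> u assume \<alpha>: "\<alpha> \<in> J" and "u \<in> I"
    then obtain H where H: "u = H y" "H \<in> K"
      unfolding I_def by blast
    then have "(\<lambda>z. \<alpha> (H z)) \<in> K"
      using A_span_comp[OF \<alpha>, of H] J_zero[OF \<alpha>] by (simp add: K_def)
    then show "\<alpha> u \<in> I" unfolding I_def by (rule rev_image_eqI) (simp add: H)
  qed
  moreover have "G \<in> K" using G by (simp add: K_def)
  then have "G y \<in> I" unfolding I_def by (rule imageI)
  ultimately have "1 \<in> I" using G(3) by (metis UNIV_I singletonD)
  then obtain H where "H \<in> K" and H1: "H y = 1"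
    unfolding I_def by (metis imageE)
  then have H: "H \<in> A_span" "\<And>j. j < k \<Longrightarrow> H (x j) = 0"
    by (simp_all add: K_def)
  define x' where "x' j = (if j = k then y else x j)" for j
  define F' where "F' i = (if i = k then H else (\<lambda>z. F i z - F i y * H z))" for i
  have "dual_system (Suc k) x' F'"
    unfolding dual_system_def
  proof (intro allI impI conjI)
    fix i assume i: "i < Suc k"
    show "F' i \<in> A_span"
    proof (cases "i = k")
      case True
      then show ?thesis by (simp add: F'_def H(1))
    next
      case False
      with i have "i < k" by simp
      from A_span_diff[OF F(1)[OF this] A_span_scale[OF H(1), of "F i y"]]
      have "(\<lambda>z. F i z - F i y * H z) \<in> A_span" .
      with False show ?thesis by (simp add: F'_def)
    qed
    fix j assume j: "j < Suc k"
    show "F' i (x' j) = (if i = j then 1 else 0)"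
    proof (cases "i = k")
      case True
      then show ?thesis using j by (cases "j = k") (simp_all add: F'_def x'_def H(2) H1)
    next
      case False
      with i have i': "i < k" by simp
      show ?thesis
      proof (cases "j = k")
        case True
        with False show ?thesis by (simp add: F'_def x'_def H1)
      next
        case j': False
        with j have "j < k" by simp
        from F(2)[OF i' this] H(2)[OF this] False j' show ?thesis
          by (simp add: F'_def x'_def)
      qed
    qed
  qed
  then show ?thesis by (intro exI)
qed

text \<open>
  Here the augmentation enters. If \<open>A J\<close> is spanned by \<open>n\<close> maps \<open>e\<^sub>l\<close>, then \<open>F\<^sub>i = \<Sum> a\<^sub>i\<^sub>l e\<^sub>l\<close> and the identity
  matrix of size \<open>k\<close> is the product of the matrices \<open>\<epsilon>(a\<^sub>i\<^sub>l)\<close> and \<open>\<epsilon>(e\<^sub>l(x\<^sub>j))\<close> over the division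
  ring \<open>D\<close>; this is impossible for \<open>k > n\<close>.
\<close>

lemma dual_system_bounded:
  fixes \<epsilon> :: "'a \<Rightarrow> 'd::division_ring" and n :: nat
  assumes \<epsilon>: "augmentation \<epsilon>" and ds: "dual_system k x F"
    and gen: "\<And>G. G \<in> A_span \<Longrightarrow> \<exists>a. \<forall>z. G z = (\<Sum>l<n. a l * e l z)"
  shows "k \<le> n"
proof (rule ccontr)
  assume "\<not> k \<le> n"
  have eps: "\<epsilon> 1 = 1" "\<epsilon> (u + v) = \<epsilon> u + \<epsilon> v" "\<epsilon> (u * v) = \<epsilon> u * \<epsilon> v" for u v
    using \<epsilon> by (auto simp: augmentation_def)
  note eps_sum = additive_rules[of \<epsilon>, OF eps(2)]
  have "\<forall>i\<in>{..<k}. \<exists>a. \<forall>z. F i z = (\<Sum>l<n. a l * e l z)"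
    using gen ds by (auto simp: dual_system_def)
  then obtain a where a: "\<And>i z. i < k \<Longrightarrow> F i z = (\<Sum>l<n. a i l * e l z)"
    by (auto simp: bchoice_iff)
  obtain d where d: "\<exists>i\<in>{..<k}. d i \<noteq> 0" "\<And>l. l < n \<Longrightarrow> (\<Sum>i<k. d i * \<epsilon> (a i l)) = 0"
    using ex_left_kernel_vector[of "{..<k}" n "\<lambda>i l. \<epsilon> (a i l)"] \<open>\<not> k \<le> n\<close> by auto
  have "d j = 0" if j: "j < k" for j
  proof -
    have "d j = (\<Sum>i<k. if i = j then d i else 0)"
      using j by simp
    also have "\<dots> = (\<Sum>i<k. d i * \<epsilon> (F i (x j)))"
      using ds j by (intro sum.cong) (auto simp: dual_system_def eps eps_sum)
    also have "\<dots> = (\<Sum>i<k. \<Sum>l<n. d i * \<epsilon> (a i l) * \<epsilon> (e l (x j)))"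
      by (intro sum.cong refl) (simp add: a eps_sum eps sum_distrib_left mult.assoc)
    also have "\<dots> = (\<Sum>l<n. (\<Sum>i<k. d i * \<epsilon> (a i l)) * \<epsilon> (e l (x j)))"
      by (subst sum.swap) (simp add: sum_distrib_right)
    also have "\<dots> = 0"
      by (simp add: d)
    finally show ?thesis .
  qed
  with d(1) show False by auto
qed

lemma ex_basis_over_fixed:
  fixes \<epsilon> :: "'a \<Rightarrow> 'd::division_ring" and n :: nat
  assumes \<epsilon>: "augmentation \<epsilon>"
    and gen: "\<And>G. G \<in> A_span \<Longrightarrow> \<exists>a. \<forall>z. G z = (\<Sum>l<n. a l * e l z)"
  obtains k x F where "dual_system k x F" "\<And>y. y = (\<Sum>j<k. x j * F j y)" "\<And>j y. j < k \<Longrightarrow> F j y \<in> B"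
proof -
  let ?P = "\<lambda>k. \<exists>x F. dual_system k x F"
  have "?P 0" by (simp add: dual_system_def)
  moreover have "\<not> ?P (Suc n)"
    using dual_system_bounded[OF \<epsilon> _ gen] by (metis Suc_n_not_le_n)
  ultimately obtain k where k: "?P k" "\<not> ?P (Suc k)"
    using nat_induct[of ?P "Suc n"] by blast
  then obtain x F where ds: "dual_system k x F" by blast
  have sep: "G y = 0" if "G \<in> A_span" "\<And>j. j < k \<Longrightarrow> G (x j) = 0" for G y
    using dual_system_extend[OF ds that] k(2) by blast
  show thesis
  proof (rule that[OF ds])
    show "y = (\<Sum>j<k. x j * F j y)" for y
      by (rule dual_system_expand_or_separate(1)[OF ds]) (rule sep)
    show "F j y \<in> B" if "j < k" for j y
      by (rule dual_system_expand_or_separate(2)[OF ds _ that]) (rule sep)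
  qed
qed

end

section \<open>Flatness and the Galois correspondence\<close>

lemma lmodule_fun_lmod:
  assumes J: "fun_submodule (centralizer C) J"
  shows "lmodule (centralizer C) (fun_lmod J)"
proof -
  have "comm_group (fun_lmod J)"
  proof (rule comm_groupI)
    fix \<alpha> assume "\<alpha> \<in> carrier (fun_lmod J)"
    then show "\<exists>\<beta>\<in>carrier (fun_lmod J). \<beta> \<otimes>\<^bsub>fun_lmod J\<^esub> \<alpha> = \<one>\<^bsub>fun_lmod J\<^esub>"
      using fun_submodule_minus[OF J, of \<alpha>] by (intro bexI[of _ "\<lambda>a. - \<alpha> a"]) auto
  qed (auto simp: fun_submoduleD[OF J] add_ac)
  then show ?thesis
    by (simp add: lmodule_def fun_submoduleD[OF J] distrib_left distrib_right mult.assoc)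
qed

text \<open>
  Tensoring \<open>0 \<rightarrow> J \<rightarrow> S\<close> with the flat module \<open>A\<^sub>V\<close> shows that \<open>A \<otimes>\<^sub>V J \<rightarrow> A \<otimes>\<^sub>V S\<close> is injective, and
  \<open>A \<otimes>\<^sub>V S\<close> embeds into \<open>End A\<close>. Hence a formal sum acting as zero on \<open>A\<close> is zero in \<open>A \<otimes>\<^sub>V J\<close>, and
  every balanced map kills it.
\<close>

lemma flat_eval_relations:
  assumes flat: "faithfully_flat TYPE('a \<Rightarrow> 'a) (centralizer C) (regular :: ('a::ring_1, 'a) bimod)"
    and qb: "right_quasibasis C C N \<gamma> u"
    and J: "J \<subseteq> End_bimod C C" "fun_submodule (centralizer C) J"
    and c: "Poly_Mapping.keys c \<subseteq> UNIV \<times> J" "\<And>x. frag_eval (\<lambda>a \<alpha>. a * \<alpha> x) c = 0"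
    and h: "balanced (centralizer C) regular (fun_lmod J) h" "\<And>a. h a (\<lambda>_. 0) = 0"
  shows "frag_eval h c = 0"
proof -
  let ?V = "centralizer C"
  \<comment> \<open>The zero module is realised inside the functions on \<open>A\<close>, as the test modules must share one type.\<close>
  let ?X = "fun_lmod {\<lambda>_. 0 :: 'a}" and ?Y = "fun_lmod J" and ?Z = "fun_lmod (End_bimod C C)"
  have mods: "fun_submodule ?V {\<lambda>_. 0}" "fun_submodule ?V J" "fun_submodule ?V (End_bimod C C)"
    using J(2) by (simp_all add: fun_submodule_def fun_submodule_End[unfolded fun_submodule_def])
  interpret X: tensor_factors ?V regular ?X by (rule tensor_factors_fun_lmod[OF mods(1)])
  interpret Y: tensor_factors ?V regular ?Y by (rule tensor_factors_fun_lmod[OF mods(2)])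
  interpret Z: tensor_factors ?V regular ?Z by (rule tensor_factors_fun_lmod[OF mods(3)])
  interpret XY: tensor_factors_map ?V regular ?X regular ?Y id id
    by unfold_locales (use fun_submoduleD(1)[OF J(2)] in \<open>simp_all add: hom_def\<close>)
  interpret YZ: tensor_factors_map ?V regular ?Y regular ?Z id id
    by unfold_locales (use J(1) in \<open>auto simp: hom_def\<close>)
  have "id \<in> lmodule_hom ?V ?X ?Y"
    using fun_submoduleD(1)[OF J(2)] by (simp add: lmodule_hom_def hom_def)
  moreover have "id \<in> lmodule_hom ?V ?Y ?Z"
    using J(1) by (auto simp: lmodule_hom_def hom_def)
  moreover have "exact_at ?X ?Y ?Z id id"
    using fun_submoduleD(1)[OF J(2)] by (auto simp: exact_at_def kernel_def)
  moreover note lmodule_fun_lmod[OF mods(1)] lmodule_fun_lmod[OF mods(2)] lmodule_fun_lmod[OF mods(3)]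
  ultimately have ex: "exact_at (tensor ?V regular ?X) (tensor ?V regular ?Y) (tensor ?V regular ?Z)
      (tensor_map ?V regular ?Y id id) (tensor_map ?V regular ?Z id id)"
    using flat unfolding faithfully_flat_def by blast
  have cZ: "Poly_Mapping.keys c \<subseteq> Z.pairs" and cY: "Poly_Mapping.keys c \<subseteq> Y.pairs"
    using c(1) J(1) by auto
  have "c \<in> Z.rels"
    using eval_injective[OF qb] cZ c(2) by simp
  then have "tensor_map ?V regular ?Z id id (Y.cls c) = \<one>\<^bsub>tensor ?V regular ?Z\<^esub>"
    using YZ.tensor_map_cls[OF cY] Z.cls_eq_one_iff[OF cZ] by simp
  then have "Y.cls c \<in> kernel (tensor ?V regular ?Y) (tensor ?V regular ?Z) (tensor_map ?V regular ?Z id id)"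
    using cY by (auto simp: kernel_def Y.carrier_tensor)
  then have "Y.cls c \<in> tensor_map ?V regular ?Y id id ` carrier (tensor ?V regular ?X)"
    using ex unfolding exact_at_def by simp
  then obtain d where d: "Poly_Mapping.keys d \<subseteq> X.pairs" "Y.cls c = tensor_map ?V regular ?Y id id (X.cls d)"
    unfolding X.carrier_tensor by blast
  have dY: "Poly_Mapping.keys d \<subseteq> Y.pairs"
    using d(1) fun_submoduleD(1)[OF J(2)] by auto
  have "Y.cls c = Y.cls d"
    using d(2) XY.tensor_map_cls[OF d(1)] by simp
  then have "frag_eval h c = frag_eval h d"
    by (rule Y.frag_eval_cls_eq[OF h(1) cY dY])
  also have "\<dots> = frag_eval (\<lambda>a \<alpha>. 0) d"
  proof (rule frag_eval_cong)
    fix a \<alpha> assume "(a, \<alpha>) \<in> Poly_Mapping.keys d"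
    then have "\<alpha> = (\<lambda>_. 0)" using d(1) by auto
    then show "h a \<alpha> = 0" by (simp add: h(2))
  qed
  finally show ?thesis by simp
qed

lemma square_class_sum_left:
  "frag_of (\<Sum>j\<in>K. m j, n) - (\<Sum>j\<in>K. frag_of (m j, n)) \<in> tensor_rels R regular regular"
proof (induction K rule: infinite_finite_induct)
  case (insert k K)
  have "frag_of (m k + (\<Sum>j\<in>K. m j), n) - frag_of (m k, n) - frag_of (\<Sum>j\<in>K. m j, n) \<in> tensor_rels R regular regular"
    using reg.rels_basic(1)[of "m k" "\<Sum>j\<in>K. m j" n R] by simp
  from reg.rels_closed(2)[OF this insert.IH] show ?case
    using insert.hyps by (simp add: algebra_simps)
qed (use reg.rels_closed(3)[OF reg.rels_basic(1)[of 0 0 n R]] in simp_all)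

text \<open>
  With a dual basis \<open>(x\<^sub>j, F\<^sub>j)\<close> of \<open>A\<close> over \<open>B\<close>, \<open>m \<otimes> n = \<Sum> x\<^sub>j F\<^sub>j(m) \<otimes> n = \<Sum> x\<^sub>j \<otimes> F\<^sub>j(m) n\<close>. So elements of
  \<open>A \<otimes>\<^sub>B A\<close> can be compared through their coordinates \<open>\<Sum> F\<^sub>j(m) n\<close> in \<open>A\<close>.
\<close>

lemma square_class_normal_form:
  fixes x :: "nat \<Rightarrow> 'a::ring_1"
  assumes F: "\<And>j y. j < k \<Longrightarrow> F j y \<in> B" and add: "\<And>j y z. j < k \<Longrightarrow> F j (y + z) = F j y + F j z"
    and exp: "\<And>y. y = (\<Sum>j<k. x j * F j y)"
  shows "square_class B c = square_class B (\<Sum>j<k. frag_of (x j, frag_eval (\<lambda>m n. F j m * n) c))"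
proof -
  let ?r = "tensor_rels B (regular :: ('a, 'a) bimod) (regular :: ('a, 'a) bimod)"
  have sum: "(\<Sum>j<k. r j) \<in> ?r" if "\<And>j. j < k \<Longrightarrow> r j \<in> ?r" for r
    using that by (intro reg.rels_sum) simp
  have "c - (\<Sum>j<k. frag_of (x j, frag_eval (\<lambda>m n. F j m * n) c)) \<in> ?r"
  proof (induction c rule: frag_pair_induct)
    case zero
    have "frag_of (x j, 0) \<in> ?r" for j
      using reg.rels_closed(3)[OF reg.rels_basic(2)[of "x j" 0 0 B]] by simp
    then have "- (\<Sum>j<k. frag_of (x j, 0)) \<in> ?r"
      by (intro reg.rels_closed(3) sum)
    then show ?case by simp
  next
    case (pair m n)
    have "frag_of (m, n) - (\<Sum>j<k. frag_of (x j * F j m, n)) \<in> ?r"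
      using square_class_sum_left[of "\<lambda>j. x j * F j m" "{..<k}" n B] by (simp flip: exp)
    moreover have "(\<Sum>j<k. frag_of (x j * F j m, n) - frag_of (x j, F j m * n)) \<in> ?r"
      using reg.rels_basic(3)[of _ _ B n] F by (intro sum) simp
    ultimately have "(frag_of (m, n) - (\<Sum>j<k. frag_of (x j * F j m, n)))
        + (\<Sum>j<k. frag_of (x j * F j m, n) - frag_of (x j, F j m * n)) \<in> ?r"
      by (rule reg.rels_closed(2))
    then show ?case by (simp add: sum_subtractf)
  next
    case (diff c d)
    let ?q = "\<lambda>j c. frag_eval (\<lambda>m n. F j m * n) c"
    have "(\<Sum>j<k. frag_of (x j, ?q j c) - frag_of (x j, ?q j (c - d)) - frag_of (x j, ?q j d)) \<in> ?r"
    proof (rule sum)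
      fix j
      show "frag_of (x j, ?q j c) - frag_of (x j, ?q j (c - d)) - frag_of (x j, ?q j d) \<in> ?r"
        using reg.rels_basic(2)[of "x j" "?q j (c - d)" "?q j d" B] by simp
    qed
    from reg.rels_closed(2)[OF reg.rels_closed(4)[OF diff] this] show ?case
      by (simp add: sum_subtractf)
  qed
  then show ?thesis
    by (subst reg.cls_eq_iff) auto
qed

text \<open>
  The elements \<open>u\<^sub>i = \<Sum> x\<^sub>j \<otimes> \<Phi>\<^sub>i(F\<^sub>j)\<close> form with the \<open>e\<^sub>i\<close> a right quasibasis for \<open>B\<close>; the retraction is given
  by \<open>y \<otimes> z \<mapsto> (e\<^sub>i(y) z)\<^sub>i\<close> and \<open>w \<mapsto> \<Sum> u\<^sub>i w\<^sub>i\<close>. The last hypothesis says \<open>\<Phi>\<^sub>i(F\<^sub>j(c -)) = \<Phi>\<^sub>i(F\<^sub>j) c\<close> and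
  makes the second map left \<open>C\<close>-linear.
\<close>

lemma bimodule_summand_tensor_squareI:
  fixes x :: "nat \<Rightarrow> 'a::ring_1"
  assumes F: "\<And>j y. j < k \<Longrightarrow> F j y \<in> B" "\<And>j y z. j < k \<Longrightarrow> F j (y + z) = F j y + F j z"
      "\<And>i j. i < k \<Longrightarrow> j < k \<Longrightarrow> F i (x j) = (if i = j then 1 else 0)"
      "\<And>y. y = (\<Sum>j<k. x j * F j y)"
    and e: "\<And>i. i < n \<Longrightarrow> e i \<in> End_bimod C B"
    and \<Phi>: "\<And>j y. j < k \<Longrightarrow> F j y = (\<Sum>i<n. \<Phi> i j * e i y)"
      "\<And>i j c. i < n \<Longrightarrow> j < k \<Longrightarrow> c \<in> C \<Longrightarrow> (\<Sum>l<k. F j (c * x l) * \<Phi> i l) = \<Phi> i j * c"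
  shows "bimodule_summand C UNIV (tensor_square B) (power_bimod regular n)"
proof -
  let ?T = "tensor_square B" and ?P = "power_bimod regular n :: ('a, nat \<Rightarrow> 'a) bimod"
  let ?c = "square_class B"
  define coord where "coord j c = frag_eval (\<lambda>m n. F j m * n) c" for j c
  have normal: "?c c = ?c (\<Sum>j<k. frag_of (x j, coord j c))" for c
    unfolding coord_def by (rule square_class_normal_form[OF F(1,2,4)])
  have coord_ext: "?c c = ?c d" if "\<And>j. j < k \<Longrightarrow> coord j c = coord j d" for c d
  proof -
    have "(\<Sum>j<k. frag_of (x j, coord j c)) = (\<Sum>j<k. frag_of (x j, coord j d))"
      using that by (intro sum.cong refl) simp
    then show ?thesis
      using normal[of c] normal[of d] by simp
  qed
  define rep where "rep t = (SOME c. t = ?c c)" for t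
  define f where "f t = (\<lambda>i\<in>{..<n}. frag_eval (\<lambda>y z. e i y * z) (rep t))" for t
  define q where "q w j = (\<Sum>i<n. \<Phi> i j * w i)" for w :: "nat \<Rightarrow> 'a" and j
  define g where "g w = ?c (\<Sum>j<k. frag_of (x j, q w j))" for w
  have bal: "balanced B regular regular (\<lambda>y z. e i y * z)" if "i < n" for i
    using e[OF that] by (simp add: balanced_regular End_bimod_iff distrib_left distrib_right mult.assoc)
  have f: "f (?c c) = (\<lambda>i\<in>{..<n}. frag_eval (\<lambda>y z. e i y * z) c)" for c
  proof -
    have "?c c = ?c (rep (?c c))"
      unfolding rep_def by (rule someI) (rule refl)
    then have "frag_eval (\<lambda>y z. e i y * z) (rep (?c c)) = frag_eval (\<lambda>y z. e i y * z) c" if "i < n" for i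
      using frag_eval_square_class_eq[OF bal[OF that], of c "rep (?c c)"] by simp
    then show ?thesis
      unfolding f_def by (intro restrict_ext) simp
  qed
  have coord_g: "coord j (\<Sum>l<k. frag_of (x l, p l)) = p j" if "j < k" for j p
  proof -
    have "coord j (\<Sum>l<k. frag_of (x l, p l)) = (\<Sum>l<k. if j = l then p l else 0)"
      unfolding coord_def frag_eval_sum frag_eval_frag_of
      by (intro sum.cong refl) (use F(3)[OF that] in simp)
    then show ?thesis using that by simp
  qed
  have fhom: "f \<in> bimodule_hom C UNIV ?T ?P"
  proof -
    have "f t \<in> extensional {..<n}" for t
      by (simp add: f_def)
    moreover have "f (?c c \<otimes>\<^bsub>?T\<^esub> ?c d) = f (?c c) \<otimes>\<^bsub>?P\<^esub> f (?c d)" for c d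
      unfolding tensor_square_simps f by (rule ext) simp
    moreover have "f (lact ?T a (?c c)) = lact ?P a (f (?c c))" if "a \<in> C" for a c
    proof -
      have "frag_eval (\<lambda>y z. e i (a * y) * z) c = a * frag_eval (\<lambda>y z. e i y * z) c" if "i < n" for i
        using e[OF that] \<open>a \<in> C\<close> by (simp add: End_bimod_iff mult.assoc frag_eval_mult_left)
      then show ?thesis
        unfolding tensor_square_lact f by (intro ext) (simp add: frag_eval_frag_map)
    qed
    moreover have "f (ract ?T (?c c) a) = ract ?P (f (?c c)) a" for a c
      unfolding tensor_square_ract f
      by (rule ext) (simp add: frag_eval_frag_map mult.assoc[symmetric] frag_eval_mult_right)
    ultimately show ?thesis
      unfolding bimodule_hom_def lmodule_hom_def hom_def tensor_square_simps(1)
      by (simp only: power_bimod_regular_simps(1)) blast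
  qed
  have ghom: "g \<in> bimodule_hom C UNIV ?P ?T"
  proof -
    have "g w \<in> carrier ?T" for w
      unfolding g_def tensor_square_simps by blast
    moreover have "g (w \<otimes>\<^bsub>?P\<^esub> w') = g w \<otimes>\<^bsub>?T\<^esub> g w'" for w w'
      unfolding g_def tensor_square_simps
    proof (rule coord_ext)
      fix j assume j: "j < k"
      have "q (w \<otimes>\<^bsub>?P\<^esub> w') j = q w j + q w' j"
        by (simp add: q_def distrib_left sum.distrib)
      moreover have "coord j (c + d) = coord j c + coord j d" for c d
        by (simp add: coord_def)
      ultimately show "coord j (\<Sum>j<k. frag_of (x j, q (w \<otimes>\<^bsub>?P\<^esub> w') j))
          = coord j ((\<Sum>j<k. frag_of (x j, q w j)) + (\<Sum>j<k. frag_of (x j, q w' j)))"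
        by (simp only: coord_g[OF j])
    qed
    moreover have "g (lact ?P a w) = lact ?T a (g w)" if "a \<in> C" for a w
      unfolding g_def tensor_square_lact
    proof (rule coord_ext)
      fix j assume j: "j < k"
      have "coord j (frag_map ((*) a) id (\<Sum>l<k. frag_of (x l, q w l))) = (\<Sum>l<k. F j (a * x l) * q w l)"
        by (simp add: coord_def frag_map_sum)
      also have "\<dots> = (\<Sum>i<n. (\<Sum>l<k. F j (a * x l) * \<Phi> i l) * w i)"
        unfolding q_def sum_distrib_left sum_distrib_right mult.assoc by (rule sum.swap)
      also have "\<dots> = q (lact ?P a w) j"
        unfolding q_def by (intro sum.cong refl) (simp add: \<Phi>(2)[OF _ j that] mult.assoc)
      finally show "coord j (\<Sum>l<k. frag_of (x l, q (lact ?P a w) l))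
          = coord j (frag_map ((*) a) id (\<Sum>l<k. frag_of (x l, q w l)))"
        by (simp only: coord_g[OF j])
    qed
    moreover have "g (ract ?P w a) = ract ?T (g w) a" for a w
      unfolding g_def tensor_square_ract
    proof (rule coord_ext)
      fix j assume j: "j < k"
      have "coord j (frag_map id (\<lambda>z. z * a) (\<Sum>l<k. frag_of (x l, q w l)))
          = coord j (\<Sum>l<k. frag_of (x l, q w l * a))"
        by (simp add: coord_def frag_map_sum)
      moreover have "q (ract ?P w a) j = q w j * a"
        by (simp add: q_def sum_distrib_right mult.assoc)
      ultimately show "coord j (\<Sum>l<k. frag_of (x l, q (ract ?P w a) l))
          = coord j (frag_map id (\<lambda>z. z * a) (\<Sum>l<k. frag_of (x l, q w l)))"
        by (simp only: coord_g[OF j])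
    qed
    ultimately show ?thesis
      unfolding bimodule_hom_def lmodule_hom_def hom_def by blast
  qed
  have gf: "g (f (?c c)) = ?c c" for c
    unfolding g_def
  proof (rule coord_ext)
    fix j assume j: "j < k"
    have "q (f (?c c)) j = (\<Sum>i<n. frag_eval (\<lambda>y z. \<Phi> i j * (e i y * z)) c)"
      unfolding q_def f by (intro sum.cong refl) (simp add: frag_eval_mult_left)
    also have "\<dots> = frag_eval (\<lambda>y z. \<Sum>i<n. \<Phi> i j * (e i y * z)) c"
      by (rule frag_eval_sum_fun[symmetric])
    also have "\<dots> = coord j c"
      unfolding coord_def by (rule frag_eval_cong) (simp add: \<Phi>(1)[OF j] sum_distrib_right mult.assoc)
    finally show "coord j (\<Sum>l<k. frag_of (x l, q (f (?c c)) l)) = coord j c"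
      by (simp only: coord_g[OF j])
  qed
  show ?thesis
    by (rule bimodule_summandI[OF comm_group_power_regular group_tensor_square fhom ghom _
          power_regular_act_hom tensor_square_act_hom])
      (use gf in \<open>auto simp: tensor_square_simps\<close>)
qed

text \<open>
  A dual basis \<open>(e\<^sub>i, \<phi>\<^sub>i)\<close> of \<open>J\<close> over \<open>V\<close> extends to one of \<open>A J\<close> over \<open>A\<close> by \<open>\<Phi>\<^sub>i(a \<alpha>) = a \<phi>\<^sub>i(\<alpha>)\<close>; flatness is
  what makes \<open>\<Phi>\<^sub>i\<close> well defined. As \<open>\<alpha>(c y) = c \<alpha>(y)\<close> and \<open>\<phi>\<^sub>i(\<alpha>)\<close> commutes with \<open>C\<close>, precomposition with
  \<open>c\<close> multiplies \<open>\<Phi>\<^sub>i\<close> by \<open>c\<close> from the right.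
\<close>

lemma (in coideal_subring) ex_A_span_coordinates:
  assumes flat: "faithfully_flat TYPE('a \<Rightarrow> 'a) (centralizer C) (regular :: ('a, 'a) bimod)"
    and qb: "right_quasibasis C C N \<gamma> u" and db: "dual_basis (centralizer C) J n e \<phi>"
  obtains \<Phi> where "\<And>F y. F \<in> A_span \<Longrightarrow> F y = (\<Sum>i<n. \<Phi> i F * e i y)"
    "\<And>i F c. i < n \<Longrightarrow> F \<in> A_span \<Longrightarrow> c \<in> C \<Longrightarrow> \<Phi> i (\<lambda>y. F (c * y)) = \<Phi> i F * c"
    "\<And>i F G. i < n \<Longrightarrow> F \<in> A_span \<Longrightarrow> G \<in> A_span \<Longrightarrow> \<Phi> i (\<lambda>y. F y + G y) = \<Phi> i F + \<Phi> i G"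
    "\<And>i F a. i < n \<Longrightarrow> F \<in> A_span \<Longrightarrow> \<Phi> i (\<lambda>y. a * F y) = a * \<Phi> i F"
proof -
  have \<phi>V: "\<phi> i \<alpha> \<in> centralizer C" and \<phi>_add: "\<phi> i (\<lambda>a. \<alpha> a + \<beta> a) = \<phi> i \<alpha> + \<phi> i \<beta>"
    and \<phi>_scale: "v \<in> centralizer C \<Longrightarrow> \<phi> i (\<lambda>a. v * \<alpha> a) = v * \<phi> i \<alpha>"
    if "i < n" "\<alpha> \<in> J" "\<beta> \<in> J" for i \<alpha> \<beta> v
    using db that by (auto simp: dual_basis_def)
  have exp: "\<alpha> a = (\<Sum>i<n. \<phi> i \<alpha> * e i a)" if "\<alpha> \<in> J" for \<alpha> a
    using db that unfolding dual_basis_def by blast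
  define rep where "rep F = (SOME c. Poly_Mapping.keys c \<subseteq> UNIV \<times> J \<and> F = span_map c)" for F
  define \<Phi> where "\<Phi> i F = frag_eval (\<lambda>a \<alpha>. a * \<phi> i \<alpha>) (rep F)" for i F
  have rep: "Poly_Mapping.keys (rep F) \<subseteq> UNIV \<times> J" "F = span_map (rep F)" if "F \<in> A_span" for F
  proof -
    have "\<exists>c. Poly_Mapping.keys c \<subseteq> UNIV \<times> J \<and> F = span_map c"
      using that unfolding A_span_def by blast
    from someI_ex[OF this] show "Poly_Mapping.keys (rep F) \<subseteq> UNIV \<times> J" "F = span_map (rep F)"
      unfolding rep_def by blast+
  qed
  have \<Phi>: "\<Phi> i F = frag_eval (\<lambda>a \<alpha>. a * \<phi> i \<alpha>) c"
    if i: "i < n" and c: "Poly_Mapping.keys c \<subseteq> UNIV \<times> J" "F = span_map c" for i F c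
  proof -
    have F: "F \<in> A_span" using c unfolding A_span_def by blast
    have "frag_eval (\<lambda>a \<alpha>. a * \<phi> i \<alpha>) (rep F - c) = 0"
    proof (rule flat_eval_relations[OF flat qb J_subset_S J_mod])
      show "Poly_Mapping.keys (rep F - c) \<subseteq> UNIV \<times> J"
        using keys_diff[of "rep F" c] c(1) rep(1)[OF F] by blast
      have "span_map (rep F) = span_map c"
        using rep(2)[OF F, symmetric] c(2) by (rule trans)
      then show "frag_eval (\<lambda>a \<alpha>. a * \<alpha> x) (rep F - c) = 0" for x
        by (simp add: fun_eq_iff span_map_def)
      show "balanced (centralizer C) regular (fun_lmod J) (\<lambda>a \<alpha>. a * \<phi> i \<alpha>)"
        unfolding balanced_def
        by (simp add: distrib_left distrib_right \<phi>_add[OF i] \<phi>_scale[OF i] mult.assoc)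
      have z: "(\<lambda>_. 0) \<in> J" by (rule fun_submoduleD(1)[OF J_mod])
      from \<phi>_add[OF i z z] show "a * \<phi> i (\<lambda>_. 0) = 0" for a
        by simp
    qed
    then show ?thesis by (simp add: \<Phi>_def)
  qed
  show thesis
  proof
    show "F y = (\<Sum>i<n. \<Phi> i F * e i y)" if F: "F \<in> A_span" for F y
    proof -
      have "F y = frag_eval (\<lambda>a \<alpha>. a * \<alpha> y) (rep F)"
        by (subst rep(2)[OF F]) (rule span_map_def)
      also have "\<dots> = frag_eval (\<lambda>a \<alpha>. \<Sum>i<n. a * \<phi> i \<alpha> * e i y) (rep F)"
      proof (rule frag_eval_cong)
        fix a \<alpha> assume "(a, \<alpha>) \<in> Poly_Mapping.keys (rep F)"
        then have "\<alpha> \<in> J" using rep(1)[OF F] by blast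
        from exp[OF this, of y] show "a * \<alpha> y = (\<Sum>i<n. a * \<phi> i \<alpha> * e i y)"
          by (simp add: sum_distrib_left mult.assoc)
      qed
      also have "\<dots> = (\<Sum>i<n. \<Phi> i F * e i y)"
        unfolding frag_eval_sum_fun frag_eval_mult_right \<Phi>_def ..
      finally show ?thesis .
    qed
  next
    fix i F c assume i: "i < n" and F: "F \<in> A_span" and c: "c \<in> C"
    let ?d = "frag_map (\<lambda>a. a * c) id (rep F)"
    have "Poly_Mapping.keys ?d \<subseteq> UNIV \<times> J"
      using rep(1)[OF F] by (intro keys_frag_map) auto
    moreover have "(\<lambda>y. F (c * y)) = span_map ?d"
    proof
      fix y
      have "F (c * y) = frag_eval (\<lambda>a \<alpha>. a * \<alpha> (c * y)) (rep F)"
        by (subst rep(2)[OF F]) (rule span_map_def)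
      also have "\<dots> = frag_eval (\<lambda>a \<alpha>. a * c * \<alpha> y) (rep F)"
      proof (rule frag_eval_cong)
        fix a \<alpha> assume "(a, \<alpha>) \<in> Poly_Mapping.keys (rep F)"
        then have "\<alpha> \<in> J" using rep(1)[OF F] by blast
        from J_linear(2)[OF this c] show "a * \<alpha> (c * y) = a * c * \<alpha> y"
          by (simp add: mult.assoc)
      qed
      finally show "F (c * y) = span_map ?d y"
        by (simp add: span_map_def frag_eval_frag_map)
    qed
    ultimately have "\<Phi> i (\<lambda>y. F (c * y)) = frag_eval (\<lambda>a \<alpha>. a * c * \<phi> i \<alpha>) (rep F)"
      using \<Phi>[OF i] by (simp add: frag_eval_frag_map)
    also have "\<dots> = frag_eval (\<lambda>a \<alpha>. a * \<phi> i \<alpha> * c) (rep F)"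
    proof (rule frag_eval_cong)
      fix a \<alpha> assume "(a, \<alpha>) \<in> Poly_Mapping.keys (rep F)"
      then have "\<alpha> \<in> J" using rep(1)[OF F] by blast
      then have "\<phi> i \<alpha> * c = c * \<phi> i \<alpha>"
        using \<phi>V[OF i, of \<alpha> \<alpha>] c by (simp add: centralizer_def)
      then show "a * c * \<phi> i \<alpha> = a * \<phi> i \<alpha> * c"
        by (simp add: mult.assoc)
    qed
    finally show "\<Phi> i (\<lambda>y. F (c * y)) = \<Phi> i F * c"
      by (simp add: frag_eval_mult_right \<Phi>_def)
  next
    fix i F G assume i: "i < n" and F: "F \<in> A_span" and G: "G \<in> A_span"
    have "Poly_Mapping.keys (rep F + rep G) \<subseteq> UNIV \<times> J"
      using keys_add[of "rep F" "rep G"] rep(1)[OF F] rep(1)[OF G] by blast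
    moreover have "(\<lambda>y. F y + G y) = span_map (rep F + rep G)"
      by (rule ext) (simp add: span_map_simps flip: rep(2)[OF F] rep(2)[OF G])
    ultimately show "\<Phi> i (\<lambda>y. F y + G y) = \<Phi> i F + \<Phi> i G"
      using \<Phi>[OF i] by (simp add: \<Phi>_def[of i F] \<Phi>_def[of i G])
  next
    fix i F a assume i: "i < n" and F: "F \<in> A_span"
    have "Poly_Mapping.keys (frag_map ((*) a) id (rep F)) \<subseteq> UNIV \<times> J"
      using rep(1)[OF F] by (intro keys_frag_map) auto
    moreover have "(\<lambda>y. a * F y) = span_map (frag_map ((*) a) id (rep F))"
    proof
      fix y
      have "F y = span_map (rep F) y" by (rule fun_cong[OF rep(2)[OF F]])
      then show "a * F y = span_map (frag_map ((*) a) id (rep F)) y"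
        by (simp add: span_map_def frag_eval_frag_map mult.assoc frag_eval_mult_left)
    qed
    ultimately show "\<Phi> i (\<lambda>y. a * F y) = a * \<Phi> i F"
      using \<Phi>[OF i] by (simp add: \<Phi>_def[of i F] frag_eval_frag_map mult.assoc frag_eval_mult_left)
  qed
qed

text \<open>
  Let \<open>(x\<^sub>j, F\<^sub>j)\<close> be the basis of \<open>A\<close> over \<open>B = A\<^sup>J\<close> with \<open>F\<^sub>j \<in> A J\<close>. A right \<open>B\<close>-linear \<open>\<beta>\<close> is
  \<open>\<Sum> \<beta>(x\<^sub>l) F\<^sub>l\<close>, hence in \<open>A J\<close>. If it is left \<open>C\<close>-linear too, then
  \<open>c \<Phi>\<^sub>i(\<beta>) = \<Phi>\<^sub>i(\<beta>(c -)) = \<Phi>\<^sub>i(\<beta>) c\<close>, so its coordinates lie in \<open>V\<close> and \<open>\<beta> \<in> V J = J\<close>.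
\<close>

lemma (in galois_subring) End_fixed_and_left_D3:
  fixes \<epsilon> :: "'a \<Rightarrow> 'd::division_ring"
  assumes \<epsilon>: "augmentation \<epsilon>"
    and flat: "faithfully_flat TYPE('a \<Rightarrow> 'a) (centralizer C) (regular :: ('a, 'a) bimod)"
    and qb: "right_quasibasis C C N \<gamma> u" and db: "dual_basis (centralizer C) J n e \<phi>"
  shows "End_bimod C B = J" "left_D3 C B"
proof -
  obtain \<Phi> where \<Phi>: "\<And>F y. F \<in> A_span \<Longrightarrow> F y = (\<Sum>i<n. \<Phi> i F * e i y)"
    "\<And>i F c. i < n \<Longrightarrow> F \<in> A_span \<Longrightarrow> c \<in> C \<Longrightarrow> \<Phi> i (\<lambda>y. F (c * y)) = \<Phi> i F * c"
    "\<And>i F G. i < n \<Longrightarrow> F \<in> A_span \<Longrightarrow> G \<in> A_span \<Longrightarrow> \<Phi> i (\<lambda>y. F y + G y) = \<Phi> i F + \<Phi> i G"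
    "\<And>i F a. i < n \<Longrightarrow> F \<in> A_span \<Longrightarrow> \<Phi> i (\<lambda>y. a * F y) = a * \<Phi> i F"
    by (rule ex_A_span_coordinates[OF flat qb db]) (rule that; assumption)
  have eJ: "e i \<in> J" if "i < n" for i
    using db that by (simp add: dual_basis_def)
  have \<Phi>_sum: "\<Phi> i (\<lambda>y. \<Sum>l<k. a l * F l y) = (\<Sum>l<k. a l * \<Phi> i (F l))"
    if i: "i < n" and F: "\<And>l. l < k \<Longrightarrow> F l \<in> A_span" for i a F and k :: nat
    using F
  proof (induction k)
    case 0
    then show ?case
      using \<Phi>(4)[OF i A_span_zero, of 0] by simp
  next
    case (Suc k)
    have "(\<lambda>y. \<Sum>l<k. a l * F l y) \<in> A_span"
      by (rule A_span_sum) (simp add: Suc.prems)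
    then show ?case
      using \<Phi>(3)[OF i _ A_span_scale[of "F k" "a k"]] \<Phi>(4)[OF i, of "F k" "a k"] Suc by simp
  qed
  have gen: "\<exists>a. \<forall>z. G z = (\<Sum>l<n. a l * e l z)" if "G \<in> A_span" for G
    by (rule exI[of _ "\<lambda>l. \<Phi> l G"], rule allI) (rule \<Phi>(1)[OF that])
  obtain k x F where ds: "dual_system k x F" and exp: "\<And>y. y = (\<Sum>j<k. x j * F j y)"
    and FB: "\<And>j y. j < k \<Longrightarrow> F j y \<in> B"
    by (rule ex_basis_over_fixed[OF \<epsilon> gen]) (assumption, (rule that; assumption))
  note F = dual_systemD[OF ds]
  have expand: "G (c * y) = (\<Sum>l<k. G (c * x l) * F l y)"
    if G: "\<And>u v. G (u + v) = G u + G v" "\<And>u b. b \<in> B \<Longrightarrow> G (u * b) = G u * b" for G c y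
  proof -
    have "c * y = (\<Sum>l<k. c * x l * F l y)"
      by (subst exp[of y]) (simp only: sum_distrib_left mult.assoc)
    then have "G (c * y) = G (\<Sum>l<k. c * x l * F l y)"
      by (rule arg_cong)
    moreover have "G (\<Sum>l<k. c * x l * F l y) = (\<Sum>l<k. G (c * x l * F l y))"
      by (rule additive_rules(4)[of G, OF G(1)])
    moreover have "(\<Sum>l<k. G (c * x l * F l y)) = (\<Sum>l<k. G (c * x l) * F l y)"
    proof (intro sum.cong refl)
      fix l assume "l \<in> {..<k}"
      then have "F l y \<in> B" by (intro FB) simp
      then show "G (c * x l * F l y) = G (c * x l) * F l y" by (rule G(2))
    qed
    ultimately show ?thesis by (simp only:)
  qed
  show "End_bimod C B = J"
  proof (rule antisym[OF _ J_subset_End_fixed], rule subsetI)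
    fix \<beta> assume \<beta>: "\<beta> \<in> End_bimod C B"
    have \<beta>_linear: "\<beta> (u + v) = \<beta> u + \<beta> v" "b \<in> B \<Longrightarrow> \<beta> (u * b) = \<beta> u * b" for u v b
      using \<beta> by (simp_all add: End_bimod_iff)
    have "\<beta> = (\<lambda>y. \<Sum>l<k. \<beta> (x l) * F l y)"
    proof
      fix y
      show "\<beta> y = (\<Sum>l<k. \<beta> (x l) * F l y)"
        using expand[of \<beta> 1 y, OF \<beta>_linear] by (simp only: mult_1_left)
    qed
    moreover have "(\<lambda>y. \<Sum>l<k. \<beta> (x l) * F l y) \<in> A_span"
      by (rule A_span_sum) (simp add: F(1))
    ultimately have span: "\<beta> \<in> A_span" by (simp only:)
    have "\<Phi> i \<beta> \<in> centralizer C" if i: "i < n" for i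
    proof -
      have "\<Phi> i \<beta> * c = c * \<Phi> i \<beta>" if c: "c \<in> C" for c
      proof -
        have "(\<lambda>y. \<beta> (c * y)) = (\<lambda>y. c * \<beta> y)"
          using \<beta> c by (simp add: End_bimod_iff)
        then show ?thesis
          using \<Phi>(2)[OF i span c] \<Phi>(4)[OF i span, of c] by simp
      qed
      then show ?thesis by (simp add: centralizer_def)
    qed
    then have "(\<lambda>y. \<Sum>i<n. \<Phi> i \<beta> * e i y) \<in> J"
      by (intro fun_submodule_sum[OF J_mod]) (simp_all add: eJ)
    moreover have "\<beta> = (\<lambda>y. \<Sum>i<n. \<Phi> i \<beta> * e i y)"
      by (rule ext) (rule \<Phi>(1)[OF span])
    ultimately show "\<beta> \<in> J" by (simp only:)
  qed
  have "bimodule_summand C UNIV (tensor_square B) (power_bimod regular n)"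
  proof (rule bimodule_summand_tensor_squareI[where x = x and F = F and e = e
        and \<Phi> = "\<lambda>i j. \<Phi> i (F j)"])
    show "e i \<in> End_bimod C B" if "i < n" for i
      using eJ[OF that] J_subset_End_fixed by blast
    show "(\<Sum>l<k. F j (c * x l) * \<Phi> i (F l)) = \<Phi> i (F j) * c" if "i < n" "j < k" "c \<in> C" for i j c
    proof -
      have "(\<lambda>y. F j (c * y)) = (\<lambda>y. \<Sum>l<k. F j (c * x l) * F l y)"
        by (intro ext expand A_span_additive A_span_right_linear F(1)[OF that(2)])
      then have "\<Phi> i (\<lambda>y. F j (c * y)) = (\<Sum>l<k. F j (c * x l) * \<Phi> i (F l))"
        using \<Phi>_sum[OF that(1), of k F "\<lambda>l. F j (c * x l)"] F(1) by simp
      then show ?thesis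
        using \<Phi>(2)[OF that(1) F(1)[OF that(2)] that(3)] by simp
    qed
    show "F j (y + z) = F j y + F j z" if "j < k" for j y z
      by (rule A_span_additive[OF F(1)[OF that]])
    show "F i (x j) = (if i = j then 1 else 0)" if "i < k" "j < k" for i j
      by (rule F(2)[OF that])
    show "F j y = (\<Sum>i<n. \<Phi> i (F j) * e i y)" if "j < k" for j y
      by (rule \<Phi>(1)[OF F(1)[OF that]])
  qed (rule FB exp, assumption?)+
  moreover have "n > 0"
  proof (rule ccontr)
    assume "\<not> n > 0"
    then have "id (1 :: 'a) = 0"
      using \<Phi>(1)[OF A_span_base[OF J_id], of 1] by simp
    then show False by simp
  qed
  ultimately show "left_D3 C B"
    unfolding left_D3_def using unital_subring_fixed C_subset_fixed by blast
qed

theorem theorem6p3: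
  fixes \<epsilon> :: "'a::ring_1 \<Rightarrow> 'd::division_ring"
    and C V :: "'a set"
    and D3rings :: "'a set set"
    and Galois :: "('a \<Rightarrow> 'a) set set"
  assumes "augmentation \<epsilon>"
    and "division_subring C"
    and "depth_two C"
    and "V = centralizer C"
    and "faithfully_flat TYPE('a \<Rightarrow> 'a) V (regular :: ('a, 'a) bimod)"
    and "D3rings = {B. left_D3 C B \<and> division_subring B}"
    and "Galois = {J. galois_left_coideal_subring C J}"
  shows "bij_betw (\<lambda>B. End_bimod C B) D3rings Galois
    \<and> bij_betw fixed_points Galois D3rings
    \<and> (\<forall>B\<in>D3rings. fixed_points (End_bimod C B) = B)
    \<and> (\<forall>J\<in>Galois. End_bimod C (fixed_points J) = J)
    \<and> antimono_on D3rings (\<lambda>B. End_bimod C B)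
    \<and> antimono_on Galois fixed_points"
proof -
  obtain N where D2: "bimodule_summand UNIV C (tensor_square C) (power_bimod regular N)"
    "bimodule_summand C UNIV (tensor_square C) (power_bimod regular N)"
    using assms(3) unfolding depth_two_def by blast
  obtain \<gamma> u where left: "left_quasibasis C N \<gamma> u"
    by (rule ex_left_quasibasis[OF D2(1)])
  obtain \<gamma>' u' where right: "right_quasibasis C C N \<gamma>' u'"
    by (rule ex_right_quasibasis[OF D2(2)])
  have D3: "End_bimod C B \<in> Galois \<and> fixed_points (End_bimod C B) = B" if "B \<in> D3rings" for B
  proof -
    have B: "left_D3 C B" "division_subring B"
      using that assms(6) by auto
    then obtain n where "C \<subseteq> B"
      and summand: "bimodule_summand C UNIV (tensor_square B) (power_bimod regular n)"
      unfolding left_D3_def by blast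
    obtain e v where qb: "right_quasibasis C B n e v"
      by (rule ex_right_quasibasis[OF summand])
    show ?thesis
      using galois_left_coideal_subring_End[OF left right qb B(2) \<open>C \<subseteq> B\<close>]
        right_quasibasis.fixed_points_End[OF qb B(2)] assms(7) by simp
  qed
  have Gal: "fixed_points J \<in> D3rings \<and> End_bimod C (fixed_points J) = J" if "J \<in> Galois" for J
  proof -
    have J: "left_coideal_subring C J" "fin_generated (centralizer C) ((S_bimod C)\<lparr>carrier := J\<rparr>)"
      "projective (centralizer C) ((S_bimod C)\<lparr>carrier := J\<rparr>)"
      and stable: "\<And>I. lsubmodule UNIV regular I \<Longrightarrow> (\<And>\<alpha>. \<alpha> \<in> J \<Longrightarrow> \<alpha> ` I \<subseteq> I) \<Longrightarrow> I = {0} \<or> I = UNIV"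
      using that assms(7) unfolding galois_left_coideal_subring_def by auto
    note J' = J(1)[unfolded left_coideal_subring_iff[OF left right]]
    interpret galois_subring C J
    proof
      show "I = {0} \<or> I = UNIV"
        if "0 \<in> I" "\<And>x y. x \<in> I \<Longrightarrow> y \<in> I \<Longrightarrow> x + y \<in> I" "\<And>a x. x \<in> I \<Longrightarrow> a * x \<in> I"
          "\<And>\<alpha> x. \<alpha> \<in> J \<Longrightarrow> x \<in> I \<Longrightarrow> \<alpha> x \<in> I" for I
        by (rule stable) (use that in \<open>auto simp: lsubmodule_regular_iff\<close>)
    qed (use J' in blast)+
    obtain n e \<phi> where db: "dual_basis (centralizer C) J n e \<phi>"
      by (rule ex_dual_basis[OF J_mod J(2,3)])
    have flat: "faithfully_flat TYPE('a \<Rightarrow> 'a) (centralizer C) (regular :: ('a, 'a) bimod)"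
      using assms(4,5) by simp
    show ?thesis
      using End_fixed_and_left_D3[OF assms(1) flat right db] division_subring_fixed assms(6) by simp
  qed
  have "bij_betw (\<lambda>B. End_bimod C B) D3rings Galois"
    by (rule bij_betw_byWitness[where f' = fixed_points]) (use D3 Gal in auto)
  moreover have "bij_betw fixed_points Galois D3rings"
    by (rule bij_betw_byWitness[where f' = "End_bimod C"]) (use D3 Gal in auto)
  moreover have "antimono_on D3rings (\<lambda>B. End_bimod C B)"
  proof (rule monotone_onI)
    fix B B' :: "'a set" assume "B \<le> B'"
    then show "End_bimod C B' \<le> End_bimod C B"
      unfolding End_bimod_iff subset_iff by blast
  qed
  moreover have "antimono_on Galois fixed_points"
    by (rule monotone_onI) (auto simp: fixed_points_def)
  ultimately show ?thesis
    using D3 Gal by blast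
qed

end
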